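(* Let $K\subset\mathbb{R}^n$ be a convex body containing the origin in its interior. If $f(x)=e^{-\|x\|_K^2/2}$ for $x\in\mathbb{R}^n$, then $$\Gamma_{-2}f(x)=e^{-\frac{\|x\|_{\Gamma_{-2}K}^2}{2}}\qquad\text{for all }x\in\mathbb{R}^n,$$ where on the left $\Gamma_{-2}f$ is the functional LYZ ellipsoid of $f$ and on the right $\Gamma_{-2}K$ is the LYZ ellipsoid of $K$.
   Context: A convex body is a compact convex set with nonempty interior. For a convex body $K$ containing the origin in its interior: the Minkowski functional is $\|x\|_K=\min\{t\ge 0: x\in tK\}$; the radial function is $\rho_K(x)=\max\{t\ge 0: tx\in K\}$ for $x\ne 0$ (so $\rho_K(x)=1/\|x\|_K$); $h_K(v)=\max_{x\in K}\langle x,v\rangle$ is the support function; $V(K)$ is the volume; $S(K,\cdot)$ is the classical surface area measure on the unit sphere $S^{n-1}$; and the $L_2$ surface area measure $S_2(K,\cdot)$ is defined by $dS_2(K,\cdot)=h_K^{-1}\,dS(K,\cdot)$. The LYZ ellipsoid $\Gamma_{-2}K$ of $K$ is the origin-centered ellipsoid defined by $$\rho_{\Gamma_{-2}K}^{-2}(u)=\frac{1}{V(K)}\int_{S^{n-1}}|\langle u,v\rangle|^2\,dS_2(K,v),\qquad u\in S^{n-1}.$$ Let $f=e^{-\varphi}$ be an integrable log-concave function on $\mathbb{R}^n$, where $\varphi:\mathbb{R}^n\to\mathbb{R}\cup\{+\infty\}$ is convex. Put $J(f)=\int_{\mathbb{R}^n}f\,dx$. The support function of $f$ is the Legendre conjugate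 $h_f(x)=\varphi^*(x)=\sup_{y\in\mathbb{R}^n}\{\langle x,y\rangle-\varphi(y)\}$. The surface area measure $\mu_f$ of $f$ is the push-forward under $\nabla\varphi$ of the measure with density $f$ with respect to Lebesgue measure, i.e. $\int g\,d\mu_f=\int_{\mathbb{R}^n}g(\nabla\varphi(x))f(x)\,dx$. The functional LYZ ellipsoid $\Gamma_{-2}f$ of $f$ is defined by $$-\log\Gamma_{-2}f(x)=\frac{n}{4J(f)}\int_{\mathbb{R}^n}|\langle x,y\rangle|^2\,h_f(y)^{-1}\,d\mu_f(y),\qquad x\in\mathbb{R}^n.$$ *)

theory Defs
  imports "HOL-Analysis.Analysis"
begin

definition convex_body :: "'a::euclidean_space set \<Rightarrow> bool" where
  "convex_body K \<longleftrightarrow> compact K \<and> convex K \<and> interior K \<noteq> {}"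

text \<open>
  For a convex body with the origin in its interior the infimum and the suprema in the next three
  definitions are attained, so they are the minimum and the maxima of the usual definitions.
\<close>

definition minkowski_functional :: "'a::euclidean_space set \<Rightarrow> 'a \<Rightarrow> real" where
  "minkowski_functional K x = Inf {t. 0 \<le> t \<and> x \<in> (\<lambda>y. t *\<^sub>R y) ` K}"

definition radial_function :: "'a::euclidean_space set \<Rightarrow> 'a \<Rightarrow> real" where
  "radial_function K x = Sup {t. 0 \<le> t \<and> t *\<^sub>R x \<in> K}"

definition support_function :: "'a::euclidean_space set \<Rightarrow> 'a \<Rightarrow> real" where
  "support_function K v = (SUP x\<in>K. x \<bullet> v)"

text \<open>
  The \<open>d\<close>-dimensional Hausdorff (outer) measure, with the normalization for which it agrees with
  Lebesgue measure on \<open>d\<close>-dimensional Euclidean space: a set of diameter \<open>r\<close> is weighted like a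
  \<open>d\<close>-dimensional ball of diameter \<open>r\<close>. The empty set is treated separately because
  \<open>diameter {} ^ 0 = 1\<close>.
\<close>

definition hausdorff_weight :: "nat \<Rightarrow> 'a::metric_space set \<Rightarrow> ennreal" where
  "hausdorff_weight d C =
     (if C = {} then 0 else ennreal (unit_ball_vol (real d) * (diameter C / 2) ^ d))"

definition hausdorff_premeasure :: "nat \<Rightarrow> real \<Rightarrow> 'a::metric_space set \<Rightarrow> ennreal" where
  "hausdorff_premeasure d \<delta> A =
     Inf {\<Sum>i. hausdorff_weight d (C i) | C :: nat \<Rightarrow> 'a set.
            A \<subseteq> (\<Union>i. C i) \<and> (\<forall>i. bounded (C i) \<and> diameter (C i) \<le> \<delta>)}"

definition hausdorff_measure :: "nat \<Rightarrow> 'a::metric_space set \<Rightarrow> ennreal" where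
  "hausdorff_measure d A = (SUP \<delta>\<in>{0<..}. hausdorff_premeasure d \<delta> A)"

definition reverse_spherical_image :: "'a::euclidean_space set \<Rightarrow> 'a set \<Rightarrow> 'a set" where
  "reverse_spherical_image K \<omega> =
     {x \<in> frontier K. \<exists>v\<in>\<omega>. norm v = 1 \<and> (\<forall>y\<in>K. y \<bullet> v \<le> x \<bullet> v)}"

text \<open>
  The classical surface area measure, a Borel measure on the unit sphere. Boundary points with more
  than one outer unit normal form a null set, which is why this set function is additive.
\<close>

definition surface_area_measure :: "(real ^ 'n) set \<Rightarrow> (real ^ 'n) measure" where
  "surface_area_measure K =
     measure_of (sphere 0 1) (sets (restrict_space borel (sphere 0 1)))
       (\<lambda>\<omega>. hausdorff_measure (CARD('n) - 1) (reverse_spherical_image K \<omega>))"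

definition L2_surface_area_measure :: "(real ^ 'n) set \<Rightarrow> (real ^ 'n) measure" where
  "L2_surface_area_measure K =
     density (surface_area_measure K) (\<lambda>v. ennreal (1 / support_function K v))"

definition centered_ellipsoid :: "(real ^ 'n) set \<Rightarrow> bool" where
  "centered_ellipsoid E \<longleftrightarrow>
     (\<exists>A :: real ^ 'n ^ 'n. transpose A = A \<and> (\<forall>x. x \<noteq> 0 \<longrightarrow> 0 < x \<bullet> (A *v x)) \<and>
        E = {x. x \<bullet> (A *v x) \<le> 1})"

definition LYZ_ellipsoid :: "(real ^ 'n) set \<Rightarrow> (real ^ 'n) set" where
  "LYZ_ellipsoid K =
     (THE E. centered_ellipsoid E \<and>
        (\<forall>u\<in>sphere 0 1. 1 / (radial_function E u)\<^sup>2 =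
           1 / measure lebesgue K * (LINT v|L2_surface_area_measure K. \<bar>u \<bullet> v\<bar>\<^sup>2)))"

definition neg_log :: "('a \<Rightarrow> real) \<Rightarrow> 'a \<Rightarrow> ereal" where
  "neg_log f x = (if f x \<le> 0 then \<infinity> else ereal (- ln (f x)))"

definition legendre_conjugate :: "('a::real_inner \<Rightarrow> ereal) \<Rightarrow> 'a \<Rightarrow> ereal" where
  "legendre_conjugate \<phi> x = (SUP y. ereal (x \<bullet> y) - \<phi> y)"

definition functional_support :: "('a::real_inner \<Rightarrow> real) \<Rightarrow> 'a \<Rightarrow> ereal" where
  "functional_support f = legendre_conjugate (neg_log f)"

text \<open>
  The gradient is set to \<open>0\<close> at points of non-differentiability. For log-concave \<open>f\<close>, almost every
  point with \<open>f x > 0\<close> is an interior point of the domain at which \<open>neg_log f\<close> is finite and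
  differentiable, so neither this convention nor the value of \<open>real_of_ereal\<close> at \<open>\<infinity>\<close> affects the
  measure below.
\<close>

definition gradient :: "('a::real_inner \<Rightarrow> real) \<Rightarrow> 'a \<Rightarrow> 'a" where
  "gradient F x = (if \<exists>D. GDERIV F x :> D then THE D. GDERIV F x :> D else 0)"

definition functional_surface_area_measure ::
    "('a::euclidean_space \<Rightarrow> real) \<Rightarrow> 'a measure" where
  "functional_surface_area_measure f =
     distr (density lebesgue (\<lambda>x. ennreal (f x))) borel
       (gradient (\<lambda>x. real_of_ereal (neg_log f x)))"

definition total_mass :: "('a::euclidean_space \<Rightarrow> real) \<Rightarrow> real" where
  "total_mass f = (LINT x|lebesgue. f x)"

text \<open>
  The reciprocal of the support function is taken in the extended reals, so it is \<open>0\<close> where the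
  support function is infinite. At zeros of the support function the coercion to the reals yields
  \<open>0\<close>; in the case \<open>f = exp (- \<parallel>x\<parallel>\<^sup>2 / 2)\<close> for the gauge of a convex body, the origin is the only
  zero and has measure zero.
\<close>

definition functional_LYZ_ellipsoid :: "(real ^ 'n \<Rightarrow> real) \<Rightarrow> real ^ 'n \<Rightarrow> real" where
  "functional_LYZ_ellipsoid f x =
     exp (- (real CARD('n) / (4 * total_mass f) *
       (LINT y|functional_surface_area_measure f.
          \<bar>x \<bullet> y\<bar>\<^sup>2 * real_of_ereal (inverse (functional_support f y)))))"

end

theory Submission
  imports Defs
begin

text \<open>
  Write \<open>g\<close> for the gauge of \<open>K\<close>, \<open>h\<close> for its support function, \<open>V\<close> for its volume and \<open>J\<close> for the
  total mass of \<open>f\<close>. Both ellipsoids are governed by one quadratic form, the integral of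
  \<open>\<langle>u, \<nabla>g(x)\<rangle>\<^sup>2\<close> over \<open>K\<close>, called \<open>grad_energy u\<close> below. The gradient exists almost everywhere
  and is homogeneous of degree \<open>0\<close>; \<open>\<langle>x, \<nabla>g(x)\<rangle> = g(x)\<close> and \<open>\<langle>y, \<nabla>g(x)\<rangle> \<le> g(y)\<close> say that
  \<open>\<nabla>g(x)\<close> is an outer normal of \<open>K\<close> at \<open>x / g(x)\<close> with \<open>h(\<nabla>g(x)) = 1\<close>.

  On the geometric side, an area element of the boundary with unit normal \<open>\<nu>\<close> spans a cone with apex
  \<open>0\<close> whose volume is \<open>h(\<nu>) / n\<close> times the area, and \<open>h(\<nu>) = 1 / |\<nabla>g|\<close> on that cone. Hence the
  surface area measure is the image of the measure with density \<open>n |\<nabla>g|\<close> on \<open>K\<close> under the normal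
  direction (\<open>surface_area_measure_eq\<close>), and dividing by \<open>h(\<nu>)\<close> turns \<open>\<langle>u, \<nu>\<rangle>\<^sup>2\<close> into
  \<open>n \<langle>u, \<nabla>g\<rangle>\<^sup>2\<close>. The squared gauge of the ellipsoid of \<open>K\<close> is therefore \<open>n / V\<close> times the form
  (\<open>minkowski_functional_LYZ_ellipsoid\<close>); it is an ellipsoid because the form is positive definite
  (\<open>grad_energy_pos\<close>).

  On the functional side \<open>\<phi> = g\<^sup>2 / 2\<close> has gradient \<open>g \<nabla>g\<close> and conjugate \<open>h\<^sup>2 / 2\<close>, whose value at
  \<open>g \<nabla>g\<close> is \<open>g\<^sup>2 / 2\<close>. The integrand is thus \<open>2 \<langle>u, \<nabla>g\<rangle>\<^sup>2 exp (- g\<^sup>2 / 2)\<close>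
  (\<open>functional_integral\<close>). As \<open>\<langle>u, \<nabla>g\<rangle>\<^sup>2\<close> is homogeneous of degree \<open>0\<close>, its mean for the density
  \<open>exp (- g\<^sup>2 / 2)\<close> equals its mean over \<open>K\<close> (\<open>homogeneous_average\<close>, \<open>gauss_average\<close>). So the
  exponent is \<open>n / (4 J)\<close> times \<open>2 J / V\<close> times the form: one half of \<open>n / V\<close> times the form, as
  claimed.

  The bulk of the work is the description of the surface area measure, which is built from Hausdorff
  measure and so has to be compared with Lebesgue measure (\<open>hausdorff_reverse_image\<close>). The boundary
  is cut into pieces whose normals lie within \<open>\<epsilon>\<close> of a fixed direction \<open>v\<close>. Such a piece is
  mapped bijectively, and up to factors tending to \<open>1\<close> isometrically, to the hyperplane orthogonal
  to \<open>v\<close>. The area of the projection is an integral over the cone spanned by the piece, by an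
  explicit change of variables (\<open>emeasure_prism_eq_integral\<close>). Hausdorff measure is compared with
  that area by the isodiametric inequality in one direction (\<open>prism_le_hausdorff_measure\<close>) and by
  Vitali coverings in the other (\<open>hausdorff_measure_le_prism\<close>). Letting \<open>\<epsilon>\<close> tend to \<open>0\<close>
  gives equality.
\<close>

section \<open>Change of variables for maps with rank-one perturbed derivative\<close>

text \<open>
  The Jacobian formula \<open>has_measure_differentiable_image\<close> is stated for well-ordered index types.
  Any finite type has a copy that is well-ordered through an enumeration, and renaming the coordinates
  is an isometry that preserves Lebesgue measure, so the formula transfers to every finite index type.
\<close>

typedef 'a ordered_copy = "UNIV :: 'a set"
  morphisms of_copy to_copy by simp

lemma bij_of_copy: "bij of_copy"
  by (metis UNIV_I bijI' of_copy_inject to_copy_inverse)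

instance ordered_copy :: (finite) finite
proof
  show "finite (UNIV :: 'a ordered_copy set)"
    using bij_of_copy bij_betw_finite finite_code by blast
qed

instantiation ordered_copy :: (finite) wellorder
begin

definition less_eq_ordered_copy :: "'a ordered_copy \<Rightarrow> 'a ordered_copy \<Rightarrow> bool" where
  "less_eq_ordered_copy x y \<longleftrightarrow> to_nat (of_copy x) \<le> to_nat (of_copy y)"

definition less_ordered_copy :: "'a ordered_copy \<Rightarrow> 'a ordered_copy \<Rightarrow> bool" where
  "less_ordered_copy x y \<longleftrightarrow> to_nat (of_copy x) < to_nat (of_copy y)"

instance
proof
  fix P :: "'a ordered_copy \<Rightarrow> bool" and a
  assume "\<And>x. (\<And>y. y < x \<Longrightarrow> P y) \<Longrightarrow> P x"
  then show "P a"
    unfolding less_ordered_copy_def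
    by (rule measure_induct_rule[where f = "\<lambda>x. to_nat (of_copy x)"])
qed (auto simp: less_eq_ordered_copy_def less_ordered_copy_def of_copy_inject)

end

definition relabel :: "real ^ 'n \<Rightarrow> real ^ 'n ordered_copy" where
  "relabel x = (\<chi> i. x $ of_copy i)"

definition unlabel :: "real ^ 'n ordered_copy \<Rightarrow> real ^ 'n" where
  "unlabel x = (\<chi> i. x $ to_copy i)"

lemma unlabel_relabel [simp]: "unlabel (relabel x) = x"
  by (simp add: relabel_def unlabel_def vec_eq_iff to_copy_inverse)

lemma relabel_unlabel [simp]: "relabel (unlabel x) = x"
  by (simp add: relabel_def unlabel_def vec_eq_iff of_copy_inverse)

lemma linear_relabel: "linear relabel" and linear_unlabel: "linear unlabel"
  by (auto intro!: linearI simp: relabel_def unlabel_def vec_eq_iff)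

lemma relabel_inner [simp]: "relabel x \<bullet> relabel y = x \<bullet> y"
  unfolding relabel_def inner_vec_def
  using sum.reindex_bij_betw[OF bij_of_copy, of "\<lambda>i. x $ i \<bullet> y $ i"] by simp

lemma unlabel_inner [simp]: "unlabel x \<bullet> unlabel y = x \<bullet> y"
  by (metis relabel_inner relabel_unlabel)

lemma inner_relabel: "y \<bullet> relabel x = unlabel y \<bullet> x" "relabel x \<bullet> y = x \<bullet> unlabel y"
  by (metis relabel_inner relabel_unlabel)+

lemma prod_Basis_cart: "(\<Prod>b\<in>Basis. f (x \<bullet> b)) = (\<Prod>i\<in>UNIV. f (x $ i))" for x :: "real ^ 'n"
proof -
  have B: "Basis = range (\<lambda>i::'n. axis i (1::real))"
    by (auto simp: Basis_vec_def)
  have "inj (\<lambda>i::'n. axis i (1::real))"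
    by (simp add: axis_eq_axis inj_on_def)
  then show ?thesis
    unfolding B by (subst prod.reindex) (auto simp: inner_axis)
qed

lemma relabel_measurable: "relabel \<in> borel_measurable borel" "unlabel \<in> borel_measurable borel"
  by (intro borel_measurable_continuous_onI linear_continuous_on linear_conv_bounded_linear[THEN iffD1]
        linear_relabel linear_unlabel)+

lemma lborel_relabel: "distr lborel lborel relabel = (lborel :: (real ^ ('n :: finite) ordered_copy) measure)"
proof -
  have "lborel = distr lborel borel (relabel :: real ^ 'n \<Rightarrow> _)"
  proof (rule lborel_eqI)
    fix l u :: "real ^ 'n ordered_copy"
    assume le: "\<And>b. b \<in> Basis \<Longrightarrow> l \<bullet> b \<le> u \<bullet> b"
    have le': "l $ i \<le> u $ i" for i
      using le[of "axis i 1"] by (simp add: inner_axis axis_in_Basis_iff)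
    have eq: "relabel -` box l u = box (unlabel l) (unlabel u)"
      unfolding set_eq_iff vimage_def mem_Collect_eq mem_box_cart relabel_def unlabel_def vec_lambda_beta
      by (metis of_copy_inverse to_copy_inverse UNIV_I)
    have "emeasure (distr lborel borel relabel) (box l u) = emeasure lborel (box (unlabel l) (unlabel u))"
      using relabel_measurable by (subst emeasure_distr) (auto simp: eq)
    also have "\<dots> = (\<Prod>b\<in>Basis. (unlabel u - unlabel l) \<bullet> b)"
      by (intro emeasure_lborel_box) (auto simp: Basis_vec_def inner_axis unlabel_def le')
    also have "\<dots> = (\<Prod>i\<in>UNIV. (u - l) $ i)"
      using prod_Basis_cart[of "\<lambda>x. x" "unlabel u - unlabel l"]
        prod.reindex_bij_betw[OF bij_of_copy, of "\<lambda>i. (unlabel u - unlabel l) $ i"]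
      by (simp add: unlabel_def of_copy_inverse)
    also have "\<dots> = (\<Prod>b\<in>Basis. (u - l) \<bullet> b)"
      using prod_Basis_cart[of "\<lambda>x. x" "u - l"] by simp
    finally show "emeasure (distr lborel borel relabel) (box l u) = (\<Prod>b\<in>Basis. (u - l) \<bullet> b)"
      by simp
  qed simp
  then show ?thesis
    by (metis distr_cong sets_lborel)
qed

lemma lborel_unlabel: "distr lborel lborel unlabel = (lborel :: (real ^ ('n :: finite)) measure)"
proof -
  have "distr (distr lborel lborel relabel) lborel unlabel = (distr lborel lborel (unlabel \<circ> relabel) :: (real ^ 'n) measure)"
    using relabel_measurable by (intro distr_distr) auto
  also have "\<dots> = lborel"
    by (simp add: o_def distr_id2)
  finally show ?thesis
    unfolding lborel_relabel .
qed

lemma lborel_iso_lebesgue: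
  fixes f :: "'a::euclidean_space \<Rightarrow> 'b::euclidean_space"
  assumes f: "f \<in> borel_measurable borel" and d: "distr lborel lborel f = lborel"
  shows "f \<in> lebesgue \<rightarrow>\<^sub>M lebesgue" "distr lebesgue lebesgue f = lebesgue"
proof -
  have m: "f \<in> lborel \<rightarrow>\<^sub>M lborel"
    using f by simp
  have d2: "distr lebesgue lborel f = lborel"
    using d distr_completion[OF m] by simp
  show "f \<in> lebesgue \<rightarrow>\<^sub>M lebesgue"
    using m d2 by (intro completion.measurable_completion2) (auto intro: measurable_completion)
  show "distr lebesgue lebesgue f = lebesgue"
    using completion.completion_distr_eq[OF m[THEN measurable_completion]] d2 by simp
qed

lemmas relabel_lebesgue = lborel_iso_lebesgue[OF relabel_measurable(1) lborel_relabel]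
  and unlabel_lebesgue = lborel_iso_lebesgue[OF relabel_measurable(2) lborel_unlabel]

text \<open>
  The form of \<open>has_measure_differentiable_image\<close> for nonnegative Lebesgue integrals.
\<close>

lemma emeasure_differentiable_image:
  fixes f :: "real ^ 'n::{finite,wellorder} \<Rightarrow> real ^ 'n::_"
  assumes S: "S \<in> sets lebesgue"
    and der: "\<And>x. x \<in> S \<Longrightarrow> (f has_derivative f' x) (at x within S)"
    and inj: "inj_on f S"
    and J: "\<And>x. x \<in> S \<Longrightarrow> \<bar>det (matrix (f' x))\<bar> = J x" "J \<in> borel_measurable lebesgue"
    and fin: "(\<integral>\<^sup>+x\<in>S. ennreal (J x) \<partial>lebesgue) < \<infinity>"
  shows "f ` S \<in> sets lebesgue" "emeasure lebesgue (f ` S) = (\<integral>\<^sup>+x\<in>S. ennreal (J x) \<partial>lebesgue)"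
proof -
  obtain m where m: "(\<integral>\<^sup>+x\<in>S. ennreal (J x) \<partial>lebesgue) = ennreal m" "0 \<le> m"
    using fin by (metis ennreal_cases less_irrefl infinity_ennreal_def)
  let ?F = "\<lambda>x. if x \<in> S then \<bar>det (matrix (f' x))\<bar> else 0"
  have F: "?F = (\<lambda>x. indicat_real S x * J x)"
    using J by (auto simp: indicator_def)
  have "(?F has_integral m) UNIV"
  proof (subst has_integral_iff_nn_integral_lebesgue, safe)
    show "?F \<in> borel_measurable lebesgue"
      unfolding F using S J by measurable
    have "(\<integral>\<^sup>+x. ennreal (?F x) \<partial>lebesgue) = (\<integral>\<^sup>+x\<in>S. ennreal (J x) \<partial>lebesgue)"
      by (intro nn_integral_cong) (auto simp: indicator_def J)
    then show "(\<integral>\<^sup>+x. ennreal (?F x) \<partial>lebesgue) = ennreal m"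
      using m by simp
  qed (use m in auto)
  then have "((\<lambda>x. \<bar>det (matrix (f' x))\<bar>) has_integral m) S"
    by (subst (asm) has_integral_restrict_UNIV)
  then have "f ` S \<in> lmeasurable \<and> measure lebesgue (f ` S) = m"
    using has_measure_differentiable_image[OF S der inj] by blast
  then show "f ` S \<in> sets lebesgue" "emeasure lebesgue (f ` S) = (\<integral>\<^sup>+x\<in>S. ennreal (J x) \<partial>lebesgue)"
    using m emeasure_eq_measure2[of "f ` S" lebesgue] by auto
qed

text \<open>
  The map is a composition of three simple ones: replace the \<open>k\<close>-th coordinate by the product with
  \<open>w\<close>, scale the remaining coordinates by \<open>a\<close>, send the \<open>k\<close>-th axis to \<open>u\<close>. Their determinants
  are \<open>w $ k\<close>, \<open>a ^ (n - 1)\<close> and \<open>u $ k\<close>.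
\<close>

lemma det_rank_one_axis:
  fixes u :: "real ^ 'n"
  shows "det (matrix (\<lambda>h. a *\<^sub>R (h - (h $ k) *\<^sub>R axis k 1) + (w \<bullet> h) *\<^sub>R u)) = a ^ (CARD('n) - 1) * u $ k * w $ k"
proof -
  define C1 where "C1 = (\<lambda>h::real^'n. h - (h $ k) *\<^sub>R axis k 1 + (h $ k) *\<^sub>R u)"
  define C2 where "C2 = (\<lambda>h::real^'n. a *\<^sub>R (h - (h $ k) *\<^sub>R axis k 1) + (h $ k) *\<^sub>R axis k 1)"
  define C3 where "C3 = (\<lambda>h::real^'n. h - (h $ k) *\<^sub>R axis k 1 + (w \<bullet> h) *\<^sub>R axis k 1)"
  have lin: "linear C1" "linear C2" "linear C3"
    unfolding C1_def C2_def C3_def by (auto intro!: linearI simp: algebra_simps inner_simps)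
  have replace: "det (\<chi> i. if i = k then x else row i (mat 1 :: real^'n^'n)) = x $ k" for x :: "real^'n"
  proof -
    have "(\<Sum>i\<in>UNIV. x $ i *s row i (mat 1 :: real^'n^'n)) = x"
      by (simp add: vec_eq_iff row_def mat_def if_distrib cong: if_cong)
    then show ?thesis
      using cramer_lemma_transpose[of k x "mat 1 :: real^'n^'n"] by (simp cong: if_cong)
  qed
  have "transpose (matrix C1) = (\<chi> i. if i = k then u else row i (mat 1))"
    by (auto simp: vec_eq_iff transpose_def matrix_def C1_def row_def mat_def axis_def)
  then have d1: "det (matrix C1) = u $ k"
    by (metis det_transpose replace)
  have "w \<bullet> (\<chi> j. if j = i then 1 else 0) = w $ i" for i
    using inner_axis[of w i 1] by (simp add: axis_def)
  then have "matrix C3 = (\<chi> i. if i = k then w else row i (mat 1))"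
    by (auto simp: vec_eq_iff matrix_def C3_def row_def mat_def axis_def)
  then have d3: "det (matrix C3) = w $ k"
    by (metis replace)
  have "det (matrix C2) = (\<Prod>i\<in>UNIV. matrix C2 $ i $ i)"
    by (rule det_diagonal) (auto simp: matrix_def C2_def axis_def)
  also have "\<dots> = (\<Prod>i\<in>UNIV. if i = k then 1 else a)"
    by (intro prod.cong) (auto simp: matrix_def C2_def axis_def)
  also have "\<dots> = a ^ (CARD('n) - 1)"
    by (subst prod.remove[of _ k]) (auto simp: prod.If_cases Compl_eq_Diff_UNIV)
  finally have d2: "det (matrix C2) = a ^ (CARD('n) - 1)" .
  have "(\<lambda>h. a *\<^sub>R (h - (h $ k) *\<^sub>R axis k 1) + (w \<bullet> h) *\<^sub>R u) = C1 \<circ> (C2 \<circ> C3)"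
    unfolding C1_def C2_def C3_def by (auto simp: fun_eq_iff algebra_simps)
  then show ?thesis
    using lin d1 d2 d3 by (simp add: matrix_compose linear_compose det_mul)
qed

text \<open>
  A rotation carries \<open>v\<close> to a coordinate axis.
\<close>

lemma det_rank_one:
  fixes u v w :: "real ^ 'n"
  assumes v: "norm v = 1"
  shows "det (matrix (\<lambda>h. a *\<^sub>R (h - (h \<bullet> v) *\<^sub>R v) + (w \<bullet> h) *\<^sub>R u)) = a ^ (CARD('n) - 1) * (u \<bullet> v) * (w \<bullet> v)"
proof -
  fix k :: 'n
  obtain f where f: "orthogonal_transformation f" "f v = axis k (1::real)"
    using orthogonal_transformation_exists_1[of v "axis k 1"] v by (metis norm_axis_1)
  have lf: "linear f"
    using f by (rule_tac orthogonal_transformation_linear)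
  have fi: "f x \<bullet> f y = x \<bullet> y" for x y
    using f by (simp add: orthogonal_transformation_def)
  have fv: "f x $ k = x \<bullet> v" for x
    using fi[of x v] f by (simp add: inner_axis)
  define M where "M = (\<lambda>h. a *\<^sub>R (h - (h \<bullet> v) *\<^sub>R v) + (w \<bullet> h) *\<^sub>R u)"
  define M' where "M' = (\<lambda>h. a *\<^sub>R (h - (h $ k) *\<^sub>R axis k 1) + (f w \<bullet> h) *\<^sub>R f u)"
  have lM: "linear M" "linear M'"
    unfolding M_def M'_def by (auto intro!: linearI simp: algebra_simps inner_simps)
  have "f \<circ> M = M' \<circ> f"
    unfolding M_def M'_def
    by (auto simp: fun_eq_iff fv fi f(2) linear_add[OF lf] linear_diff[OF lf] linear_scale[OF lf])
  then have "det (matrix f) * det (matrix M) = det (matrix M') * det (matrix f)"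
    using matrix_compose[OF lM(1) lf] matrix_compose[OF lf lM(2)] by (metis det_mul)
  moreover have "det (matrix f) \<noteq> 0"
    using orthogonal_transformation_det[OF f(1)] by auto
  ultimately have "det (matrix M) = det (matrix M')"
    by simp
  also have "\<dots> = a ^ (CARD('n) - 1) * f u $ k * f w $ k"
    unfolding M'_def by (rule det_rank_one_axis)
  finally show ?thesis
    unfolding M_def fv .
qed

lemma card_ordered_copy: "CARD('n ordered_copy) = CARD('n)"
  by (rule bij_betw_same_card[OF bij_of_copy])

lemma emeasure_differentiable_image_relabel:
  fixes f :: "real ^ 'n \<Rightarrow> real ^ 'n"
  assumes S: "S \<in> sets lebesgue"
    and der: "\<And>x. x \<in> S \<Longrightarrow> (f has_derivative f' x) (at x within S)"
    and inj: "inj_on f S"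
    and J: "\<And>x. x \<in> S \<Longrightarrow> \<bar>det (matrix (relabel \<circ> f' x \<circ> unlabel))\<bar> = J x"
      "J \<in> borel_measurable lebesgue"
    and fin: "(\<integral>\<^sup>+x\<in>S. ennreal (J x) \<partial>lebesgue) < \<infinity>"
  shows "f ` S \<in> sets lebesgue" "emeasure lebesgue (f ` S) = (\<integral>\<^sup>+x\<in>S. ennreal (J x) \<partial>lebesgue)"
proof -
  define g where "g = relabel \<circ> f \<circ> unlabel"
  define T where "T = unlabel -` S"
  define M' where "M' = (\<lambda>y. relabel \<circ> f' (unlabel y) \<circ> unlabel)"
  have T: "T \<in> sets lebesgue"
    unfolding T_def using measurable_sets[OF unlabel_lebesgue(1) S] by simp
  have uT: "unlabel ` T = S"
    unfolding T_def by (auto simp: image_iff) (metis unlabel_relabel)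
  have bl: "bounded_linear (relabel :: real ^ 'n \<Rightarrow> _)" "bounded_linear (unlabel :: _ \<Rightarrow> real ^ 'n)"
    by (simp_all add: linear_conv_bounded_linear[symmetric] linear_relabel linear_unlabel)
  have der': "(g has_derivative M' y) (at y within T)" if "y \<in> T" for y
  proof -
    have "(f has_derivative f' (unlabel y)) (at (unlabel y) within unlabel ` T)"
      unfolding uT using der[of "unlabel y"] that by (simp add: T_def)
    then have "(f \<circ> unlabel has_derivative f' (unlabel y) \<circ> unlabel) (at y within T)"
      using bounded_linear_imp_has_derivative[OF bl(2)] by (rule_tac diff_chain_within)
    then have "(relabel \<circ> (f \<circ> unlabel) has_derivative relabel \<circ> (f' (unlabel y) \<circ> unlabel)) (at y within T)"
      using bounded_linear_imp_has_derivative[OF bl(1)] by (rule_tac diff_chain_within)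
    then show ?thesis
      unfolding g_def M'_def by (simp add: o_assoc)
  qed
  have inj': "inj_on g T"
    unfolding g_def T_def using inj
    by (auto simp: inj_on_def) (metis relabel_unlabel unlabel_relabel)
  have J': "\<bar>det (matrix (M' y))\<bar> = J (unlabel y)" if "y \<in> T" for y
    using J(1)[of "unlabel y"] that by (simp add: T_def M'_def)
  have Jm: "(\<lambda>y. J (unlabel y)) \<in> borel_measurable lebesgue"
    using measurable_comp[OF unlabel_lebesgue(1) J(2)] by (simp add: o_def)
  have I: "(\<integral>\<^sup>+x\<in>S. ennreal (J x) \<partial>lebesgue) = (\<integral>\<^sup>+y\<in>T. ennreal (J (unlabel y)) \<partial>lebesgue)"
  proof -
    have "(\<integral>\<^sup>+x\<in>S. ennreal (J x) \<partial>lebesgue) = (\<integral>\<^sup>+x\<in>S. ennreal (J x) \<partial>distr lebesgue lebesgue unlabel)"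
      by (simp add: unlabel_lebesgue(2))
    also have "\<dots> = (\<integral>\<^sup>+y. ennreal (J (unlabel y)) * indicator S (unlabel y) \<partial>lebesgue)"
      using S J(2) by (intro nn_integral_distr unlabel_lebesgue(1)) (auto simp: unlabel_lebesgue(2))
    finally show ?thesis
      by (simp add: T_def indicator_def)
  qed
  have img: "g ` T = relabel ` (f ` S)"
    unfolding g_def uT[symmetric] by (simp add: image_image)
  then have fS: "f ` S = relabel -` (g ` T)"
    by (auto simp: image_iff) (metis unlabel_relabel)
  note G = emeasure_differentiable_image[OF T der' inj' J' Jm, folded I, OF _ _ fin]
  show 1: "f ` S \<in> sets lebesgue"
    unfolding fS using measurable_sets[OF relabel_lebesgue(1) G(1)] by simp
  have "emeasure lebesgue (g ` T) = emeasure (distr lebesgue lebesgue relabel) (g ` T)"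
    by (simp add: relabel_lebesgue(2))
  also have "\<dots> = emeasure lebesgue (f ` S)"
    using relabel_lebesgue(1) G(1) by (subst emeasure_distr) (auto simp: fS)
  finally show "emeasure lebesgue (f ` S) = (\<integral>\<^sup>+x\<in>S. ennreal (J x) \<partial>lebesgue)"
    using G(2) by simp
qed

lemma emeasure_image_rank_one_derivative:
  fixes f :: "real ^ 'n \<Rightarrow> real ^ 'n"
  assumes S: "S \<in> sets lebesgue" and v: "norm v = 1"
    and der: "\<And>x. x \<in> S \<Longrightarrow>
      (f has_derivative (\<lambda>h. a x *\<^sub>R (h - (h \<bullet> v) *\<^sub>R v) + (w x \<bullet> h) *\<^sub>R u x)) (at x within S)"
    and inj: "inj_on f S"
    and J: "\<And>x. x \<in> S \<Longrightarrow> \<bar>a x ^ (CARD('n) - 1) * (u x \<bullet> v) * (w x \<bullet> v)\<bar> = J x"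
      "J \<in> borel_measurable lebesgue"
    and fin: "(\<integral>\<^sup>+x\<in>S. ennreal (J x) \<partial>lebesgue) < \<infinity>"
  shows "f ` S \<in> sets lebesgue" "emeasure lebesgue (f ` S) = (\<integral>\<^sup>+x\<in>S. ennreal (J x) \<partial>lebesgue)"
proof -
  define M where "M = (\<lambda>x h. a x *\<^sub>R (h - (h \<bullet> v) *\<^sub>R v) + (w x \<bullet> h) *\<^sub>R u x)"
  have v': "norm (relabel v) = 1"
    using v by (simp add: norm_eq_sqrt_inner)
  have "relabel \<circ> M x \<circ> unlabel = (\<lambda>h. a x *\<^sub>R (h - (h \<bullet> relabel v) *\<^sub>R relabel v)
     + (relabel (w x) \<bullet> h) *\<^sub>R relabel (u x))" for x
    unfolding M_def
    by (auto simp: fun_eq_iff linear_add[OF linear_relabel] linear_diff[OF linear_relabel]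
        linear_scale[OF linear_relabel] inner_relabel)
  then have J': "\<bar>det (matrix (relabel \<circ> M x \<circ> unlabel))\<bar> = J x" if "x \<in> S" for x
    using J(1)[OF that] by (simp add: det_rank_one[OF v'] card_ordered_copy)
  have der': "(f has_derivative M x) (at x within S)" if "x \<in> S" for x
    unfolding M_def using der that by blast
  show "f ` S \<in> sets lebesgue" "emeasure lebesgue (f ` S) = (\<integral>\<^sup>+x\<in>S. ennreal (J x) \<partial>lebesgue)"
    using emeasure_differentiable_image_relabel[OF S der' inj J' J(2) fin] by auto
qed

text \<open>
  An isometry has Jacobian \<open>1\<close>, so it preserves the measure of boxes, which determines Lebesgue
  measure.
\<close>

lemma orthogonal_image_lebesgue:
  fixes f :: "real ^ 'n \<Rightarrow> real ^ 'n"
  assumes f: "orthogonal_transformation f"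
  shows "f \<in> lebesgue \<rightarrow>\<^sub>M lebesgue" "distr lebesgue lebesgue f = lebesgue"
proof -
  have vol: "emeasure lebesgue (g ` box l u) = emeasure lborel (box l u)"
    if g: "orthogonal_transformation g" for g :: "real ^ 'n \<Rightarrow> real ^ 'n" and l u
  proof -
    have lg: "linear g"
      using g by (rule orthogonal_transformation_linear)
    have "(relabel \<circ> g \<circ> unlabel) x \<bullet> (relabel \<circ> g \<circ> unlabel) y = x \<bullet> y" for x y
      using g by (simp add: orthogonal_transformation_def)
    moreover have "linear (relabel \<circ> g \<circ> unlabel)"
      by (intro linear_compose lg linear_relabel linear_unlabel)
    ultimately have "orthogonal_transformation (relabel \<circ> g \<circ> unlabel)"
      by (simp add: orthogonal_transformation_def)
    then have J: "\<bar>det (matrix (relabel \<circ> g \<circ> unlabel))\<bar> = 1"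
      by simp
    have "emeasure lebesgue (g ` box l u) = (\<integral>\<^sup>+x\<in>box l u. ennreal ((\<lambda>_. 1) x) \<partial>lebesgue)"
    proof (rule emeasure_differentiable_image_relabel)
      show "(g has_derivative g) (at x within box l u)" for x
        using lg by (simp add: linear_imp_has_derivative)
      show "inj_on g (box l u)"
        using orthogonal_transformation_inj[OF g] inj_on_subset by blast
      show "(\<integral>\<^sup>+x\<in>box l u. ennreal 1 \<partial>lebesgue) < \<infinity>"
        by (simp add: less_top[symmetric] emeasure_lborel_box_eq)
    qed (auto simp: J)
    then show ?thesis by simp
  qed
  have fm: "f \<in> borel_measurable borel"
    using orthogonal_transformation_linear[OF f]
    by (intro borel_measurable_continuous_onI linear_continuous_on)
      (simp add: linear_conv_bounded_linear)
  have "lborel = distr lborel lborel f"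
  proof (rule lborel_eqI)
    fix l u :: "real ^ 'n"
    assume le: "\<And>b. b \<in> Basis \<Longrightarrow> l \<bullet> b \<le> u \<bullet> b"
    have "f -` box l u = inv f ` box l u"
      by (simp add: bij_vimage_eq_inv_image f orthogonal_transformation_bij)
    then have "emeasure (distr lborel lborel f) (box l u) = emeasure lborel (inv f ` box l u)"
      using fm by (subst emeasure_distr) auto
    also have "\<dots> = emeasure lebesgue (inv f ` box l u)"
      using fm \<open>f -` box l u = inv f ` box l u\<close> measurable_sets[OF fm, of "box l u"]
      by (subst emeasure_completion) (auto simp: emeasure_completion)
    also have "\<dots> = emeasure lborel (box l u)"
      by (intro vol orthogonal_transformation_inv f)
    finally show "emeasure (distr lborel lborel f) (box l u) = (\<Prod>b\<in>Basis. (u - l) \<bullet> b)"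
      using le by simp
  qed simp
  from lborel_iso_lebesgue[OF fm this[symmetric]]
  show "f \<in> lebesgue \<rightarrow>\<^sub>M lebesgue" "distr lebesgue lebesgue f = lebesgue" .
qed

section \<open>The isodiametric inequality\<close>

text \<open>
  \<open>X\<close> lies in \<open>[Inf X, Sup X]\<close> and \<open>Y\<close> in \<open>[Sup X - \<delta>, Inf X + \<delta>]\<close>; the lengths of these two
  intervals add up to \<open>2 \<delta>\<close>.
\<close>

lemma measure_add_le_two_dist:
  fixes X Y :: "real set"
  assumes X: "X \<in> sets borel" "X \<noteq> {}" and Y: "Y \<in> sets borel" "Y \<noteq> {}"
    and close: "\<And>s t. s \<in> X \<Longrightarrow> t \<in> Y \<Longrightarrow> \<bar>s - t\<bar> \<le> \<delta>"
  shows "measure lborel X + measure lborel Y \<le> 2 * \<delta>"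
proof -
  obtain t0 where t0: "t0 \<in> Y" using Y by auto
  obtain s0 where s0: "s0 \<in> X" using X by auto
  have "t0 - \<delta> \<le> s" "s \<le> t0 + \<delta>" if "s \<in> X" for s
    using close[OF that t0] by (auto simp: abs_le_iff)
  then have bX: "bdd_above X" "bdd_below X"
    by - (auto intro!: bdd_aboveI bdd_belowI)
  have YX: "t \<le> Inf X + \<delta>" "Sup X - \<delta> \<le> t" if "t \<in> Y" for t
  proof -
    have "t - \<delta> \<le> s \<and> s \<le> t + \<delta>" if "s \<in> X" for s
      using close[OF that \<open>t \<in> Y\<close>] by linarith
    then have "t - \<delta> \<le> Inf X" "Sup X \<le> t + \<delta>"
      using X(2) by (auto intro!: cInf_greatest cSup_least)
    then show "t \<le> Inf X + \<delta>" "Sup X - \<delta> \<le> t"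
      by linarith+
  qed
  have le: "Inf X \<le> Sup X" "Sup X - \<delta> \<le> Inf X + \<delta>"
    using bX X(2) s0 YX[OF t0] by (auto intro: cInf_le_cSup)
  have "measure lborel X \<le> measure lborel {Inf X .. Sup X}"
    using X bX by (intro measure_mono_fmeasurable)
      (auto intro: cInf_lower cSup_upper simp: fmeasurable_def emeasure_lborel_Icc_eq)
  moreover have "measure lborel Y \<le> measure lborel {Sup X - \<delta> .. Inf X + \<delta>}"
    using Y YX by (intro measure_mono_fmeasurable)
      (auto simp: fmeasurable_def emeasure_lborel_Icc_eq)
  ultimately show ?thesis
    using le by simp
qed

text \<open>
  Steiner symmetrization along the coordinate \<open>j\<close> of a set \<open>Q\<close> of diameter at most \<open>D\<close>: each line
  section in direction \<open>j\<close> is replaced by the centred open interval of the same length. The points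
  are functions on an arbitrary finite index set, so that the dimension is a cardinality and may later
  be one less than that of the ambient space.
\<close>

context
  fixes j :: 'i and I :: "'i set" and Q :: "('i \<Rightarrow> real) set" and D :: real
  assumes I: "finite I" "j \<notin> I"
    and Q: "Q \<in> sets (\<Pi>\<^sub>M i\<in>insert j I. lborel)"
    and diam: "\<And>x y. x \<in> Q \<Longrightarrow> y \<in> Q \<Longrightarrow> (\<Sum>i\<in>insert j I. (x i - y i)\<^sup>2) \<le> D\<^sup>2"
begin

definition section_length :: "('i \<Rightarrow> real) \<Rightarrow> real" where
  "section_length x = measure lborel {t. x(j := t) \<in> Q}"

text \<open>
  The strict inequality makes empty and null sections disappear, and measurability of the set then
  follows from that of the section lengths.
\<close>

definition steiner :: "('i \<Rightarrow> real) set" where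
  "steiner = {z \<in> space (\<Pi>\<^sub>M i\<in>insert j I. lborel). 2 * \<bar>z j\<bar> < section_length (restrict z I)}"

interpretation product_sigma_finite "\<lambda>_::'i. lborel :: real measure"
  by standard

lemma section_measurable: 
  assumes "x \<in> space (\<Pi>\<^sub>M i\<in>I. lborel)"
  shows "{t. x(j := t) \<in> Q} \<in> sets borel"
proof -
  have "(\<lambda>t. x(j := t)) \<in> lborel \<rightarrow>\<^sub>M (\<Pi>\<^sub>M i\<in>insert j I. lborel)"
    using measurable_compose[OF measurable_Pair1'[OF assms] measurable_add_dim] by simp
  from measurable_sets[OF this Q] show ?thesis
    by (simp add: vimage_def)
qed

lemma section_diam:
  assumes "x(j := s) \<in> Q" "y(j := t) \<in> Q"
  shows "(\<Sum>i\<in>I. (x i - y i)\<^sup>2) + (s - t)\<^sup>2 \<le> D\<^sup>2"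
proof -
  have "(\<Sum>i\<in>I. ((x(j := s)) i - (y(j := t)) i)\<^sup>2) = (\<Sum>i\<in>I. (x i - y i)\<^sup>2)"
    using I by (intro sum.cong) auto
  then show ?thesis
    using diam[OF assms] I by simp
qed

lemma section_finite:
  assumes "x \<in> space (\<Pi>\<^sub>M i\<in>I. lborel)"
  shows "emeasure lborel {t. x(j := t) \<in> Q} = ennreal (section_length x)"
proof -
  have "bounded {t. x(j := t) \<in> Q}"
  proof (cases "{t. x(j := t) \<in> Q} = {}")
    case False
    then obtain t0 where t0: "x(j := t0) \<in> Q" by auto
    have "dist t0 t \<le> \<bar>D\<bar>" if "x(j := t) \<in> Q" for t
      using section_diam[OF t0 that] by (simp add: dist_real_def abs_le_square_iff)
    then show ?thesis
      unfolding bounded_def by blast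
  qed auto
  then have "emeasure lborel {t. x(j := t) \<in> Q} < \<infinity>"
    using emeasure_bounded_finite by blast
  then show ?thesis
    unfolding section_length_def by (intro emeasure_eq_ennreal_measure) auto
qed

lemma section_length_measurable: "section_length \<in> borel_measurable (\<Pi>\<^sub>M i\<in>I. lborel)"
proof -
  have "(\<lambda>(x, t). indicator Q (x(j := t)) :: ennreal) \<in> borel_measurable ((\<Pi>\<^sub>M i\<in>I. lborel) \<Otimes>\<^sub>M lborel)"
    using measurable_compose[OF measurable_add_dim[of j I "\<lambda>_. lborel"] borel_measurable_indicator[OF Q]]
    by (simp add: case_prod_beta' )
  then have "(\<lambda>x. enn2real (\<integral>\<^sup>+t. indicator Q (x(j := t)) \<partial>lborel)) \<in> borel_measurable (\<Pi>\<^sub>M i\<in>I. lborel)"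
    by measurable
  moreover have "enn2real (\<integral>\<^sup>+t. indicator Q (x(j := t)) \<partial>lborel) = section_length x"
    if "x \<in> space (\<Pi>\<^sub>M i\<in>I. lborel)" for x
  proof -
    have "(\<integral>\<^sup>+t. indicator Q (x(j := t)) \<partial>lborel) = (\<integral>\<^sup>+t. indicator {t. x(j := t) \<in> Q} t \<partial>lborel)"
      by (intro nn_integral_cong) (auto simp: indicator_def)
    also have "\<dots> = emeasure lborel {t. x(j := t) \<in> Q}"
      using section_measurable[OF that] by simp
    finally show ?thesis
      by (simp add: section_length_def measure_def)
  qed
  ultimately show ?thesis
    by (subst (asm) measurable_cong) auto
qed

lemma steiner_measurable: "steiner \<in> sets (\<Pi>\<^sub>M i\<in>insert j I. lborel)"
proof -
  have "(\<lambda>z. restrict z I) \<in> (\<Pi>\<^sub>M i\<in>insert j I. lborel) \<rightarrow>\<^sub>M (\<Pi>\<^sub>M i\<in>I. (lborel :: real measure))"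
    by (intro measurable_restrict_subset) auto
  from measurable_compose[OF this section_length_measurable]
  have [measurable]: "(\<lambda>z. section_length (restrict z I)) \<in> borel_measurable (\<Pi>\<^sub>M i\<in>insert j I. lborel)" .
  have [measurable]: "(\<lambda>z. z j) \<in> borel_measurable (\<Pi>\<^sub>M i\<in>insert j I. (lborel :: real measure))"
    using measurable_component_singleton[of j "insert j I" "\<lambda>_. lborel :: real measure"] by simp
  show ?thesis
    unfolding steiner_def by measurable
qed

lemma restrict_upd:
  assumes "x \<in> space (\<Pi>\<^sub>M i\<in>I. (lborel :: real measure))"
  shows "restrict (x(j := t)) I = x"
  using assms I by (auto simp: space_PiM PiE_def extensional_def restrict_def fun_eq_iff)

lemma steiner_emeasure: "emeasure (\<Pi>\<^sub>M i\<in>insert j I. lborel) steiner = emeasure (\<Pi>\<^sub>M i\<in>insert j I. lborel) Q"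
proof -
  have by_sections: "emeasure (\<Pi>\<^sub>M i\<in>insert j I. lborel) A =
      (\<integral>\<^sup>+x. \<integral>\<^sup>+t. indicator {t. x(j := t) \<in> A} t \<partial>lborel \<partial>(\<Pi>\<^sub>M i\<in>I. lborel))"
    if A: "A \<in> sets (\<Pi>\<^sub>M i\<in>insert j I. (lborel :: real measure))" for A
  proof -
    have "emeasure (\<Pi>\<^sub>M i\<in>insert j I. lborel) A = (\<integral>\<^sup>+z. indicator A z \<partial>(\<Pi>\<^sub>M i\<in>insert j I. lborel))"
      using A by simp
    also have "\<dots> = (\<integral>\<^sup>+x. \<integral>\<^sup>+t. indicator A (x(j := t)) \<partial>lborel \<partial>(\<Pi>\<^sub>M i\<in>I. lborel))"
      using A I by (intro product_nn_integral_insert) auto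
    finally show ?thesis
      by (simp add: indicator_def)
  qed
  have "(\<integral>\<^sup>+t. indicator {t. x(j := t) \<in> steiner} t \<partial>lborel) = (\<integral>\<^sup>+t. indicator {t. x(j := t) \<in> Q} t \<partial>lborel)"
    if x: "x \<in> space (\<Pi>\<^sub>M i\<in>I. (lborel :: real measure))" for x
  proof -
    have "x(j := t) \<in> space (\<Pi>\<^sub>M i\<in>insert j I. (lborel :: real measure))" for t
      using x by (auto simp: space_PiM PiE_def extensional_def)
    then have "{t. x(j := t) \<in> steiner} = {- (section_length x / 2)<..<section_length x / 2}"
      unfolding steiner_def using restrict_upd[OF x] by (auto simp: abs_if split: if_splits)
    moreover have "0 \<le> section_length x"
      by (simp add: section_length_def)
    ultimately have "(\<integral>\<^sup>+t. indicator {t. x(j := t) \<in> steiner} t \<partial>lborel) = ennreal (section_length x)"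
      by (simp del: ennreal_plus)
    then show ?thesis
      using section_finite[OF x] section_measurable[OF x] by simp
  qed
  then show ?thesis
    unfolding by_sections[OF Q] by_sections[OF steiner_measurable] by (rule nn_integral_cong)
qed

text \<open>
  If the heights of two points of the new set differ by \<open>d\<close>, then \<open>d\<close> is less than half the sum of
  the lengths of their sections, so by \<open>measure_add_le_two_dist\<close> the original sections contain heights
  that differ by more than \<open>d\<close>.
\<close>

lemma steiner_diam:
  assumes "z \<in> steiner" "w \<in> steiner"
  shows "(\<Sum>i\<in>insert j I. (z i - w i)\<^sup>2) \<le> D\<^sup>2"
proof -
  let ?X = "{t. (restrict z I)(j := t) \<in> Q}" and ?Y = "{t. (restrict w I)(j := t) \<in> Q}"
  have sp: "restrict z I \<in> space (\<Pi>\<^sub>M i\<in>I. (lborel :: real measure))" "restrict w I \<in> space (\<Pi>\<^sub>M i\<in>I. (lborel :: real measure))"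
    by (auto simp: space_PiM)
  have len: "2 * \<bar>z j\<bar> < measure lborel ?X" "2 * \<bar>w j\<bar> < measure lborel ?Y"
    using assms by (auto simp: steiner_def section_length_def)
  have ne: "?X \<noteq> {}" "?Y \<noteq> {}"
    using len by (metis abs_ge_zero measure_empty mult_nonneg_nonneg not_le zero_le_numeral)+
  have "\<exists>s\<in>?X. \<exists>t\<in>?Y. \<bar>z j - w j\<bar> < \<bar>s - t\<bar>"
  proof (rule ccontr)
    assume "\<not> ?thesis"
    then have "measure lborel ?X + measure lborel ?Y \<le> 2 * \<bar>z j - w j\<bar>"
      by (intro measure_add_le_two_dist section_measurable sp ne) (auto simp: not_less)
    moreover have "\<not> p + q \<le> 2 * c" if "2 * a < p" "2 * b < q" "c \<le> a + b" for a b c p q :: real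
      using that by linarith
    ultimately show False
      using len abs_triangle_ineq4[of "z j" "w j"] by blast
  qed
  then obtain s t where st: "s \<in> ?X" "t \<in> ?Y" "\<bar>z j - w j\<bar> < \<bar>s - t\<bar>" by blast
  have "(\<Sum>i\<in>I. (restrict z I i - restrict w I i)\<^sup>2) + (s - t)\<^sup>2 \<le> D\<^sup>2"
    using section_diam[of "restrict z I" s "restrict w I" t] st(1,2) by blast
  moreover have "(\<Sum>i\<in>I. (restrict z I i - restrict w I i)\<^sup>2) = (\<Sum>i\<in>I. (z i - w i)\<^sup>2)"
    by (intro sum.cong) auto
  moreover have "(z j - w j)\<^sup>2 \<le> (s - t)\<^sup>2"
    using st by (simp add: abs_le_square_iff[symmetric])
  ultimately show ?thesis
    using I by simp
qed

lemma steiner_symmetric: "z \<in> steiner \<Longrightarrow> z(j := - z j) \<in> steiner"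
proof -
  assume z: "z \<in> steiner"
  have "restrict (z(j := - z j)) I = restrict z I"
    using I by (auto simp: restrict_def fun_eq_iff)
  then show ?thesis
    using z by (auto simp: steiner_def space_PiM PiE_def extensional_def)
qed

text \<open>
  Reflected sections have the same length.
\<close>

lemma steiner_keeps_symmetry:
  assumes k: "k \<in> I" and sym: "\<And>z. z \<in> Q \<Longrightarrow> z(k := - z k) \<in> Q" and z: "z \<in> steiner"
  shows "z(k := - z k) \<in> steiner"
proof -
  have jk: "j \<noteq> k" using k I by auto
  let ?x = "restrict z I" and ?y = "restrict (z(k := - z k)) I"
  have "?y(j := t) = (?x(j := t))(k := - (?x(j := t)) k)" "?x(j := t) = (?y(j := t))(k := - (?y(j := t)) k)" for t
    using jk k by (auto simp: fun_eq_iff)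
  then have "?x(j := t) \<in> Q \<longleftrightarrow> ?y(j := t) \<in> Q" for t
    using sym by metis
  then have "section_length ?y = section_length ?x"
    by (simp add: section_length_def)
  then show ?thesis
    using z jk k by (auto simp: steiner_def space_PiM PiE_def extensional_def)
qed

lemma steiner_exists:
  "\<exists>R\<in>sets (\<Pi>\<^sub>M i\<in>insert j I. lborel).
    emeasure (\<Pi>\<^sub>M i\<in>insert j I. lborel) R = emeasure (\<Pi>\<^sub>M i\<in>insert j I. lborel) Q \<and>
    (\<forall>x\<in>R. \<forall>y\<in>R. (\<Sum>i\<in>insert j I. (x i - y i)\<^sup>2) \<le> D\<^sup>2) \<and>
    (\<forall>z\<in>R. z(j := - z j) \<in> R) \<and>
    (\<forall>k\<in>I. (\<forall>z\<in>Q. z(k := - z k) \<in> Q) \<longrightarrow> (\<forall>z\<in>R. z(k := - z k) \<in> R))"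
  using steiner_diam steiner_symmetric steiner_keeps_symmetry
  by (intro bexI[OF _ steiner_measurable] conjI steiner_emeasure ballI impI) blast+

end

lemma symmetrization:
  fixes Q :: "('i \<Rightarrow> real) set"
  assumes I: "finite I" and L: "L \<subseteq> I"
    and Q: "Q \<in> sets (\<Pi>\<^sub>M i\<in>I. lborel)"
    and diam: "\<And>x y. x \<in> Q \<Longrightarrow> y \<in> Q \<Longrightarrow> (\<Sum>i\<in>I. (x i - y i)\<^sup>2) \<le> D\<^sup>2"
  shows "\<exists>R\<in>sets (\<Pi>\<^sub>M i\<in>I. lborel). emeasure (\<Pi>\<^sub>M i\<in>I. lborel) R = emeasure (\<Pi>\<^sub>M i\<in>I. lborel) Q \<and>
    (\<forall>x\<in>R. \<forall>y\<in>R. (\<Sum>i\<in>I. (x i - y i)\<^sup>2) \<le> D\<^sup>2) \<and> (\<forall>k\<in>L. \<forall>x\<in>R. x(k := - x k) \<in> R)"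
  using finite_subset[OF L I] L
proof (induction L rule: finite_induct)
  case empty
  then show ?case
    using Q diam by blast
next
  case (insert j L)
  then have "L \<subseteq> I" by simp
  from insert.IH[OF this] obtain R where R: "R \<in> sets (\<Pi>\<^sub>M i\<in>I. lborel)"
    "emeasure (\<Pi>\<^sub>M i\<in>I. lborel) R = emeasure (\<Pi>\<^sub>M i\<in>I. lborel) Q"
    "\<And>x y. x \<in> R \<Longrightarrow> y \<in> R \<Longrightarrow> (\<Sum>i\<in>I. (x i - y i)\<^sup>2) \<le> D\<^sup>2"
    "\<And>k x. k \<in> L \<Longrightarrow> x \<in> R \<Longrightarrow> x(k := - x k) \<in> R"
    by blast
  define I' where "I' = I - {j}"
  have I': "finite I'" "j \<notin> I'" "I = insert j I'"
    using insert I by (auto simp: I'_def)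
  have LI': "L \<subseteq> I'"
    using insert by (auto simp: I'_def)
  have "\<exists>R'\<in>sets (\<Pi>\<^sub>M i\<in>I. lborel).
      emeasure (\<Pi>\<^sub>M i\<in>I. lborel) R' = emeasure (\<Pi>\<^sub>M i\<in>I. lborel) R \<and>
      (\<forall>x\<in>R'. \<forall>y\<in>R'. (\<Sum>i\<in>I. (x i - y i)\<^sup>2) \<le> D\<^sup>2) \<and>
      (\<forall>z\<in>R'. z(j := - z j) \<in> R') \<and>
      (\<forall>k\<in>I'. (\<forall>z\<in>R. z(k := - z k) \<in> R) \<longrightarrow> (\<forall>z\<in>R'. z(k := - z k) \<in> R'))"
    using R(1,3) unfolding I'(3) by (rule steiner_exists[OF I'(1,2)])
  then obtain R' where R': "R' \<in> sets (\<Pi>\<^sub>M i\<in>I. lborel)"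
      "emeasure (\<Pi>\<^sub>M i\<in>I. lborel) R' = emeasure (\<Pi>\<^sub>M i\<in>I. lborel) R"
      "\<forall>x\<in>R'. \<forall>y\<in>R'. (\<Sum>i\<in>I. (x i - y i)\<^sup>2) \<le> D\<^sup>2"
      "\<forall>z\<in>R'. z(j := - z j) \<in> R'"
      "\<forall>k\<in>I'. (\<forall>z\<in>R. z(k := - z k) \<in> R) \<longrightarrow> (\<forall>z\<in>R'. z(k := - z k) \<in> R')"
    by blast
  have sym: "\<forall>k\<in>insert j L. \<forall>z\<in>R'. z(k := - z k) \<in> R'"
    using R'(4,5) R(4) LI' by blast
  show ?case
    by (intro bexI[OF _ R'(1)] conjI sym R'(3)) (simp add: R'(2) R(2))
qed

text \<open>
  After symmetrization along all coordinates the set is invariant under \<open>x \<mapsto> - x\<close>. Then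
  \<open>2 |x| = |x - (- x)| \<le> D\<close> for each of its points, so it lies in the ball of radius \<open>D / 2\<close>.
\<close>

lemma isodiametric_PiM:
  fixes Q :: "('i \<Rightarrow> real) set"
  assumes I: "finite I" and D: "0 < D"
    and Q: "Q \<in> sets (\<Pi>\<^sub>M i\<in>I. lborel)"
    and diam: "\<And>x y. x \<in> Q \<Longrightarrow> y \<in> Q \<Longrightarrow> (\<Sum>i\<in>I. (x i - y i)\<^sup>2) \<le> D\<^sup>2"
  shows "emeasure (\<Pi>\<^sub>M i\<in>I. lborel) Q \<le> ennreal (unit_ball_vol (real (card I)) * (D / 2) ^ card I)"
proof -
  obtain R where R: "R \<in> sets (\<Pi>\<^sub>M i\<in>I. lborel)"
    "emeasure (\<Pi>\<^sub>M i\<in>I. lborel) R = emeasure (\<Pi>\<^sub>M i\<in>I. lborel) Q"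
    "\<And>x y. x \<in> R \<Longrightarrow> y \<in> R \<Longrightarrow> (\<Sum>i\<in>I. (x i - y i)\<^sup>2) \<le> D\<^sup>2"
    "\<And>k x. k \<in> I \<Longrightarrow> x \<in> R \<Longrightarrow> x(k := - x k) \<in> R"
    using symmetrization[OF I order_refl Q diam] by blast
  have refl: "(\<lambda>i. if i \<in> L then - x i else x i) \<in> R" if "x \<in> R" "L \<subseteq> I" for x L
    using finite_subset[OF that(2) I] that
  proof (induction L rule: finite_induct)
    case (insert k L)
    then have "(\<lambda>i. if i \<in> L then - x i else x i)(k := - (if k \<in> L then - x k else x k)) \<in> R"
      by (intro R(4)[where x = "\<lambda>i. if i \<in> L then - x i else x i"]) auto
    moreover have "(\<lambda>i. if i \<in> L then - x i else x i)(k := - (if k \<in> L then - x k else x k))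
        = (\<lambda>i. if i \<in> insert k L then - x i else x i)"
      using insert by (auto simp: fun_eq_iff)
    ultimately show ?case by simp
  qed simp
  have "sqrt (\<Sum>i\<in>I. (x i)\<^sup>2) \<le> D / 2" if "x \<in> R" for x
  proof -
    have "(\<Sum>i\<in>I. (x i - (if i \<in> I then - x i else x i))\<^sup>2) \<le> D\<^sup>2"
      using refl[OF that order_refl] that by (intro R(3)) auto
    also have "(\<Sum>i\<in>I. (x i - (if i \<in> I then - x i else x i))\<^sup>2) = 4 * (\<Sum>i\<in>I. (x i)\<^sup>2)"
      unfolding sum_distrib_left by (intro sum.cong) (auto simp: power2_eq_square)
    finally have "(\<Sum>i\<in>I. (x i)\<^sup>2) \<le> (D / 2)\<^sup>2"
      by (simp add: power_divide)
    then show ?thesis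
      using D by (intro real_le_lsqrt) (auto simp: sum_nonneg)
  qed
  then have "R \<subseteq> {f. sqrt (\<Sum>i\<in>I. (f i)\<^sup>2) \<le> D / 2} \<inter> space (\<Pi>\<^sub>M i\<in>I. lborel)"
    using sets.sets_into_space[OF R(1)] by auto
  then have "emeasure (\<Pi>\<^sub>M i\<in>I. lborel) R \<le>
     emeasure (\<Pi>\<^sub>M i\<in>I. lborel) ({f. sqrt (\<Sum>i\<in>I. (f i)\<^sup>2) \<le> D / 2} \<inter> space (\<Pi>\<^sub>M i\<in>I. lborel))"
    by (intro emeasure_mono) measurable
  then show ?thesis
    using emeasure_cball_aux[OF I, of "D / 2"] D R(2) by simp
qed

definition orth_proj :: "'a::real_inner \<Rightarrow> 'a \<Rightarrow> 'a" where
  "orth_proj v x = x - (x \<bullet> v) *\<^sub>R v"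

text \<open>
  The prism of height \<open>1\<close> over the projection of \<open>A\<close> to the hyperplane orthogonal to \<open>v\<close>. Its
  volume is the \<open>(n - 1)\<close>-dimensional measure of the projection, expressed through Lebesgue measure on
  the ambient space alone.
\<close>

definition shadow_prism :: "'a::real_inner \<Rightarrow> 'a set \<Rightarrow> 'a set" where
  "shadow_prism v A = {x. 0 \<le> x \<bullet> v \<and> x \<bullet> v \<le> 1 \<and> orth_proj v x \<in> orth_proj v ` A}"

lemma linear_orth_proj: "linear (orth_proj v)"
  unfolding orth_proj_def by (auto intro!: linearI simp: algebra_simps inner_simps)

lemma continuous_orth_proj: "continuous_on S (orth_proj v)"
  unfolding orth_proj_def by (intro continuous_intros)

lemma orth_proj_orthogonal:
  assumes "norm v = 1"
  shows "orth_proj v x \<bullet> v = 0" "orth_proj v (orth_proj v x) = orth_proj v x"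
    "(norm x)\<^sup>2 = (norm (orth_proj v x))\<^sup>2 + (x \<bullet> v)\<^sup>2"
proof -
  have vv: "v \<bullet> v = 1" using assms by (simp add: dot_square_norm)
  then show "orth_proj v x \<bullet> v = 0" "orth_proj v (orth_proj v x) = orth_proj v x"
    by (simp_all add: orth_proj_def inner_simps)
  show "(norm x)\<^sup>2 = (norm (orth_proj v x))\<^sup>2 + (x \<bullet> v)\<^sup>2"
    unfolding power2_norm_eq_inner
    by (simp add: orth_proj_def inner_simps vv inner_commute power2_eq_square)
qed

lemma norm_orth_proj_le:
  assumes "norm v = 1"
  shows "norm (orth_proj v x) \<le> norm x"
proof (rule power2_le_imp_le)
  show "(norm (orth_proj v x))\<^sup>2 \<le> (norm x)\<^sup>2"
    unfolding orth_proj_orthogonal(3)[OF assms, of x] by simp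
qed simp

lemma shadow_prism_mono: "A \<subseteq> B \<Longrightarrow> shadow_prism v A \<subseteq> shadow_prism v B"
  unfolding shadow_prism_def by blast

lemma shadow_prism_UN: "shadow_prism v (\<Union>i\<in>I. A i) = (\<Union>i\<in>I. shadow_prism v (A i))"
  unfolding shadow_prism_def image_UN by blast

lemma compact_shadow_prism:
  fixes A :: "'a::euclidean_space set"
  assumes v: "norm v = 1" and A: "compact A"
  shows "compact (shadow_prism v A)"
proof -
  have vv: "v \<bullet> v = 1" using v by (simp add: dot_square_norm)
  have "shadow_prism v A = (\<lambda>(y, t). orth_proj v y + t *\<^sub>R v) ` (A \<times> {0..1})"
  proof safe
    fix x assume "x \<in> shadow_prism v A"
    then obtain y where "y \<in> A" "orth_proj v x = orth_proj v y" "0 \<le> x \<bullet> v" "x \<bullet> v \<le> 1"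
      by (auto simp: shadow_prism_def)
    then show "x \<in> (\<lambda>(y, t). orth_proj v y + t *\<^sub>R v) ` (A \<times> {0..1})"
      by (intro image_eqI[of _ _ "(y, x \<bullet> v)"]) (auto simp: orth_proj_def algebra_simps)
  next
    fix y and t :: real assume "y \<in> A" "t \<in> {0..1}"
    then show "orth_proj v y + t *\<^sub>R v \<in> shadow_prism v A"
      by (auto simp: shadow_prism_def orth_proj_def inner_simps vv intro!: image_eqI[of _ _ y])
  qed
  moreover have "compact ((\<lambda>(y, t). orth_proj v y + t *\<^sub>R v) ` (A \<times> {0..1}))"
    unfolding case_prod_beta' orth_proj_def
    by (intro compact_continuous_image compact_Times A compact_Icc continuous_intros)
  ultimately show ?thesis by simp
qed

lemma borel_measurable_vec_lambda:
  fixes f :: "'a \<Rightarrow> 'n::finite \<Rightarrow> real"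
  assumes "\<And>i. (\<lambda>x. f x i) \<in> borel_measurable M"
  shows "(\<lambda>x. \<chi> i. f x i) \<in> borel_measurable M"
  by (subst borel_measurable_euclidean_space) (auto simp: Basis_vec_def inner_axis assms)

lemma lborel_cart_PiM:
  "(lborel :: (real ^ 'n) measure) = distr (\<Pi>\<^sub>M i\<in>UNIV. lborel) borel (\<lambda>f. \<chi> i. f i)"
proof (rule lborel_eqI)
  fix l u :: "real ^ 'n"
  assume le: "\<And>b. b \<in> Basis \<Longrightarrow> l \<bullet> b \<le> u \<bullet> b"
  have le': "l $ i \<le> u $ i" for i
    using le[of "axis i 1"] by (simp add: inner_axis axis_in_Basis_iff)
  interpret product_sigma_finite "\<lambda>_::'n. lborel :: real measure"
    by standard
  have [measurable]: "(\<lambda>f. \<chi> i. f i) \<in> (\<Pi>\<^sub>M i\<in>UNIV. lborel) \<rightarrow>\<^sub>M (borel :: (real ^ 'n) measure)"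
    by (rule borel_measurable_vec_lambda) measurable
  have "(\<lambda>f. \<chi> i. f i) -` box l u \<inter> space (\<Pi>\<^sub>M i\<in>UNIV. lborel) = (\<Pi>\<^sub>E i\<in>UNIV. {l $ i<..<u $ i})"
    by (auto simp: space_PiM mem_box_cart PiE_def Pi_iff)
  then have "emeasure (distr (\<Pi>\<^sub>M i\<in>UNIV. lborel) borel (\<lambda>f. \<chi> i. f i)) (box l u)
    = (\<Prod>i\<in>UNIV. emeasure lborel {l $ i<..<u $ i})"
    by (subst emeasure_distr) (auto simp: emeasure_PiM)
  also have "\<dots> = ennreal (\<Prod>i\<in>UNIV. (u - l) $ i)"
    using le' by (simp add: prod_ennreal)
  also have "\<dots> = (\<Prod>b\<in>Basis. (u - l) \<bullet> b)"
    using prod_Basis_cart[of "\<lambda>x. x" "u - l"] by simp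
  finally show "emeasure (distr (\<Pi>\<^sub>M i\<in>UNIV. lborel) borel (\<lambda>f. \<chi> i. f i)) (box l u) = (\<Prod>b\<in>Basis. (u - l) \<bullet> b)" .
qed simp

text \<open>
  Fubini in the \<open>k\<close>-th coordinate: for an axis direction the volume of the prism is a Lebesgue
  measure in the remaining \<open>n - 1\<close> coordinates.
\<close>

lemma emeasure_axis_prism:
  fixes B :: "(real ^ 'n) set" and k :: 'n
  defines "F \<equiv> \<lambda>f. (\<chi> i. (f(k := 0)) i) :: real ^ 'n"
  assumes B: "B \<in> sets borel"
  shows "{f \<in> space (\<Pi>\<^sub>M i\<in>UNIV - {k}. lborel). F f \<in> B} \<in> sets (\<Pi>\<^sub>M i\<in>UNIV - {k}. lborel)"
    "emeasure lborel {x. 0 \<le> x $ k \<and> x $ k \<le> 1 \<and> orth_proj (axis k 1) x \<in> B} =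
      emeasure (\<Pi>\<^sub>M i\<in>UNIV - {k}. lborel) {f \<in> space (\<Pi>\<^sub>M i\<in>UNIV - {k}. lborel). F f \<in> B}"
proof -
  interpret product_sigma_finite "\<lambda>_::'n. lborel :: real measure"
    by standard
  let ?M = "\<Pi>\<^sub>M i\<in>UNIV - {k}. (lborel :: real measure)" and ?N = "\<Pi>\<^sub>M i\<in>UNIV. (lborel :: real measure)"
  have Fm: "F \<in> ?M \<rightarrow>\<^sub>M borel"
    unfolding F_def
  proof (rule borel_measurable_vec_lambda)
    fix i :: 'n
    show "(\<lambda>f. (f(k := 0)) i) \<in> borel_measurable ?M"
      by (cases "i = k") auto
  qed
  let ?Q = "{f \<in> space ?M. F f \<in> B}" and ?A = "{x. 0 \<le> x $ k \<and> x $ k \<le> 1 \<and> orth_proj (axis k 1) x \<in> B}"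
  show Q: "?Q \<in> sets ?M"
    using measurable_sets[OF Fm B] by (simp add: vimage_def Int_def conj_commute)
  have proj: "orth_proj (axis k 1) x = (\<chi> i. if i = k then 0 else x $ i)" for x :: "real ^ 'n"
    by (auto simp: orth_proj_def vec_eq_iff inner_axis) (auto simp: axis_def)
  have A: "?A \<in> sets borel"
  proof -
    have [measurable]: "orth_proj (axis k 1) \<in> borel_measurable (borel :: (real ^ 'n) measure)"
      by (intro borel_measurable_continuous_onI continuous_orth_proj)
    have [measurable]: "(\<lambda>x::real ^ 'n. x $ k) \<in> borel_measurable borel"
      by (intro borel_measurable_continuous_onI continuous_intros)
    show ?thesis
      using B by measurable
  qed
  have L: "(\<lambda>f. \<chi> i. f i) \<in> ?N \<rightarrow>\<^sub>M (borel :: (real ^ 'n) measure)"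
    by (rule borel_measurable_vec_lambda) measurable
  let ?C = "(\<lambda>f. \<chi> i. f i) -` ?A \<inter> space ?N"
  have C: "?C \<in> sets ?N"
    using measurable_sets[OF L A] .
  have "emeasure lborel ?A = emeasure ?N ?C"
    using L A by (subst lborel_cart_PiM) (rule emeasure_distr)
  also have "\<dots> = (\<integral>\<^sup>+f. indicator ?C f \<partial>\<Pi>\<^sub>M i\<in>insert k (UNIV - {k}). lborel)"
    using C by (simp add: insert_absorb)
  also have "\<dots> = (\<integral>\<^sup>+f. \<integral>\<^sup>+t. indicator ?C (f(k := t)) \<partial>lborel \<partial>?M)"
    using C by (intro product_nn_integral_insert) (auto simp: insert_absorb)
  also have "\<dots> = (\<integral>\<^sup>+f. \<integral>\<^sup>+t. indicator ?Q f * indicator {0..1::real} t \<partial>lborel \<partial>?M)"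
  proof (intro nn_integral_cong)
    fix f :: "'n \<Rightarrow> real" and t :: real assume f: "f \<in> space ?M"
    have "orth_proj (axis k 1) (\<chi> i. (f(k := t)) i) = F f"
      unfolding proj by (auto simp: F_def vec_eq_iff)
    moreover have "f(k := t) \<in> ?C \<longleftrightarrow>
        0 \<le> t \<and> t \<le> 1 \<and> orth_proj (axis k 1) (\<chi> i. (f(k := t)) i) \<in> B"
      by (simp add: space_PiM fun_upd_def)
    ultimately have "f(k := t) \<in> ?C \<longleftrightarrow> 0 \<le> t \<and> t \<le> 1 \<and> F f \<in> B"
      by (simp only:)
    then show "indicator ?C (f(k := t)) = (indicator ?Q f * indicator {0..1} t :: ennreal)"
      using f by (auto simp: indicator_def)
  qed
  also have "\<dots> = emeasure ?M ?Q"
    using Q by (simp add: nn_integral_cmult)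
  finally show "emeasure lborel ?A = emeasure ?M ?Q" .
qed

lemma sum_remove_axis:
  "(norm (\<chi> i. (f(k := 0)) i :: real ^ 'n))\<^sup>2 = (\<Sum>i\<in>UNIV - {k}. (f i)\<^sup>2)"
proof -
  have "(norm (\<chi> i. (f(k := 0)) i :: real ^ 'n))\<^sup>2 = (\<Sum>i\<in>UNIV. ((f(k := 0)) i)\<^sup>2)"
    by (simp add: norm_vec_def L2_set_def sum_nonneg)
  also have "\<dots> = (\<Sum>i\<in>UNIV - {k}. ((f(k := 0)) i)\<^sup>2)"
    by (subst sum.remove[of _ k]) auto
  also have "\<dots> = (\<Sum>i\<in>UNIV - {k}. (f i)\<^sup>2)"
    by (intro sum.cong) auto
  finally show ?thesis .
qed

lemma shadow_prism_rotate:
  fixes v w :: "real ^ 'n"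
  assumes v: "norm v = 1" and w: "norm w = 1"
  obtains f where "orthogonal_transformation f" "f v = w"
    "\<And>A. shadow_prism w (f ` A) \<in> sets lebesgue \<Longrightarrow>
      emeasure lebesgue (shadow_prism v A) = emeasure lebesgue (shadow_prism w (f ` A))"
proof -
  obtain f where f: "orthogonal_transformation f" "f v = w"
    using orthogonal_transformation_exists_1[OF v w] by metis
  have lf: "linear f"
    using f(1) by (rule orthogonal_transformation_linear)
  have fi: "f x \<bullet> f y = x \<bullet> y" for x y
    using f(1) by (simp add: orthogonal_transformation_def)
  have fp: "orth_proj w (f x) = f (orth_proj v x)" for x
    using fi[of x v] by (simp add: orth_proj_def linear_diff[OF lf] linear_scale[OF lf] f(2))
  have "shadow_prism v A = f -` shadow_prism w (f ` A)" for A
    using fi[of _ v] orthogonal_transformation_inj[OF f(1)]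
    by (auto simp: shadow_prism_def f(2) fp image_image dest: injD)
  then have "emeasure lebesgue (shadow_prism v A) = emeasure (distr lebesgue lebesgue f) (shadow_prism w (f ` A))"
    if "shadow_prism w (f ` A) \<in> sets lebesgue" for A
    using emeasure_distr[OF orthogonal_image_lebesgue(1)[OF f(1)] that] by simp
  then show thesis
    unfolding orthogonal_image_lebesgue(2)[OF f(1)] using that f by blast
qed

text \<open>
  Projections do not increase diameters, so this is the isodiametric inequality in dimension
  \<open>n - 1\<close>, after a rotation of \<open>v\<close> to a coordinate axis.
\<close>

lemma isodiametric_prism:
  fixes C :: "(real ^ 'n) set"
  assumes v: "norm v = 1" and C: "compact C"
  shows "emeasure lebesgue (shadow_prism v C) \<le> hausdorff_weight (CARD('n) - 1) C"
proof (cases "C = {}")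
  case True
  then show ?thesis by (simp add: shadow_prism_def hausdorff_weight_def)
next
  case False
  fix k :: 'n
  define w where "w = (axis k 1 :: real ^ 'n)"
  have w: "norm w = 1" by (simp add: w_def)
  obtain f where f: "orthogonal_transformation f" "f v = w"
    "\<And>A. shadow_prism w (f ` A) \<in> sets lebesgue \<Longrightarrow>
      emeasure lebesgue (shadow_prism v A) = emeasure lebesgue (shadow_prism w (f ` A))"
    using shadow_prism_rotate[OF v w] by metis
  have cf: "compact (f ` C)"
    using f(1) by (intro compact_continuous_image C linear_continuous_on)
      (simp add: linear_conv_bounded_linear[symmetric] orthogonal_transformation_linear)
  let ?S = "shadow_prism w (f ` C)" and ?B = "orth_proj w ` f ` C"
  have "compact ?S" using compact_shadow_prism[OF w cf] .
  then have S: "?S \<in> sets borel" by (simp add: borel_compact)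
  have cB: "compact ?B" by (intro compact_continuous_image continuous_orth_proj cf)
  have fn: "norm (f x - f y) = norm (x - y)" for x y
    using f(1) by (metis orthogonal_transformation_isometry dist_norm)
  have bd: "emeasure lborel ?S \<le> ennreal (unit_ball_vol (real (CARD('n) - 1)) * (D / 2) ^ (CARD('n) - 1))"
    if D: "0 < D" "diameter C \<le> D" for D
  proof -
    let ?Q = "{g \<in> space (\<Pi>\<^sub>M i\<in>UNIV - {k}. lborel). (\<chi> i. (g(k := 0)) i) \<in> ?B}"
    have "?S = {x. 0 \<le> x $ k \<and> x $ k \<le> 1 \<and> orth_proj (axis k 1) x \<in> ?B}"
      by (auto simp: shadow_prism_def w_def inner_axis)
    then have "emeasure lborel ?S = emeasure (\<Pi>\<^sub>M i\<in>UNIV - {k}. lborel) ?Q"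
      using emeasure_axis_prism(2)[of ?B k] cB by (simp add: borel_compact)
    also have "\<dots> \<le> ennreal (unit_ball_vol (real (card (UNIV - {k}))) * (D / 2) ^ card (UNIV - {k}))"
    proof (rule isodiametric_PiM)
      show "?Q \<in> sets (\<Pi>\<^sub>M i\<in>UNIV - {k}. lborel)"
        using emeasure_axis_prism(1)[of ?B k] cB by (simp add: borel_compact)
      fix x y assume "x \<in> ?Q" "y \<in> ?Q"
      then obtain c d where cd: "c \<in> C" "d \<in> C" "(\<chi> i. (x(k := 0)) i) = orth_proj w (f c)"
        "(\<chi> i. (y(k := 0)) i) = orth_proj w (f d)"
        by auto
      have "(\<Sum>i\<in>UNIV - {k}. (x i - y i)\<^sup>2) = (norm (\<chi> i. ((\<lambda>i. x i - y i)(k := 0)) i :: real ^ 'n))\<^sup>2"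
        by (rule sum_remove_axis[symmetric])
      also have "(\<chi> i. ((\<lambda>i. x i - y i)(k := 0)) i) = (\<chi> i. (x(k := 0)) i) - ((\<chi> i. (y(k := 0)) i) :: real ^ 'n)"
        by (auto simp: vec_eq_iff)
      also have "\<dots> = orth_proj w (f c - f d)"
        unfolding cd by (rule linear_diff[OF linear_orth_proj, symmetric])
      finally have eq: "(\<Sum>i\<in>UNIV - {k}. (x i - y i)\<^sup>2) = (norm (orth_proj w (f c - f d)))\<^sup>2" .
      have "norm (orth_proj w (f c - f d)) \<le> norm (c - d)"
        using norm_orth_proj_le[OF w, of "f c - f d"] by (simp add: fn)
      also have "\<dots> \<le> D"
        using diameter_bounded_bound[OF compact_imp_bounded[OF C] cd(1,2)] D by (simp add: dist_norm)
      finally show "(\<Sum>i\<in>UNIV - {k}. (x i - y i)\<^sup>2) \<le> D\<^sup>2"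
        unfolding eq by (intro power_mono) auto
    qed (use D in auto)
    finally show ?thesis by (simp add: card_Diff_singleton)
  qed
  have "emeasure lborel ?S \<le> ennreal (unit_ball_vol (real (CARD('n) - 1)) * (diameter C / 2) ^ (CARD('n) - 1))"
  \<comment> \<open>The diameter may vanish, while the bound is available for positive \<open>D\<close> only.\<close>
  proof (rule LIMSEQ_le_const)
    let ?D = "\<lambda>m. diameter C + 1 / real (Suc m)"
    show "\<exists>N. \<forall>m\<ge>N. emeasure lborel ?S \<le> ennreal (unit_ball_vol (real (CARD('n) - 1)) * (?D m / 2) ^ (CARD('n) - 1))"
      using diameter_ge_0[OF compact_imp_bounded[OF C]] by (intro exI[of _ 0] allI impI bd) (auto intro: add_nonneg_pos)
    have "?D \<longlonglongrightarrow> diameter C + 0"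
      by (intro tendsto_intros LIMSEQ_Suc[OF lim_1_over_n, unfolded o_def])
    then have "?D \<longlonglongrightarrow> diameter C" by simp
    then show "(\<lambda>m. ennreal (unit_ball_vol (real (CARD('n) - 1)) * (?D m / 2) ^ (CARD('n) - 1)))
       \<longlonglongrightarrow> ennreal (unit_ball_vol (real (CARD('n) - 1)) * (diameter C / 2) ^ (CARD('n) - 1))"
      by (intro tendsto_intros) auto
  qed
  then have "emeasure lebesgue ?S \<le> hausdorff_weight (CARD('n) - 1) C"
    using False S by (simp add: hausdorff_weight_def)
  then show ?thesis
    using f(3)[of C] S by simp
qed

lemma emeasure_ball_prism:
  fixes v s :: "real ^ 'n"
  assumes v: "norm v = 1" and r: "0 < r"
  shows "emeasure lebesgue (shadow_prism v (cball s r)) = ennreal (unit_ball_vol (real (CARD('n) - 1)) * r ^ (CARD('n) - 1))"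
proof -
  have vv: "v \<bullet> v = 1" using v by (simp add: dot_square_norm)
  fix k :: 'n
  define w where "w = (axis k 1 :: real ^ 'n)"
  have w: "norm w = 1" by (simp add: w_def)
  have mem: "orth_proj u x \<in> orth_proj u ` cball s r \<longleftrightarrow> norm (orth_proj u x - orth_proj u s) \<le> r"
    if u: "norm u = 1" for u x s :: "real ^ 'n"
  proof
    assume "orth_proj u x \<in> orth_proj u ` cball s r"
    then obtain y where "orth_proj u x = orth_proj u y" "norm (y - s) \<le> r"
      by (auto simp: dist_norm norm_minus_commute)
    then show "norm (orth_proj u x - orth_proj u s) \<le> r"
      using norm_orth_proj_le[OF u, of "y - s"] by (simp add: linear_diff[OF linear_orth_proj])
  next
    assume *: "norm (orth_proj u x - orth_proj u s) \<le> r"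
    have uu: "u \<bullet> u = 1" using u by (simp add: dot_square_norm)
    have "orth_proj u x = orth_proj u (orth_proj u x + (s \<bullet> u) *\<^sub>R u)"
      by (simp add: orth_proj_def inner_simps uu)
    moreover have "s - (orth_proj u x + (s \<bullet> u) *\<^sub>R u) = orth_proj u s - orth_proj u x"
      by (simp add: orth_proj_def)
    then have "orth_proj u x + (s \<bullet> u) *\<^sub>R u \<in> cball s r"
      using * by (simp only: mem_cball dist_norm norm_minus_commute)
    ultimately show "orth_proj u x \<in> orth_proj u ` cball s r"
      by (rule image_eqI)
  qed
  have comp: "compact (shadow_prism u (cball s r))" if "norm u = 1" for u s :: "real ^ 'n"
    using compact_shadow_prism[OF that compact_cball] .
  obtain f where f: "orthogonal_transformation f" "f v = w"
    "\<And>A. shadow_prism w (f ` A) \<in> sets lebesgue \<Longrightarrow>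
      emeasure lebesgue (shadow_prism v A) = emeasure lebesgue (shadow_prism w (f ` A))"
    using shadow_prism_rotate[OF v w] by metis
  have fb: "f ` cball 0 r = cball 0 r"
    using image_orthogonal_transformation_cball[OF f(1), of 0 r] f(1)
    by (simp add: orthogonal_transformation_linear linear_0)
  have "shadow_prism v (cball s r) = (\<lambda>x. orth_proj v s + x) ` shadow_prism v (cball 0 r)"
  proof safe
    fix x assume "x \<in> shadow_prism v (cball s r)"
    then show "x \<in> (+) (orth_proj v s) ` shadow_prism v (cball 0 r)"
      using orth_proj_orthogonal(1,2)[OF v] linear_diff[OF linear_orth_proj, of v x "orth_proj v s"]
      by (intro image_eqI[of _ _ "x - orth_proj v s"])
        (auto simp: shadow_prism_def mem[OF v] inner_simps linear_0[OF linear_orth_proj])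
  next
    fix x assume "x \<in> shadow_prism v (cball 0 r)"
    then show "orth_proj v s + x \<in> shadow_prism v (cball s r)"
      using orth_proj_orthogonal(1,2)[OF v] linear_add[OF linear_orth_proj, of v "orth_proj v s" x]
      by (auto simp: shadow_prism_def mem[OF v] inner_simps linear_0[OF linear_orth_proj])
  qed
  then have "emeasure lebesgue (shadow_prism v (cball s r)) = emeasure lebesgue (shadow_prism v (cball 0 r))"
    using comp[OF v, of s] comp[OF v, of 0]
    by (simp add: emeasure_eq_measure2 lmeasurable_compact measure_translation)
  also have "\<dots> = emeasure lebesgue (shadow_prism w (cball 0 r))"
    using f(3)[of "cball 0 r"] comp[OF w, of 0] fb by (simp add: borel_compact)
  also have "\<dots> = emeasure lborel (shadow_prism w (cball 0 r))"
    using comp[OF w, of 0] by (simp add: borel_compact)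
  also have "shadow_prism w (cball 0 r) = {x. 0 \<le> x $ k \<and> x $ k \<le> 1 \<and> orth_proj (axis k 1) x \<in> cball 0 r}"
    unfolding shadow_prism_def mem[OF w]
    by (auto simp: linear_0[OF linear_orth_proj] w_def inner_axis)
  also have "emeasure lborel \<dots> = emeasure (\<Pi>\<^sub>M i\<in>UNIV - {k}. lborel)
      {f \<in> space (\<Pi>\<^sub>M i\<in>UNIV - {k}. lborel). (\<chi> i. (f(k := 0)) i :: real ^ 'n) \<in> cball 0 r}"
    by (rule emeasure_axis_prism(2)) auto
  also have "{f \<in> space (\<Pi>\<^sub>M i\<in>UNIV - {k}. lborel). (\<chi> i. (f(k := 0)) i :: real ^ 'n) \<in> cball 0 r}
      = {f. sqrt (\<Sum>i\<in>UNIV - {k}. (f i)\<^sup>2) \<le> r} \<inter> space (\<Pi>\<^sub>M i\<in>UNIV - {k}. lborel)"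
    using r by (auto simp: sum_remove_axis[symmetric])
  also have "emeasure (\<Pi>\<^sub>M i\<in>UNIV - {k}. lborel) \<dots> = ennreal (unit_ball_vol (real (card (UNIV - {k}))) * r ^ card (UNIV - {k}))"
    by (rule emeasure_cball_aux) (use r in auto)
  finally show ?thesis by (simp add: card_Diff_singleton)
qed

section \<open>Hausdorff measure and orthogonal projection\<close>

lemma hausdorff_weight_empty [simp]: "hausdorff_weight d {} = 0"
  by (simp add: hausdorff_weight_def)

lemma hausdorff_premeasure_le:
  assumes "A \<subseteq> (\<Union>i. C i)" "\<And>i. bounded (C i)" "\<And>i. diameter (C i) \<le> \<delta>"
  shows "hausdorff_premeasure d \<delta> A \<le> (\<Sum>i. hausdorff_weight d (C i))"
  unfolding hausdorff_premeasure_def using assms by (intro Inf_lower) auto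

lemma hausdorff_premeasure_greatest:
  assumes "\<And>C :: nat \<Rightarrow> 'a::metric_space set. A \<subseteq> (\<Union>i. C i) \<Longrightarrow> (\<And>i. bounded (C i)) \<Longrightarrow> (\<And>i. diameter (C i) \<le> \<delta>) \<Longrightarrow>
    X \<le> (\<Sum>i. hausdorff_weight d (C i))"
  shows "X \<le> hausdorff_premeasure d \<delta> A"
  unfolding hausdorff_premeasure_def using assms by (intro Inf_greatest) auto

lemma hausdorff_premeasure_mono: "A \<subseteq> B \<Longrightarrow> hausdorff_premeasure d \<delta> A \<le> hausdorff_premeasure d \<delta> B"
  by (rule hausdorff_premeasure_greatest) (rule hausdorff_premeasure_le, auto)

lemma hausdorff_premeasure_antimono: "\<delta> \<le> \<epsilon> \<Longrightarrow> hausdorff_premeasure d \<epsilon> A \<le> hausdorff_premeasure d \<delta> A"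
  by (rule hausdorff_premeasure_greatest) (rule hausdorff_premeasure_le, auto intro: order_trans)

lemma hausdorff_measure_mono: "A \<subseteq> B \<Longrightarrow> hausdorff_measure d A \<le> hausdorff_measure d B"
  unfolding hausdorff_measure_def by (intro SUP_mono) (auto intro: hausdorff_premeasure_mono)

lemma hausdorff_premeasure_le_measure: "0 < \<delta> \<Longrightarrow> hausdorff_premeasure d \<delta> A \<le> hausdorff_measure d A"
  unfolding hausdorff_measure_def by (rule SUP_upper) auto

lemma hausdorff_measure_least:
  "(\<And>\<delta>. 0 < \<delta> \<Longrightarrow> hausdorff_premeasure d \<delta> A \<le> X) \<Longrightarrow> hausdorff_measure d A \<le> X"
  unfolding hausdorff_measure_def by (rule SUP_least) auto

lemma hausdorff_measure_empty [simp]: "hausdorff_measure d {} = 0"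
proof -
  have "hausdorff_premeasure d \<delta> ({} :: 'a set) \<le> (\<Sum>i. hausdorff_weight d ((\<lambda>_::nat. {} :: 'a set) i))"
    if "0 < \<delta>" for \<delta>
    using that by (intro hausdorff_premeasure_le) (auto simp: diameter_def)
  then have "hausdorff_measure d ({} :: 'a set) \<le> 0"
    by (intro hausdorff_measure_least) simp
  then show ?thesis by simp
qed

text \<open>
  Two nearly optimal covers are merged into one sequence by enumerating \<open>\<nat> \<times> \<nat>\<close>, with all rows but
  two empty.
\<close>

lemma hausdorff_premeasure_subadditive:
  assumes \<delta>: "0 \<le> \<delta>"
  shows "hausdorff_premeasure d \<delta> (A \<union> B) \<le> hausdorff_premeasure d \<delta> A + hausdorff_premeasure d \<delta> (B :: 'a::metric_space set)"
proof (rule ennreal_le_epsilon)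
  fix e :: real
  assume fin: "hausdorff_premeasure d \<delta> A + hausdorff_premeasure d \<delta> B < top" and e: "0 < e"
  have near: "\<exists>C :: nat \<Rightarrow> 'a set. S \<subseteq> (\<Union>i. C i) \<and> (\<forall>i. bounded (C i) \<and> diameter (C i) \<le> \<delta>) \<and>
      (\<Sum>i. hausdorff_weight d (C i)) \<le> hausdorff_premeasure d \<delta> S + ennreal (e / 2)"
    if "hausdorff_premeasure d \<delta> S < top" for S
  proof (rule ccontr)
    assume "\<not> ?thesis"
    then have "hausdorff_premeasure d \<delta> S + ennreal (e / 2) \<le> hausdorff_premeasure d \<delta> S"
      by (intro hausdorff_premeasure_greatest) (metis linear)
    then show False
      using that e
      by (cases "hausdorff_premeasure d \<delta> S" rule: ennreal_cases) (auto simp flip: ennreal_plus)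
  qed
  obtain C where C: "A \<subseteq> (\<Union>i. C i)" "\<And>i::nat. bounded (C i) \<and> diameter (C i) \<le> \<delta>"
    "(\<Sum>i. hausdorff_weight d (C i)) \<le> hausdorff_premeasure d \<delta> A + ennreal (e / 2)"
    using near[of A] fin by (auto simp: add_top)
  obtain C' where C': "B \<subseteq> (\<Union>i. C' i)" "\<And>i::nat. bounded (C' i) \<and> diameter (C' i) \<le> \<delta>"
    "(\<Sum>i. hausdorff_weight d (C' i)) \<le> hausdorff_premeasure d \<delta> B + ennreal (e / 2)"
    using near[of B] fin by (auto simp: add_top)
  define D where "D = (\<lambda>(m :: nat, n). if m = 0 then C n else if m = 1 then C' n else ({} :: 'a set))"
  have D0: "D (0, n) = C n" and D1: "D (1, n) = C' n" for n
    by (simp_all add: D_def)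
  have "D p \<subseteq> (\<Union>i. D (prod_decode i))" for p
  proof -
    have "D (prod_decode (prod_encode p)) \<subseteq> (\<Union>i. D (prod_decode i))"
      by (rule UN_upper) simp
    then show ?thesis by simp
  qed
  then have sub: "D (m, n) \<subseteq> (\<Union>i. D (prod_decode i))" for m n .
  have "(\<Union>n. C n) \<subseteq> (\<Union>i. D (prod_decode i))" "(\<Union>n. C' n) \<subseteq> (\<Union>i. D (prod_decode i))"
    by (rule UN_least, use sub[of 0] in \<open>simp only: D0\<close>) (rule UN_least, use sub[of 1] in \<open>simp only: D1\<close>)
  from order_trans[OF C(1) this(1)] order_trans[OF C'(1) this(2)]
  have cover: "A \<union> B \<subseteq> (\<Union>i. D (prod_decode i))"
    by (rule Un_least)
  have DD: "bounded (D p)" "diameter (D p) \<le> \<delta>" for p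
    using C(2) C'(2) \<delta> by (simp_all add: D_def split: prod.split)
  have "hausdorff_premeasure d \<delta> (A \<union> B) \<le> (\<Sum>i. hausdorff_weight d (D (prod_decode i)))"
    by (rule hausdorff_premeasure_le[OF cover DD])
  also have "\<dots> = (\<Sum>m. \<Sum>n. hausdorff_weight d (D (m, n)))"
    by (rule suminf_ennreal_2dimen) simp
  also have "\<dots> = (\<Sum>m\<in>{0, 1}. \<Sum>n. hausdorff_weight d (D (m, n)))"
    by (rule suminf_finite) (auto simp: D_def)
  also have "\<dots> = (\<Sum>i. hausdorff_weight d (C i)) + (\<Sum>i. hausdorff_weight d (C' i))"
    by (simp add: D_def)
  also have "\<dots> \<le> (hausdorff_premeasure d \<delta> A + ennreal (e / 2)) + (hausdorff_premeasure d \<delta> B + ennreal (e / 2))"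
    using C(3) C'(3) by (rule add_mono)
  also have "\<dots> = hausdorff_premeasure d \<delta> A + hausdorff_premeasure d \<delta> B + (ennreal (e / 2) + ennreal (e / 2))"
    by (simp only: ac_simps)
  also have "ennreal (e / 2) + ennreal (e / 2) = ennreal e"
    using e by (subst ennreal_plus[symmetric]) auto
  finally show "hausdorff_premeasure d \<delta> (A \<union> B) \<le> hausdorff_premeasure d \<delta> A + hausdorff_premeasure d \<delta> B + ennreal e" .
qed

lemma hausdorff_measure_Un_le: "hausdorff_measure d (A \<union> B) \<le> hausdorff_measure d A + hausdorff_measure d B"
  by (rule hausdorff_measure_least)
    (meson add_mono hausdorff_premeasure_le_measure hausdorff_premeasure_subadditive less_imp_le order_trans)

lemma hausdorff_measure_UN_le:
  "finite I \<Longrightarrow> hausdorff_measure d (\<Union>i\<in>I. A i) \<le> (\<Sum>i\<in>I. hausdorff_measure d (A i))"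
proof (induction I rule: finite_induct)
  case (insert i I)
  then show ?case
    using hausdorff_measure_Un_le[of d "A i" "\<Union>i\<in>I. A i"] by (auto intro: order_trans add_mono)
qed simp

text \<open>
  Disjoint compact sets have positive distance, so a covering set of smaller diameter meets only one
  of them and every fine cover of the union splits into a cover of each.
\<close>

lemma hausdorff_measure_separated:
  fixes A B :: "'a::euclidean_space set"
  assumes A: "compact A" and B: "compact B" and AB: "A \<inter> B = {}"
  shows "hausdorff_measure d A + hausdorff_measure d B \<le> hausdorff_measure d (A \<union> B)"
proof -
  obtain \<eta> where \<eta>: "0 < \<eta>" "\<And>a b. a \<in> A \<Longrightarrow> b \<in> B \<Longrightarrow> \<eta> \<le> dist a b"
    using separate_compact_closed[OF A compact_imp_closed[OF B] AB] by blast
  have sep: "hausdorff_premeasure d \<delta> A + hausdorff_premeasure d \<delta> B \<le> hausdorff_premeasure d \<delta> (A \<union> B)"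
    if \<delta>: "0 < \<delta>" "\<delta> < \<eta>" for \<delta>
  proof (rule hausdorff_premeasure_greatest)
    fix C :: "nat \<Rightarrow> 'a set"
    assume C: "A \<union> B \<subseteq> (\<Union>i. C i)" "\<And>i. bounded (C i)" "\<And>i. diameter (C i) \<le> \<delta>"
    let ?C = "\<lambda>S i. if C i \<inter> S = {} then {} else C i"
    have one: "hausdorff_premeasure d \<delta> S \<le> (\<Sum>i. hausdorff_weight d (?C S i))" if "S \<subseteq> A \<union> B" for S
    proof (rule hausdorff_premeasure_le)
      show "S \<subseteq> (\<Union>i. ?C S i)"
        using that C(1) by (force split: if_splits)
      show "bounded (?C S i)" "diameter (?C S i) \<le> \<delta>" for i
        using C(2,3)[of i] \<delta> by simp_all
    qed
    have "C i \<inter> A = {} \<or> C i \<inter> B = {}" for i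
    proof (rule ccontr)
      assume "\<not> ?thesis"
      then obtain a b where "a \<in> C i" "a \<in> A" "b \<in> C i" "b \<in> B" by blast
      then show False
        using diameter_bounded_bound[OF C(2), of a i b] C(3)[of i] \<eta>(2)[of a b] \<delta> by simp
    qed
    then have le: "hausdorff_weight d (?C A i) + hausdorff_weight d (?C B i) \<le> hausdorff_weight d (C i)" for i
      by (cases "C i \<inter> A = {}"; cases "C i \<inter> B = {}") auto
    have "hausdorff_premeasure d \<delta> A + hausdorff_premeasure d \<delta> B \<le>
        (\<Sum>i. hausdorff_weight d (?C A i)) + (\<Sum>i. hausdorff_weight d (?C B i))"
      by (intro add_mono one) auto
    also have "\<dots> = (\<Sum>i. hausdorff_weight d (?C A i) + hausdorff_weight d (?C B i))"
      by (intro suminf_add) auto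
    also have "\<dots> \<le> (\<Sum>i. hausdorff_weight d (C i))"
      using le by (intro suminf_le) auto
    finally show "hausdorff_premeasure d \<delta> A + hausdorff_premeasure d \<delta> B \<le> (\<Sum>i. hausdorff_weight d (C i))" .
  qed
  have "hausdorff_premeasure d \<delta> A + hausdorff_premeasure d \<epsilon> B \<le> hausdorff_measure d (A \<union> B)"
    if "0 < \<delta>" "0 < \<epsilon>" for \<delta> \<epsilon>
  proof -
    define \<gamma> where "\<gamma> = min (min \<delta> \<epsilon>) (\<eta> / 2)"
    have \<gamma>: "0 < \<gamma>" "\<gamma> < \<eta>" "\<gamma> \<le> \<delta>" "\<gamma> \<le> \<epsilon>"
      using that \<eta> by (auto simp: \<gamma>_def min_def)
    have "hausdorff_premeasure d \<delta> A + hausdorff_premeasure d \<epsilon> B \<le> hausdorff_premeasure d \<gamma> A + hausdorff_premeasure d \<gamma> B"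
      using \<gamma> by (intro add_mono hausdorff_premeasure_antimono)
    also have "\<dots> \<le> hausdorff_premeasure d \<gamma> (A \<union> B)"
      using \<gamma> by (intro sep)
    also have "\<dots> \<le> hausdorff_measure d (A \<union> B)"
      using \<gamma> by (intro hausdorff_premeasure_le_measure)
    finally show ?thesis .
  qed
  then have "(SUP \<epsilon>\<in>{0<..}. SUP \<delta>\<in>{0<..}. hausdorff_premeasure d \<delta> A + hausdorff_premeasure d \<epsilon> B) \<le> hausdorff_measure d (A \<union> B)"
    by (intro SUP_least) auto
  moreover have "(SUP \<epsilon>\<in>{0<..}. SUP \<delta>\<in>{0<..}. hausdorff_premeasure d \<delta> A + hausdorff_premeasure d \<epsilon> B)
      = hausdorff_measure d A + hausdorff_measure d B"
    unfolding hausdorff_measure_def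
    by (subst ennreal_SUP_add_left) (auto simp: ennreal_SUP_add_right ex_gt_or_lt intro: exI[of _ "1::real"])
  ultimately show ?thesis by simp
qed

lemma hausdorff_measure_disjoint_compact:
  fixes A :: "'i \<Rightarrow> 'a::euclidean_space set"
  assumes "finite I" and "\<And>i. i \<in> I \<Longrightarrow> compact (A i)"
    and "\<And>i j. i \<in> I \<Longrightarrow> j \<in> I \<Longrightarrow> i \<noteq> j \<Longrightarrow> A i \<inter> A j = {}"
  shows "(\<Sum>i\<in>I. hausdorff_measure d (A i)) \<le> hausdorff_measure d (\<Union>i\<in>I. A i)"
  using assms
proof (induction I rule: finite_induct)
  case (insert i I)
  have "compact (\<Union>i\<in>I. A i)"
    using insert.hyps insert.prems by (intro compact_UN) auto
  moreover have "A i \<inter> (\<Union>i\<in>I. A i) = {}"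
    using insert.hyps insert.prems(2)[of i] by auto
  ultimately have "hausdorff_measure d (A i) + hausdorff_measure d (\<Union>i\<in>I. A i)
      \<le> hausdorff_measure d (A i \<union> (\<Union>i\<in>I. A i))"
    using insert.prems by (intro hausdorff_measure_separated) auto
  moreover have "(\<Sum>i\<in>I. hausdorff_measure d (A i)) \<le> hausdorff_measure d (\<Union>i\<in>I. A i)"
    using insert.prems by (intro insert.IH) auto
  ultimately show ?case
    using insert.hyps by (auto intro: order_trans add_left_mono)
qed simp

text \<open>
  Every cover of \<open>A\<close> yields a cover of the prism by prisms over its members, and by the isodiametric
  inequality each of these has at most the weight of the member.
\<close>

lemma prism_le_hausdorff_measure:
  fixes A :: "(real ^ 'n) set"
  assumes v: "norm v = 1" and A: "shadow_prism v A \<in> sets lebesgue"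
  shows "emeasure lebesgue (shadow_prism v A) \<le> hausdorff_measure (CARD('n) - 1) A"
proof -
  have "emeasure lebesgue (shadow_prism v A) \<le> hausdorff_premeasure (CARD('n) - 1) 1 A"
  proof (rule hausdorff_premeasure_greatest)
    fix C :: "nat \<Rightarrow> (real ^ 'n) set"
    assume C: "A \<subseteq> (\<Union>i. C i)" "\<And>i. bounded (C i)" "\<And>i. diameter (C i) \<le> 1"
    have comp: "compact (closure (C i))" for i
      using C(2) by (simp add: compact_closure)
    then have m: "shadow_prism v (closure (C i)) \<in> sets lebesgue" for i
      using compact_shadow_prism[OF v] by (simp add: borel_compact)
    have "A \<subseteq> (\<Union>i. closure (C i))"
      using C(1) closure_subset by blast
    then have "shadow_prism v A \<subseteq> (\<Union>i. shadow_prism v (closure (C i)))"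
      unfolding shadow_prism_UN[symmetric] by (rule shadow_prism_mono)
    then have "emeasure lebesgue (shadow_prism v A) \<le> emeasure lebesgue (\<Union>i. shadow_prism v (closure (C i)))"
      using m by (intro emeasure_mono) auto
    also have "\<dots> \<le> (\<Sum>i. emeasure lebesgue (shadow_prism v (closure (C i))))"
      using m by (intro emeasure_subadditive_countably) auto
    also have "\<dots> \<le> (\<Sum>i. hausdorff_weight (CARD('n) - 1) (C i))"
    proof (intro suminf_le)
      fix i
      have "hausdorff_weight (CARD('n) - 1) (closure (C i)) = hausdorff_weight (CARD('n) - 1) (C i)"
        using diameter_closure[OF C(2)[of i]] by (simp add: hausdorff_weight_def)
      then show "emeasure lebesgue (shadow_prism v (closure (C i))) \<le> hausdorff_weight (CARD('n) - 1) (C i)"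
        using isodiametric_prism[OF v comp, of i] by simp
    qed auto
    finally show "emeasure lebesgue (shadow_prism v A) \<le> (\<Sum>i. hausdorff_weight (CARD('n) - 1) (C i))" .
  qed
  also have "\<dots> \<le> hausdorff_measure (CARD('n) - 1) A"
    by (rule hausdorff_premeasure_le_measure) simp
  finally show ?thesis .
qed

text \<open>
  The projection of \<open>A\<close> is covered efficiently by small balls, whose preimages in \<open>A\<close> have at most
  \<open>L\<close> times their diameter. By Vitali's lemma there are disjoint balls whose prisms stay in an open set
  hardly larger than the prism over \<open>A\<close>, and which cover everything once all but finitely many of them
  are enlarged five times; the enlarged ones contribute only the tail of a convergent series. The balls
  are taken in the ambient space with centres in the hyperplane: disjoint balls then have disjoint
  traces in the hyperplane, hence disjoint prisms, and the volume of such a prism is exactly the weight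
  of the ball.
\<close>

lemma hausdorff_measure_le_prism:
  fixes A :: "(real ^ 'n) set"
  assumes v: "norm v = 1" and A: "bounded A" "shadow_prism v A \<in> sets lebesgue" and L: "0 \<le> L"
    and lip: "\<And>x y. x \<in> A \<Longrightarrow> y \<in> A \<Longrightarrow> norm (x - y) \<le> L * norm (orth_proj v x - orth_proj v y)"
  shows "hausdorff_measure (CARD('n) - 1) A \<le> ennreal (L ^ (CARD('n) - 1)) * emeasure lebesgue (shadow_prism v A)"
proof (rule hausdorff_measure_least)
  fix \<delta> :: real assume \<delta>: "0 < \<delta>"
  define d where "d = CARD('n) - 1"
  define \<omega> where "\<omega> = unit_ball_vol (real d)"
  have \<omega>: "0 < \<omega>" by (simp add: \<omega>_def)
  have "shadow_prism v A \<subseteq> shadow_prism v (closure A)"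
    by (intro shadow_prism_mono closure_subset)
  moreover have "compact (shadow_prism v (closure A))"
    using A by (intro compact_shadow_prism v) (simp add: compact_closure)
  ultimately have lm: "shadow_prism v A \<in> lmeasurable"
    using A(2) by (meson bounded_set_imp_lmeasurable bounded_subset compact_imp_bounded)
  define M where "M = measure lebesgue (shadow_prism v A)"
  have M: "0 \<le> M" "emeasure lebesgue (shadow_prism v A) = ennreal M"
    using lm by (auto simp: M_def emeasure_eq_measure2)
  have "hausdorff_premeasure d \<delta> A \<le> ennreal (L ^ d * M) + ennreal \<epsilon>" if \<epsilon>: "0 < \<epsilon>" for \<epsilon>
  proof -
    \<comment> \<open>The excess volume of the open set enters with the factor \<open>L ^ d\<close>, the tail of the enlarged
      balls with the factor \<open>(5 * L) ^ d\<close>.\<close>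
    define e where "e = \<epsilon> / (L ^ d + (5 * L) ^ d + 1)"
    have e: "0 < e" "L ^ d * e + (5 * L) ^ d * e \<le> \<epsilon>"
    proof -
      have pos: "0 \<le> L ^ d" "0 \<le> (5 * L) ^ d" using L by auto
      then show "0 < e" using \<epsilon> by (auto simp: e_def intro!: divide_pos_pos add_nonneg_pos)
      have "(L ^ d + (5 * L) ^ d) * e \<le> (L ^ d + (5 * L) ^ d + 1) * e"
        using \<open>0 < e\<close> by (intro mult_right_mono) auto
      also have "\<dots> = \<epsilon>"
        using pos add_nonneg_pos[OF add_nonneg_nonneg[OF pos] zero_less_one] by (simp add: e_def)
      finally show "L ^ d * e + (5 * L) ^ d * e \<le> \<epsilon>"
        by (simp add: distrib_right)
    qed
    obtain U where U: "open U" "shadow_prism v A \<subseteq> U" "emeasure lebesgue U \<le> ennreal (M + e)"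
    proof -
      obtain T where T: "open T" "shadow_prism v A \<subseteq> T" "T - shadow_prism v A \<in> lmeasurable"
        "emeasure lebesgue (T - shadow_prism v A) < ennreal e"
        using sets_lebesgue_outer_open[OF A(2) e(1)] by blast
      have "emeasure lebesgue T = emeasure lebesgue (shadow_prism v A) + emeasure lebesgue (T - shadow_prism v A)"
        using T A(2) by (subst plus_emeasure) (auto simp: Un_absorb1)
      also have "\<dots> \<le> ennreal M + ennreal e"
        using T(4) M by (intro add_mono) auto
      also have "\<dots> = ennreal (M + e)"
        using M e by (simp add: ennreal_plus)
      finally show thesis
        using that T by blast
    qed
    \<comment> \<open>Preimages of balls of radius \<open>5 \<rho>\<close> have diameter at most \<open>10 L \<rho> \<le> \<delta>\<close>; the summand \<open>1\<close>
      covers the case \<open>L = 0\<close>.\<close>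
    define \<rho> where "\<rho> = \<delta> / (10 * (L + 1))"
    have \<rho>: "0 < \<rho>" "10 * L * \<rho> \<le> \<delta>"
      using \<delta> L by (auto simp: \<rho>_def field_simps)
    define K where "K = {(s, r). s \<in> orth_proj v ` A \<and> 0 < r \<and> r \<le> \<rho> \<and> shadow_prism v (cball s r) \<subseteq> U}"
    have proj2: "orth_proj v s = s" if "s \<in> orth_proj v ` A" for s
      using that orth_proj_orthogonal(2)[OF v] by auto
    have proj_in: "norm (orth_proj v x - s) \<le> r" if x: "x \<in> shadow_prism v (cball s r)" and s: "s \<in> orth_proj v ` A" for x s r
    proof -
      obtain y where y: "orth_proj v x = orth_proj v y" "norm (y - s) \<le> r"
        using x by (auto simp: shadow_prism_def dist_norm norm_minus_commute)
      then show ?thesis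
        using norm_orth_proj_le[OF v, of "y - s"] proj2[OF s]
        by (simp add: linear_diff[OF linear_orth_proj])
    qed
    \<comment> \<open>The segment of the prism above \<open>s\<close> is compact, so it has a neighbourhood inside \<open>U\<close>.\<close>
    have small: "\<exists>r0>0. \<forall>r. 0 < r \<and> r \<le> r0 \<longrightarrow> (s, r) \<in> K" if s: "s \<in> orth_proj v ` A" for s
    proof -
      let ?S = "(\<lambda>t. s + t *\<^sub>R v) ` {0..1::real}"
      have "compact ?S"
        by (intro compact_continuous_image continuous_intros compact_Icc)
      moreover have "?S \<subseteq> U"
      proof -
        have sv: "s \<bullet> v = 0" "v \<bullet> v = 1"
          using s orth_proj_orthogonal(1)[OF v] v by (auto simp: dot_square_norm)
        then have "s + t *\<^sub>R v \<in> shadow_prism v A" if "t \<in> {0..1}" for t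
          using that s by (simp add: shadow_prism_def inner_simps orth_proj_def)
        then show ?thesis using U(2) by blast
      qed
      ultimately obtain \<epsilon> where \<epsilon>: "0 < \<epsilon>" "(\<Union>x\<in>?S. cball x \<epsilon>) \<subseteq> U"
        using compact_subset_open_imp_cball_epsilon_subset[OF _ U(1)] by blast
      have "shadow_prism v (cball s r) \<subseteq> U" if "r \<le> \<epsilon>" for r
      proof
        fix x assume x: "x \<in> shadow_prism v (cball s r)"
        then have "s + (x \<bullet> v) *\<^sub>R v \<in> ?S"
          by (auto simp: shadow_prism_def)
        moreover have "s + (x \<bullet> v) *\<^sub>R v - x = - (orth_proj v x - s)"
          by (simp add: orth_proj_def)
        then have "x \<in> cball (s + (x \<bullet> v) *\<^sub>R v) \<epsilon>"
          using proj_in[OF x s] that by (simp only: mem_cball dist_norm norm_minus_cancel)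
        ultimately show "x \<in> U" using \<epsilon>(2) by blast
      qed
      then show ?thesis
        using \<epsilon>(1) \<rho>(1) s by (intro exI[of _ "min \<epsilon> \<rho>"]) (auto simp: K_def)
    qed
    have radius: "0 < snd i \<and> snd i \<le> \<rho>" if "i \<in> K" for i
      using that by (auto simp: K_def)
    obtain F where F: "countable F" "F \<subseteq> K"
      "pairwise (\<lambda>i j. disjnt (cball (fst i) (snd i)) (cball (fst j) (snd j))) F"
      "\<And>i. i \<in> K \<Longrightarrow> \<exists>j. j \<in> F \<and> \<not> disjnt (cball (fst i) (snd i)) (cball (fst j) (snd j)) \<and>
          cball (fst i) (snd i) \<subseteq> ball (fst j) (5 * snd j)"
    proof (rule Vitali_covering_lemma_cballs_balls[of K snd \<rho> fst, OF radius], goal_cases)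
      case (2 C)
      show thesis
        by (rule 2(1)[OF 2(2-5)])
    qed
    have inK: "fst p \<in> orth_proj v ` A" "0 < snd p" "snd p \<le> \<rho>" "shadow_prism v (cball (fst p) (snd p)) \<subseteq> U"
      if "p \<in> F" for p
    proof -
      have "(fst p, snd p) \<in> K"
        using F(2) that by auto
      then show "fst p \<in> orth_proj v ` A" "0 < snd p" "snd p \<le> \<rho>" "shadow_prism v (cball (fst p) (snd p)) \<subseteq> U"
        unfolding K_def by blast+
    qed
    \<comment> \<open>The selected balls and their prisms, listed by an enumeration of the countable family \<open>F\<close>.\<close>
    define g where "g = (\<lambda>n. if n \<in> to_nat_on F ` F then \<omega> * snd (from_nat_into F n) ^ d else 0)"
    define P where "P = (\<lambda>n. if n \<in> to_nat_on F ` F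
        then shadow_prism v (cball (fst (from_nat_into F n)) (snd (from_nat_into F n))) else {})"
    have from_F: "from_nat_into F n \<in> F" if "n \<in> to_nat_on F ` F" for n
      using that F(1) by auto
    have gP: "emeasure lebesgue (P n) = ennreal (g n)" for n
      using emeasure_ball_prism[OF v inK(2)[OF from_F]] by (auto simp: g_def P_def \<omega>_def d_def)
    have g0: "0 \<le> g n" for n
      using \<omega> inK(2)[OF from_F] by (auto simp: g_def intro!: mult_nonneg_nonneg zero_le_power less_imp_le)
    have Pm: "P n \<in> sets lebesgue" for n
      using compact_shadow_prism[OF v compact_cball] by (auto simp: P_def borel_compact)
    have "disjoint_family P"
      unfolding disjoint_family_on_def
    proof (intro ballI impI, rule ccontr)
      fix m n assume mn: "m \<noteq> n" "P m \<inter> P n \<noteq> {}"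
      then have m: "m \<in> to_nat_on F ` F" and n: "n \<in> to_nat_on F ` F"
        by (auto simp: P_def split: if_splits)
      obtain x where "x \<in> P m" "x \<in> P n" using mn by blast
      then have "orth_proj v x \<in> cball (fst (from_nat_into F m)) (snd (from_nat_into F m))"
        "orth_proj v x \<in> cball (fst (from_nat_into F n)) (snd (from_nat_into F n))"
        using proj_in inK(1)[OF from_F[OF m]] inK(1)[OF from_F[OF n]] m n
        by (auto simp: P_def dist_norm norm_minus_commute)
      moreover have "from_nat_into F m \<noteq> from_nat_into F n"
        using m n mn(1) F(1) by auto
      ultimately show False
        using pairwiseD[OF F(3) from_F[OF m] from_F[OF n]] unfolding disjnt_def by blast
    qed
    then have "(\<Sum>n. emeasure lebesgue (P n)) = emeasure lebesgue (\<Union>n. P n)"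
      using Pm by (intro suminf_emeasure) auto
    also have "\<dots> \<le> emeasure lebesgue U"
      using U(1) inK(4)[OF from_F] by (intro emeasure_mono) (auto simp: P_def split: if_splits)
    also have "\<dots> \<le> ennreal (M + e)"
      by (rule U(3))
    finally have sum_g: "(\<Sum>n. ennreal (g n)) \<le> ennreal (M + e)"
      by (simp add: gP)
    then have "(\<Sum>n. ennreal (g n)) \<noteq> top"
      by (metis ennreal_neq_top top.extremum_uniqueI)
    then have sg: "summable g"
      using summable_suminf_not_top[OF g0] by simp
    then have sum_g': "suminf g \<le> M + e"
      using sum_g M(1) e(1) unfolding suminf_ennreal2[OF g0 sg] by (subst (asm) ennreal_le_iff) auto
    obtain N where "norm (\<Sum>i. g (i + N)) < e"
      using suminf_exist_split[OF e(1) sg] by blast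
    then have N: "(\<Sum>i. g (i + N)) < e"
      by simp
    define tail where "tail = (\<lambda>n. if n < N then 0 else g n)"
    have tail: "summable tail" "suminf tail \<le> e"
    proof -
      have "summable (\<lambda>i. tail (i + N))"
        using sg by (simp add: tail_def summable_iff_shift)
      then show st: "summable tail"
        by (simp only: summable_iff_shift)
      have "suminf tail = (\<Sum>i. tail (i + N)) + sum tail {..<N}"
        by (rule suminf_split_initial_segment[OF st])
      also have "sum tail {..<N} = 0"
        by (simp add: tail_def)
      finally show "suminf tail \<le> e"
        using N by (simp add: tail_def)
    qed
    \<comment> \<open>The first \<open>N\<close> balls keep their radius. A point outside these finitely many closed balls has a
      small ball that avoids them, which is swallowed by an enlargement of a later one.\<close>
    define R where "R = (\<lambda>n. (if n < N then 1 else 5) * snd (from_nat_into F n))"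
    define C where "C = (\<lambda>n. if n \<in> to_nat_on F ` F
        then {a \<in> A. orth_proj v a \<in> cball (fst (from_nat_into F n)) (R n)} else {})"
    have cover: "A \<subseteq> (\<Union>n. C n)"
    proof
      fix a assume a: "a \<in> A"
      let ?x = "orth_proj v a"
      let ?I = "{p \<in> F. to_nat_on F p < N}"
      have at: "p = from_nat_into F (to_nat_on F p)" if "p \<in> F" for p
        using that F(1) by simp
      have finI: "finite ?I"
      proof (rule finite_imageD)
        show "finite (to_nat_on F ` ?I)"
          by (rule finite_subset[of _ "{..<N}"]) auto
        show "inj_on (to_nat_on F) ?I"
          using inj_on_to_nat_on[OF F(1)] by (rule inj_on_subset) auto
      qed
      show "a \<in> (\<Union>n. C n)"
      proof (cases "?x \<in> (\<Union>p\<in>?I. cball (fst p) (snd p))")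
        case True
        then obtain p where p: "p \<in> F" "to_nat_on F p < N" "?x \<in> cball (fst p) (snd p)" by auto
        then have "a \<in> C (to_nat_on F p)"
          using a F(1) by (simp add: C_def R_def)
        then show ?thesis by blast
      next
        case False
        have "closed (\<Union>p\<in>?I. cball (fst p) (snd p))"
          using finI by (intro closed_UN) auto
        then obtain \<epsilon> where \<epsilon>: "0 < \<epsilon>" "ball ?x \<epsilon> \<inter> (\<Union>p\<in>?I. cball (fst p) (snd p)) = {}"
          using False by (meson ComplI disjoint_eq_subset_Compl openE open_Compl)
        obtain r0 where r0: "0 < r0" "\<And>r. 0 < r \<Longrightarrow> r \<le> r0 \<Longrightarrow> (?x, r) \<in> K"
          using small[of ?x] a by auto
        define r where "r = min r0 (\<epsilon> / 2)"
        have r: "0 < r" "r \<le> r0" "r < \<epsilon>"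
          using r0 \<epsilon> by (auto simp: r_def)
        obtain q where q: "q \<in> F" "\<not> disjnt (cball ?x r) (cball (fst q) (snd q))"
            "cball ?x r \<subseteq> ball (fst q) (5 * snd q)"
          using F(4)[OF r0(2)[OF r(1,2)]] by auto
        have "cball ?x r \<subseteq> ball ?x \<epsilon>"
          using r by auto
        then have "\<not> to_nat_on F q < N"
          using q(1,2) \<epsilon>(2) by (auto simp: disjnt_def)
        moreover have "?x \<in> cball (fst q) (5 * snd q)"
          using q(3) r(1) by (auto simp: subset_iff dest!: spec[of _ ?x])
        ultimately have "a \<in> C (to_nat_on F q)"
          using a q(1) F(1) by (simp add: C_def R_def)
        then show ?thesis by blast
      qed
    qed
    have diamC: "diameter (C n) \<le> 2 * L * R n" "0 \<le> R n" "R n \<le> 5 * \<rho>" if n: "n \<in> to_nat_on F ` F" for n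
    proof -
      note p = inK[OF from_F[OF n]]
      show R0: "0 \<le> R n" and "R n \<le> 5 * \<rho>"
        using p by (auto simp: R_def)
      show "diameter (C n) \<le> 2 * L * R n"
      proof (rule diameter_le)
        show "C n \<noteq> {} \<or> 0 \<le> 2 * L * R n" using R0 L by simp
        fix x y assume "x \<in> C n" "y \<in> C n"
        then have xy: "x \<in> A" "y \<in> A" "dist (fst (from_nat_into F n)) (orth_proj v x) \<le> R n"
          "dist (fst (from_nat_into F n)) (orth_proj v y) \<le> R n"
          using n by (auto simp: C_def)
        have "norm (x - y) \<le> L * norm (orth_proj v x - orth_proj v y)"
          using xy by (intro lip)
        also have "norm (orth_proj v x - orth_proj v y) \<le> 2 * R n"
          using xy(3,4) dist_triangle3[of "orth_proj v x" "orth_proj v y" "fst (from_nat_into F n)"]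
          by (simp add: dist_norm)
        finally show "norm (x - y) \<le> 2 * L * R n"
          using L by (simp add: mult_left_mono mult.assoc mult.left_commute)
      qed
    qed
    have weight: "hausdorff_weight d (C n) \<le> ennreal (L ^ d * g n + (5 * L) ^ d * tail n)" for n
    proof (cases "n \<in> to_nat_on F ` F \<and> C n \<noteq> {}")
      case False
      then have "C n = {}" by (auto simp: C_def)
      then show ?thesis by simp
    next
      case True
      note p = inK[OF from_F[OF conjunct1[OF True]]] and D = diamC[OF conjunct1[OF True]]
      have "0 \<le> diameter (C n)"
        using A(1) by (intro diameter_ge_0) (auto simp: C_def intro: bounded_subset)
      then have "(diameter (C n) / 2) ^ d \<le> (L * R n) ^ d"
        using D by (intro power_mono) auto
      then have "\<omega> * (diameter (C n) / 2) ^ d \<le> \<omega> * (L * R n) ^ d"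
        using \<omega> by simp
      also have "\<dots> \<le> L ^ d * g n + (5 * L) ^ d * tail n"
        using True g0[of n] L by (auto simp: g_def tail_def R_def power_mult_distrib)
      finally show ?thesis
        using True by (simp add: hausdorff_weight_def \<omega>_def ennreal_leI)
    qed
    have "hausdorff_premeasure d \<delta> A \<le> (\<Sum>n. hausdorff_weight d (C n))"
    proof (rule hausdorff_premeasure_le[OF cover])
      fix n
      show "bounded (C n)"
        using A(1) by (auto simp: C_def intro: bounded_subset)
      show "diameter (C n) \<le> \<delta>"
      proof (cases "n \<in> to_nat_on F ` F")
        case True
        have "2 * L * R n \<le> 2 * L * (5 * \<rho>)"
          using diamC[OF True] L by (intro mult_left_mono) auto
        then show ?thesis using diamC(1)[OF True] \<rho> by simp
      qed (use \<delta> in \<open>simp add: C_def\<close>)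
    qed
    also have "\<dots> \<le> (\<Sum>n. ennreal (L ^ d * g n + (5 * L) ^ d * tail n))"
      using weight by (intro suminf_le) auto
    also have "\<dots> = ennreal (\<Sum>n. L ^ d * g n + (5 * L) ^ d * tail n)"
      using sg tail(1) g0 L by (intro suminf_ennreal2 summable_add summable_mult) (auto simp: tail_def)
    also have "(\<Sum>n. L ^ d * g n + (5 * L) ^ d * tail n) = L ^ d * suminf g + (5 * L) ^ d * suminf tail"
      using sg tail(1) by (simp add: suminf_add[symmetric] suminf_mult summable_mult)
    also have "\<dots> \<le> L ^ d * (M + e) + (5 * L) ^ d * e"
      using sum_g' tail(2) L by (intro add_mono mult_left_mono) auto
    also have "\<dots> \<le> L ^ d * M + \<epsilon>"
      using e(2) by (simp add: distrib_left)
    finally show ?thesis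
      using \<epsilon> M(1) L by (simp add: ennreal_plus[symmetric] ennreal_leI del: ennreal_plus)
  qed
  then have "hausdorff_premeasure d \<delta> A \<le> ennreal (L ^ d * M)"
    by (rule_tac ennreal_le_epsilon) blast
  then show "hausdorff_premeasure (CARD('n) - 1) \<delta> A \<le> ennreal (L ^ (CARD('n) - 1)) * emeasure lebesgue (shadow_prism v A)"
    using M L by (simp add: d_def ennreal_mult)
qed

section \<open>Finite convex functions are differentiable almost everywhere\<close>

lemma convex_on_UNIV_combination:
  fixes f :: "'a::real_vector \<Rightarrow> real"
  assumes f: "convex_on UNIV f" and st: "0 \<le> s" "0 \<le> t" "0 < s + t"
  shows "(s + t) * f ((s / (s + t)) *\<^sub>R x + (t / (s + t)) *\<^sub>R y) \<le> s * f x + t * f y"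
proof -
  have one: "1 - t / (s + t) = s / (s + t)"
    using st by (simp add: field_simps)
  have "f ((s / (s + t)) *\<^sub>R x + (t / (s + t)) *\<^sub>R y) \<le> (s / (s + t)) * f x + (t / (s + t)) * f y"
    using convex_onD[OF f, of "t / (s + t)" x y] st unfolding one by simp
  also have "\<dots> = (s * f x + t * f y) / (s + t)"
    by (simp add: add_divide_distrib)
  finally show ?thesis
    using st by (simp add: pos_le_divide_eq mult.commute)
qed

lemma convex_quotient_mono:
  fixes f :: "'a::real_vector \<Rightarrow> real"
  assumes f: "convex_on UNIV f" and st: "0 < s" "s \<le> t"
  shows "(f (x + s *\<^sub>R b) - f x) / s \<le> (f (x + t *\<^sub>R b) - f x) / t"
proof -
  have "((t - s) / t) *\<^sub>R x + (s / t) *\<^sub>R (x + t *\<^sub>R b) = x + s *\<^sub>R b"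
    using st by (simp add: algebra_simps diff_divide_distrib)
  then have "t * f (x + s *\<^sub>R b) \<le> (t - s) * f x + s * f (x + t *\<^sub>R b)"
    using convex_on_UNIV_combination[OF f, of "t - s" s x "x + t *\<^sub>R b"] st by simp
  then show ?thesis
    using st by (simp add: field_simps)
qed

lemma convex_quotient_opposite:
  fixes f :: "'a::real_vector \<Rightarrow> real"
  assumes f: "convex_on UNIV f" and st: "0 < s" "0 < t"
  shows "(f x - f (x - s *\<^sub>R b)) / s \<le> (f (x + t *\<^sub>R b) - f x) / t"
proof -
  have "(t / (s + t)) *\<^sub>R (x - s *\<^sub>R b) + (s / (s + t)) *\<^sub>R (x + t *\<^sub>R b)
      = (t / (s + t) + s / (s + t)) *\<^sub>R x + ((s / (s + t)) * t - (t / (s + t)) * s) *\<^sub>R b"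
    by (simp only: scaleR_add_left scaleR_diff_left scaleR_add_right scaleR_diff_right scaleR_scaleR) simp
  also have "\<dots> = x"
    using st by (simp add: add_divide_distrib[symmetric] add.commute[of t s])
  finally have "(t + s) * f x \<le> t * f (x - s *\<^sub>R b) + s * f (x + t *\<^sub>R b)"
    using convex_on_UNIV_combination[OF f, of t s "x - s *\<^sub>R b" "x + t *\<^sub>R b"] st by (simp add: add.commute)
  then show ?thesis
    using st by (simp add: field_simps)
qed

text \<open>
  Convexity makes one-sided difference quotients monotone, so along each axis they converge and, by the
  smallness of the second differences, from both sides to the same limit. Let \<open>r\<close> be the error of the
  linear map with these partial derivatives; it is convex, and small along the axes. Any \<open>h\<close> is the
  average of the axis vectors \<open>n h\<^sub>b b\<close>, so \<open>r h\<close> is bounded above by the mean of small values, and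
  below because \<open>0 = 2 r 0 \<le> r h + r (- h)\<close>.
\<close>

lemma convex_differentiable_at:
  fixes f :: "'a::euclidean_space \<Rightarrow> real"
  assumes f: "convex_on UNIV f"
    and partial: "\<And>b \<epsilon>. b \<in> Basis \<Longrightarrow> 0 < \<epsilon> \<Longrightarrow>
      \<exists>s>0. (f (x + s *\<^sub>R b) + f (x - s *\<^sub>R b) - 2 * f x) / s < \<epsilon>"
  shows "f differentiable (at x)"
proof -
  define wb where "wb = (\<lambda>b. INF t\<in>{0<..}. (f (x + t *\<^sub>R b) - f x) / t)"
  define w where "w = (\<Sum>b\<in>Basis. wb b *\<^sub>R b)"
  define r where "r = (\<lambda>h. f (x + h) - f x - w \<bullet> h)"
  have wb_w: "w \<bullet> b = wb b" if "b \<in> Basis" for b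
    using that by (simp add: w_def inner_sum_left inner_Basis if_distrib sum.delta cong: if_cong)
  have bdd: "bdd_below ((\<lambda>t. (f (x + t *\<^sub>R b) - f x) / t) ` {0<..})" for b
    by (rule bdd_belowI2[of _ "(f x - f (x - 1 *\<^sub>R b)) / 1"]) (use convex_quotient_opposite[OF f, of 1 _ x b] in simp)
  have wb_le: "wb b \<le> (f (x + t *\<^sub>R b) - f x) / t" if "0 < t" for b t
    unfolding wb_def using that by (intro cINF_lower bdd) auto
  have wb_ge: "(f x - f (x - s *\<^sub>R b)) / s \<le> wb b" if "0 < s" for b s
    unfolding wb_def using that convex_quotient_opposite[OF f that] by (intro cINF_greatest) auto
  have r0: "r 0 = 0"
    by (simp add: r_def)
  have small: "\<exists>\<delta>>0. \<forall>t. \<bar>t\<bar> \<le> \<delta> \<longrightarrow> r (t *\<^sub>R b) \<le> \<epsilon> * \<bar>t\<bar>" if b: "b \<in> Basis" and \<epsilon>: "0 < \<epsilon>" for b \<epsilon>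
  proof -
    obtain s where s: "0 < s" "(f (x + s *\<^sub>R b) + f (x - s *\<^sub>R b) - 2 * f x) / s < \<epsilon>"
      using partial[OF b \<epsilon>] by blast
    have q: "(f (x + s *\<^sub>R b) - f x) / s - (f x - f (x - s *\<^sub>R b)) / s < \<epsilon>"
      using s(2) by (simp add: diff_divide_distrib add_divide_distrib)
    have up: "(f (x + s *\<^sub>R b) - f x) / s \<le> wb b + \<epsilon>" and lo: "wb b - \<epsilon> \<le> (f x - f (x - s *\<^sub>R b)) / s"
      using q wb_ge[OF s(1), of b] wb_le[OF s(1), of b] by linarith+
    have "r (t *\<^sub>R b) \<le> \<epsilon> * \<bar>t\<bar>" if t: "\<bar>t\<bar> \<le> s" for t
    proof -
      consider "t = 0" | "0 < t" | "t < 0" by linarith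
      then show ?thesis
      proof cases
        case 1
        then show ?thesis by (simp add: r0)
      next
        case 2
        then have "(f (x + t *\<^sub>R b) - f x) / t \<le> wb b + \<epsilon>"
          using convex_quotient_mono[OF f, of t s x b] t up by simp
        then have "f (x + t *\<^sub>R b) - f x \<le> (wb b + \<epsilon>) * t"
          using 2 by (simp add: divide_le_eq)
        then show ?thesis
          using 2 by (simp add: r_def wb_w[OF b] algebra_simps)
      next
        case 3
        then have "(f (x + (- t) *\<^sub>R (- b)) - f x) / (- t) \<le> (f (x + s *\<^sub>R (- b)) - f x) / s"
          using convex_quotient_mono[OF f, of "- t" s x "- b"] t by simp
        then have "(f (x + t *\<^sub>R b) - f x) / (- t) \<le> - ((f x - f (x - s *\<^sub>R b)) / s)"
          by (simp add: minus_divide_left)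
        then have "(f (x + t *\<^sub>R b) - f x) / (- t) \<le> \<epsilon> - wb b"
          using lo by linarith
        then have "f (x + t *\<^sub>R b) - f x \<le> (\<epsilon> - wb b) * (- t)"
          using 3 by (simp only: divide_le_eq)
        then show ?thesis
          using 3 by (simp add: r_def wb_w[OF b] algebra_simps)
      qed
    qed
    then show ?thesis using s(1) by blast
  qed
  have convex_r: "convex_on UNIV r"
  proof (rule convex_onI)
    fix t :: real and y z :: 'a assume t: "0 < t" "t < 1"
    have "x + ((1 - t) *\<^sub>R y + t *\<^sub>R z) = (1 - t) *\<^sub>R (x + y) + t *\<^sub>R (x + z)"
      by (simp add: algebra_simps)
    then have "f (x + ((1 - t) *\<^sub>R y + t *\<^sub>R z)) \<le> (1 - t) * f (x + y) + t * f (x + z)"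
      using convex_onD[OF f, of t "x + y" "x + z"] t by simp
    then show "r ((1 - t) *\<^sub>R y + t *\<^sub>R z) \<le> (1 - t) * r y + t * r z"
      by (simp add: r_def inner_simps algebra_simps)
  qed simp
  let ?n = "real DIM('a)"
  have upper: "\<exists>d>0. \<forall>h. norm h < d \<longrightarrow> r h \<le> \<epsilon> * norm h" if \<epsilon>: "0 < \<epsilon>" for \<epsilon>
  proof -
    have "\<forall>b\<in>Basis. \<exists>\<delta>>0. \<forall>t. \<bar>t\<bar> \<le> \<delta> \<longrightarrow> r (t *\<^sub>R b) \<le> \<epsilon> / ?n * \<bar>t\<bar>"
    proof
      fix b :: 'a assume "b \<in> Basis"
      then show "\<exists>\<delta>>0. \<forall>t. \<bar>t\<bar> \<le> \<delta> \<longrightarrow> r (t *\<^sub>R b) \<le> \<epsilon> / ?n * \<bar>t\<bar>"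
        using small[of b "\<epsilon> / ?n"] \<epsilon> by (simp add: DIM_positive)
    qed
    then obtain \<delta> where \<delta>: "\<And>b. b \<in> Basis \<Longrightarrow> 0 < \<delta> b \<and> (\<forall>t. \<bar>t\<bar> \<le> \<delta> b \<longrightarrow> r (t *\<^sub>R b) \<le> \<epsilon> / ?n * \<bar>t\<bar>)"
      by (metis (no_types))
    define d where "d = Min (\<delta> ` Basis) / ?n"
    have "0 < d"
      unfolding d_def using \<delta> by (intro divide_pos_pos) (auto simp: DIM_positive)
    moreover have "r h \<le> \<epsilon> * norm h" if h: "norm h < d" for h
    proof -
      have comp: "\<bar>?n * (h \<bullet> b)\<bar> \<le> ?n * norm h" if "b \<in> Basis" for b
        using Basis_le_norm[OF that, of h] by (simp add: abs_mult)
      have in_\<delta>: "\<bar>?n * (h \<bullet> b)\<bar> \<le> \<delta> b" if "b \<in> Basis" for b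
      proof -
        have "norm h * ?n < Min (\<delta> ` Basis)"
          using h unfolding d_def by (subst (asm) pos_less_divide_eq) (simp_all add: DIM_positive)
        then have "?n * norm h \<le> Min (\<delta> ` Basis)"
          by (metis less_imp_le mult.commute)
        also have "\<dots> \<le> \<delta> b"
          using that by (intro Min_le) auto
        finally show ?thesis using comp[OF that] by linarith
      qed
      have "h = (\<Sum>b\<in>Basis. (1 / ?n) *\<^sub>R ((?n * (h \<bullet> b)) *\<^sub>R b))"
        by (simp add: euclidean_representation DIM_positive)
      then have "r h \<le> (\<Sum>b\<in>Basis. (1 / ?n) * r ((?n * (h \<bullet> b)) *\<^sub>R b))"
        using convex_on_sum[OF finite_Basis nonempty_Basis convex_r, of "\<lambda>_. 1 / ?n" "\<lambda>b. (?n * (h \<bullet> b)) *\<^sub>R b"]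
        by (simp add: DIM_positive)
      also have "\<dots> \<le> (\<Sum>b\<in>(Basis :: 'a set). (1 / ?n) * (\<epsilon> * norm h))"
      proof (intro sum_mono mult_left_mono)
        fix b :: 'a assume b: "b \<in> Basis"
        have "r ((?n * (h \<bullet> b)) *\<^sub>R b) \<le> \<epsilon> / ?n * \<bar>?n * (h \<bullet> b)\<bar>"
          using \<delta>[OF b] in_\<delta>[OF b] by blast
        also have "\<dots> \<le> \<epsilon> / ?n * (?n * norm h)"
          using \<epsilon> comp[OF b] by (intro mult_left_mono) auto
        also have "\<dots> = \<epsilon> * norm h"
          by (simp add: DIM_positive)
        finally show "r ((?n * (h \<bullet> b)) *\<^sub>R b) \<le> \<epsilon> * norm h" .
      qed auto
      also have "\<dots> = \<epsilon> * norm h"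
        by (simp add: DIM_positive)
      finally show ?thesis .
    qed
    ultimately show ?thesis by blast
  qed
  have "(f has_derivative (\<lambda>h. w \<bullet> h)) (at x)"
    unfolding has_derivative_at_alt
  proof (intro conjI allI impI bounded_linear_inner_right)
    fix \<epsilon> :: real assume \<epsilon>: "0 < \<epsilon>"
    obtain d where d: "0 < d" "\<And>h. norm h < d \<Longrightarrow> r h \<le> \<epsilon> * norm h"
      using upper[OF \<epsilon>] by blast
    have "norm (f y - f x - w \<bullet> (y - x)) \<le> \<epsilon> * norm (y - x)" if y: "norm (y - x) < d" for y
    proof -
      have "(1 / 2) *\<^sub>R (y - x) + (1 / 2) *\<^sub>R (- (y - x)) = 0"
        by (metis add.right_inverse scaleR_minus_right)
      then have "2 * r 0 \<le> r (y - x) + r (- (y - x))"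
        using convex_on_UNIV_combination[OF convex_r, of 1 1 "y - x" "- (y - x)"] by simp
      then have "- r (- (y - x)) \<le> r (y - x)"
        using r0 by simp
      moreover have "r (- (y - x)) \<le> \<epsilon> * norm (y - x)" "r (y - x) \<le> \<epsilon> * norm (y - x)"
        using d(2)[of "- (y - x)"] d(2)[of "y - x"] y unfolding norm_minus_cancel by auto
      ultimately have "\<bar>r (y - x)\<bar> \<le> \<epsilon> * norm (y - x)"
        by linarith
      then show ?thesis
        by (simp add: r_def)
    qed
    then show "\<exists>d>0. \<forall>y. norm (y - x) < d \<longrightarrow> norm (f y - f x - w \<bullet> (y - x)) \<le> \<epsilon> * norm (y - x)"
      using d(1) by blast
  qed
  then show ?thesis
    by (rule differentiableI)
qed

lemma lborel_integral_translate:
  fixes G :: "'a::euclidean_space \<Rightarrow> real"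
  assumes "G \<in> borel_measurable borel"
  shows "(\<integral>x. G (c + x) \<partial>lborel) = (\<integral>x. G x \<partial>lborel)"
proof -
  have "(\<integral>x. G x \<partial>lborel) = (\<integral>x. G x \<partial>distr lborel borel ((+) c))"
    by (simp add: lborel_distr_plus)
  also have "\<dots> = (\<integral>x. G (c + x) \<partial>lborel)"
    using assms by (intro integral_distr) auto
  finally show ?thesis by simp
qed

text \<open>
  The second difference is \<open>F x - F (x - \<delta> b)\<close> for the first difference quotient \<open>F\<close>, which is bounded
  by \<open>C\<close>. After a translation the two integrals cancel except on the symmetric difference of two balls
  with centres \<open>\<delta>\<close> apart, which lies in a spherical shell.
\<close>

lemma second_difference_small:
  fixes f :: "'a::euclidean_space \<Rightarrow> real"
  assumes lip: "\<And>x y. \<bar>f x - f y\<bar> \<le> C * norm (x - y)" and b: "norm b = 1"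
    and \<delta>: "0 < \<delta>" "\<delta> \<le> M"
  shows "(\<integral>x. indicator (cball 0 M) x * ((f (x + \<delta> *\<^sub>R b) + f (x - \<delta> *\<^sub>R b) - 2 * f x) / \<delta>) \<partial>lborel)
    \<le> C * (unit_ball_vol (real DIM('a)) * ((M + \<delta>) ^ DIM('a) - (M - \<delta>) ^ DIM('a)))"
proof -
  have cont: "continuous_on UNIV f"
  proof (rule continuous_on_iff[THEN iffD2], intro ballI allI impI)
    fix x e assume e: "0 < (e::real)"
    have "dist (f y) (f x) < e" if "dist y x < e / (\<bar>C\<bar> + 1)" for y
    proof -
      have "\<bar>f y - f x\<bar> \<le> C * norm (y - x)" by (rule lip)
      also have "\<dots> \<le> (\<bar>C\<bar> + 1) * norm (y - x)"
        by (intro mult_right_mono) auto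
      also have "\<dots> < e"
        using that by (simp add: dist_norm field_simps)
      finally show ?thesis by (simp add: dist_real_def)
    qed
    then show "\<exists>d>0. \<forall>y\<in>UNIV. dist y x < d \<longrightarrow> dist (f y) (f x) < e"
      using e by (intro exI[of _ "e / (\<bar>C\<bar> + 1)"]) auto
  qed
  then have [measurable]: "f \<in> borel_measurable borel"
    by (rule borel_measurable_continuous_onI)
  define F where "F = (\<lambda>x. (f (x + \<delta> *\<^sub>R b) - f x) / \<delta>)"
  let ?B = "cball (0::'a) M"
  have Fm: "F \<in> borel_measurable borel"
    unfolding F_def by measurable
  then have Fm' [measurable]: "(\<lambda>x. F (c + x)) \<in> borel_measurable borel" for c
    by (rule measurable_compose[rotated]) simp
  have F_bound: "\<bar>F x\<bar> \<le> C" for x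
    using lip[of "x + \<delta> *\<^sub>R b" x] b \<delta> by (simp add: F_def divide_le_eq)
  have C: "0 \<le> C"
    using F_bound[of 0] by linarith
  have int: "integrable lborel (\<lambda>x. indicator S x * F (c + x))" if "compact S" for S c
  proof -
    have "integrable lborel (\<lambda>x. indicator S x *\<^sub>R F (c + x))"
      using that F_bound emeasure_bounded_finite[OF compact_imp_bounded[OF that]]
      by (intro integrableI_bounded_set_indicator[where B = C]) (auto simp: borel_compact)
    then show ?thesis by simp
  qed
  have int_shift: "(\<integral>x. indicator ?B x * F (- (\<delta> *\<^sub>R b) + x) \<partial>lborel) = (\<integral>x. indicator ?B (\<delta> *\<^sub>R b + x) * F x \<partial>lborel)"
  proof -
    have "(\<lambda>x. indicator ?B x * F (- (\<delta> *\<^sub>R b) + x)) \<in> borel_measurable borel"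
      by (intro borel_measurable_times borel_measurable_indicator Fm') simp
    from lborel_integral_translate[OF this, of "\<delta> *\<^sub>R b"] show ?thesis
      by simp
  qed
  have dist_shift: "dist (- (\<delta> *\<^sub>R b)) x = norm (\<delta> *\<^sub>R b + x)" for x
  proof -
    have "- (\<delta> *\<^sub>R b) - x = - (\<delta> *\<^sub>R b + x)"
      by simp
    then show ?thesis
      by (simp only: dist_norm norm_minus_cancel)
  qed
  have shifted: "indicator ?B (\<delta> *\<^sub>R b + x) = (indicator (cball (- (\<delta> *\<^sub>R b)) M) x :: real)" for x
    by (simp add: indicator_def dist_shift)
  have "(\<integral>x. indicator ?B x * ((f (x + \<delta> *\<^sub>R b) + f (x - \<delta> *\<^sub>R b) - 2 * f x) / \<delta>) \<partial>lborel)
      = (\<integral>x. indicator ?B x * F (0 + x) - indicator ?B x * F (- (\<delta> *\<^sub>R b) + x) \<partial>lborel)"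
    by (intro Bochner_Integration.integral_cong) (auto simp: F_def indicator_def diff_divide_distrib add_divide_distrib)
  also have "\<dots> = (\<integral>x. indicator ?B x * F (0 + x) \<partial>lborel) - (\<integral>x. indicator (cball (- (\<delta> *\<^sub>R b)) M) x * F (0 + x) \<partial>lborel)"
    by (subst Bochner_Integration.integral_diff[OF int int]) (simp_all only: compact_cball int_shift shifted add_0)
  also have "\<dots> = (\<integral>x. indicator ?B x * F (0 + x) - indicator (cball (- (\<delta> *\<^sub>R b)) M) x * F (0 + x) \<partial>lborel)"
    by (intro Bochner_Integration.integral_diff[symmetric] int compact_cball)
  also have "\<dots> \<le> (\<integral>x. indicator (cball (0::'a) (M + \<delta>) - ball 0 (M - \<delta>)) x * C \<partial>lborel)"
  proof (rule Bochner_Integration.integral_mono)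
    show "integrable lborel (\<lambda>x. indicator ?B x * F (0 + x) - indicator (cball (- (\<delta> *\<^sub>R b)) M) x * F (0 + x))"
      by (intro Bochner_Integration.integrable_diff int compact_cball)
    show "integrable lborel (\<lambda>x. indicator (cball (0::'a) (M + \<delta>) - ball 0 (M - \<delta>)) x * C :: real)"
      by (intro integrable_mult_left integrable_real_indicator)
        (simp_all add: emeasure_bounded_finite bounded_diff flip: infinity_ennreal_def)
    fix x :: 'a
    have shell: "norm x \<le> M + \<delta> \<and> \<not> norm x < M - \<delta>" if "(norm x \<le> M) \<noteq> (norm (\<delta> *\<^sub>R b + x) \<le> M)"
      using that norm_triangle_ineq[of "\<delta> *\<^sub>R b + x" "- (\<delta> *\<^sub>R b)"] norm_triangle_ineq[of "\<delta> *\<^sub>R b" x] b \<delta>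
      by auto
    show "indicator ?B x * F (0 + x) - indicator (cball (- (\<delta> *\<^sub>R b)) M) x * F (0 + x) \<le> indicator (cball 0 (M + \<delta>) - ball 0 (M - \<delta>)) x * C"
      using F_bound[of x] C shell by (auto simp: indicator_def abs_le_iff dist_shift)
  qed
  also have "\<dots> = C * measure lborel (cball 0 (M + \<delta>) - ball (0::'a) (M - \<delta>))"
    by simp
  also have "measure lborel (cball 0 (M + \<delta>) - ball (0::'a) (M - \<delta>)) = measure lborel (cball (0::'a) (M + \<delta>)) - measure lborel (ball (0::'a) (M - \<delta>))"
    using \<delta> emeasure_bounded_finite[OF bounded_cball, of "0::'a" "M + \<delta>"] by (intro measure_Diff) auto
  also have "\<dots> = unit_ball_vol (real DIM('a)) * ((M + \<delta>) ^ DIM('a) - (M - \<delta>) ^ DIM('a))"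
    using \<delta> by (simp add: content_cball content_ball right_diff_distrib)
  finally show ?thesis .
qed

text \<open>
  At a point of nondifferentiability the nonnegative second difference quotients of some axis stay above
  a positive constant for all steps (\<open>convex_differentiable_at\<close>). Their integrals over balls tend to
  \<open>0\<close> with the step (\<open>second_difference_small\<close>), so the set of such points is null.
\<close>

proposition convex_lipschitz_differentiable_AE:
  fixes f :: "'a::euclidean_space \<Rightarrow> real"
  assumes f: "convex_on UNIV f" and lip: "\<And>x y. \<bar>f x - f y\<bar> \<le> C * norm (x - y)"
  shows "negligible {x. \<not> f differentiable (at x)}"
proof -
  define \<delta> where "\<delta> = (\<lambda>m. 1 / real (Suc m))"
  have \<delta>: "0 < \<delta> m" "\<delta> m \<le> 1" for m
    by (auto simp: \<delta>_def)
  have \<delta>_lim: "\<delta> \<longlonglongrightarrow> 0"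
    unfolding \<delta>_def using LIMSEQ_Suc[OF lim_1_over_n] by simp
  define q where "q = (\<lambda>b m x. (f (x + \<delta> m *\<^sub>R b) + f (x - \<delta> m *\<^sub>R b) - 2 * f x) / \<delta> m)"
  have cont: "continuous_on UNIV f"
    using f by (intro convex_on_continuous) auto
  then have fm [measurable]: "f \<in> borel_measurable borel"
    by (rule borel_measurable_continuous_onI)
  have qm [measurable]: "q b m \<in> borel_measurable borel" for b m
    unfolding q_def by measurable
  have q0: "0 \<le> q b m x" for b m x
  proof -
    have "q b m x = (f (x + \<delta> m *\<^sub>R b) - f x) / \<delta> m - (f x - f (x - \<delta> m *\<^sub>R b)) / \<delta> m"
      by (simp add: q_def diff_divide_distrib add_divide_distrib)
    then show ?thesis
      using convex_quotient_opposite[OF f \<delta>(1) \<delta>(1), of x m b m] by simp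
  qed
  define N where "N = (\<lambda>b (i::nat) (j::nat). {x \<in> cball (0::'a) (real i + 1). \<forall>m. 1 / real (Suc j) \<le> q b m x})"
  have Nm: "N b i j \<in> sets borel" for b i j
    unfolding N_def by measurable
  have "emeasure lborel (N b i j) = 0" if b: "b \<in> Basis" for b i j
  proof -
    let ?M = "real i + 1" and ?B = "cball (0::'a) (real i + 1)" and ?\<epsilon> = "1 / real (Suc j)"
    have fin: "N b i j \<in> fmeasurable lborel"
      by (rule fmeasurableI2[of ?B]) (auto simp: N_def Nm[unfolded N_def] fmeasurable_compact)
    have bound: "?\<epsilon> * measure lborel (N b i j) \<le>
        C * (unit_ball_vol (real DIM('a)) * ((?M + \<delta> m) ^ DIM('a) - (?M - \<delta> m) ^ DIM('a)))" for m
    proof -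
      have "?\<epsilon> * measure lborel (N b i j) = (\<integral>x. indicator (N b i j) x * ?\<epsilon> \<partial>lborel)"
        by simp
      also have "\<dots> \<le> (\<integral>x. indicator ?B x * q b m x \<partial>lborel)"
      proof (rule Bochner_Integration.integral_mono)
        show "integrable lborel (\<lambda>x. indicator (N b i j) x * ?\<epsilon>)"
          using fin by (intro integrable_mult_left integrable_real_indicator) (auto simp: fmeasurable_def)
        have "continuous_on ?B (q b m)"
          unfolding q_def using \<delta>(1)[of m]
          by (intro continuous_intros continuous_on_compose2[OF cont]) auto
        then show "integrable lborel (\<lambda>x. indicator ?B x * q b m x)"
          using borel_integrable_compact[OF compact_cball, of 0 "real i + 1" "q b m"] by (simp add: indicator_def if_distrib cong: if_cong)
        show "indicator (N b i j) x * ?\<epsilon> \<le> indicator ?B x * q b m x" for x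
          using q0[of b m x] by (auto simp: indicator_def N_def)
      qed
      also have "\<dots> \<le> C * (unit_ball_vol (real DIM('a)) * ((?M + \<delta> m) ^ DIM('a) - (?M - \<delta> m) ^ DIM('a)))"
        unfolding q_def using \<delta>[of m] b by (intro second_difference_small lip) auto
      finally show ?thesis .
    qed
    have "(\<lambda>m. C * (unit_ball_vol (real DIM('a)) * ((?M + \<delta> m) ^ DIM('a) - (?M - \<delta> m) ^ DIM('a))))
      \<longlonglongrightarrow> C * (unit_ball_vol (real DIM('a)) * ((?M + 0) ^ DIM('a) - (?M - 0) ^ DIM('a)))"
      by (intro tendsto_intros \<delta>_lim)
    then have "?\<epsilon> * measure lborel (N b i j) \<le> 0"
      using LIMSEQ_le_const[OF _ exI[of _ 0]] bound by fastforce
    then have "measure lborel (N b i j) = 0"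
      using measure_nonneg[of lborel "N b i j"] by (simp add: mult_le_0_iff divide_le_0_iff)
    then show ?thesis
      using fin by (simp add: emeasure_eq_measure2)
  qed
  then have "N b i j \<in> null_sets lborel" if "b \<in> Basis" for b i j
    using that Nm by (simp add: null_sets_def)
  then have "(\<Union>b\<in>Basis. \<Union>i. \<Union>j. N b i j) \<in> null_sets lborel"
    by (intro null_sets_UN' null_sets_UN) (auto simp: countable_finite)
  then have "negligible (\<Union>b\<in>Basis. \<Union>i. \<Union>j. N b i j)"
    by (simp add: negligible_iff_null_sets null_sets_completionI)
  moreover have "{x. \<not> f differentiable (at x)} \<subseteq> (\<Union>b\<in>Basis. \<Union>i. \<Union>j. N b i j)"
  proof
    fix x assume "x \<in> {x. \<not> f differentiable (at x)}"
    then obtain b \<epsilon> where b: "b \<in> Basis" "0 < \<epsilon>"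
      "\<And>s. 0 < s \<Longrightarrow> \<epsilon> \<le> (f (x + s *\<^sub>R b) + f (x - s *\<^sub>R b) - 2 * f x) / s"
      using convex_differentiable_at[OF f, of x] by (metis mem_Collect_eq not_less)
    obtain j where j: "1 / real (Suc j) < \<epsilon>"
      using b(2) nat_approx_posE by blast
    obtain i :: nat where i: "norm x \<le> real i"
      using real_arch_simple by blast
    have "1 / real (Suc j) \<le> q b m x" for m
      using b(3)[OF \<delta>(1)[of m]] j by (simp add: q_def)
    then have "x \<in> N b i j"
      using i by (simp add: N_def)
    then show "x \<in> (\<Union>b\<in>Basis. \<Union>i. \<Union>j. N b i j)"
      using b(1) by blast
  qed
  ultimately show ?thesis
    by (rule negligible_subset)
qed

section \<open>Gauge and support function of a convex body\<close>

locale body_around_origin =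
  fixes K :: "'a::euclidean_space set"
  assumes body: "convex_body K" and origin: "0 \<in> interior K"
begin

abbreviation gauge :: "'a \<Rightarrow> real" where "gauge \<equiv> minkowski_functional K"
abbreviation supp :: "'a \<Rightarrow> real" where "supp \<equiv> support_function K"

lemma compact_K: "compact K" and convex_K: "convex K"
  using body by (auto simp: convex_body_def)

lemma zero_in_K: "0 \<in> K"
  using origin interior_subset by blast

definition inradius :: real where "inradius = (SOME r. 0 < r \<and> cball 0 r \<subseteq> K)"
definition outradius :: real where "outradius = (SOME R. 0 < R \<and> K \<subseteq> cball 0 R)"

lemma inradius: "0 < inradius" "cball 0 inradius \<subseteq> K"
proof -
  have "\<exists>r. 0 < r \<and> cball 0 r \<subseteq> K"
    using origin by (metis mem_interior_cball)
  then have "0 < inradius \<and> cball 0 inradius \<subseteq> K"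
    unfolding inradius_def by (rule someI_ex)
  then show "0 < inradius" "cball 0 inradius \<subseteq> K" by auto
qed

lemma outradius: "0 < outradius" "\<And>x. x \<in> K \<Longrightarrow> norm x \<le> outradius"
proof -
  obtain a where "0 < a" "\<And>x. x \<in> K \<Longrightarrow> norm x \<le> a"
    using compact_imp_bounded[OF compact_K] by (metis bounded_pos)
  then have "\<exists>R. 0 < R \<and> K \<subseteq> cball 0 R"
    by (intro exI[of _ a]) auto
  then have "0 < outradius \<and> K \<subseteq> cball 0 outradius"
    unfolding outradius_def by (rule someI_ex)
  then show "0 < outradius" "\<And>x. x \<in> K \<Longrightarrow> norm x \<le> outradius"
    by auto
qed

lemma shrink_in_K: "x \<in> K \<Longrightarrow> 0 \<le> t \<Longrightarrow> t \<le> 1 \<Longrightarrow> t *\<^sub>R x \<in> K"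
  using convexD_alt[OF convex_K zero_in_K, of x t] by simp

lemma in_scaled_K: "0 < t \<Longrightarrow> x \<in> (\<lambda>y. t *\<^sub>R y) ` K \<longleftrightarrow> (1 / t) *\<^sub>R x \<in> K"
  by (auto intro!: image_eqI[of _ _ "(1 / t) *\<^sub>R x"])

lemma scalings_nonempty: "{t. 0 \<le> t \<and> x \<in> (\<lambda>y. t *\<^sub>R y) ` K} \<noteq> {}"
proof (cases "x = 0")
  case True
  then have "0 \<in> {t. 0 \<le> t \<and> x \<in> (\<lambda>y. t *\<^sub>R y) ` K}" using zero_in_K by auto
  then show ?thesis by blast
next
  case False
  have "(inradius / norm x) *\<^sub>R x \<in> K"
    using inradius False by (intro subsetD[OF inradius(2)]) (simp add: abs_of_pos)
  then have "norm x / inradius \<in> {t. 0 \<le> t \<and> x \<in> (\<lambda>y. t *\<^sub>R y) ` K}"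
    using False inradius(1) in_scaled_K[of "norm x / inradius" x] by simp
  then show ?thesis by blast
qed

text \<open>
  By compactness the infimum is attained. Everything about the gauge is read off from this
  characterization of its sublevel sets.
\<close>

lemma gauge_le_iff:
  assumes t: "0 < t"
  shows "gauge x \<le> t \<longleftrightarrow> (1 / t) *\<^sub>R x \<in> K"
proof -
  let ?S = "{t. 0 \<le> t \<and> x \<in> (\<lambda>y. t *\<^sub>R y) ` K}"
  have bdd: "bdd_below ?S"
    by (rule bdd_belowI[of _ 0]) auto
  note ne = scalings_nonempty[of x]
  show ?thesis
  proof
    assume "(1 / t) *\<^sub>R x \<in> K"
    then have "t \<in> ?S"
      using in_scaled_K[OF t, of x] t by simp
    then show "gauge x \<le> t"
      unfolding minkowski_functional_def by (intro cInf_lower bdd)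
  next
    assume le: "gauge x \<le> t"
    have above: "(1 / s) *\<^sub>R x \<in> K" if s: "t < s" for s
    proof -
      have "Inf ?S < s"
        using le s unfolding minkowski_functional_def by linarith
      then obtain r where r: "r \<in> ?S" "r < s"
        using cInf_lessD[OF ne] by blast
      then obtain y where y: "y \<in> K" "x = r *\<^sub>R y" by auto
      then have "(1 / s) *\<^sub>R x = (r / s) *\<^sub>R y" by simp
      then show ?thesis
        using shrink_in_K[OF y(1), of "r / s"] r s t by simp
    qed
    have "(\<lambda>m. 1 / (t + 1 / real (Suc m))) \<longlonglongrightarrow> 1 / (t + 0)"
      using t by (intro tendsto_intros LIMSEQ_Suc[OF lim_1_over_n, unfolded o_def]) auto
    from tendsto_scaleR[OF this tendsto_const[of x]]
    have lim: "(\<lambda>m. (1 / (t + 1 / real (Suc m))) *\<^sub>R x) \<longlonglongrightarrow> (1 / t) *\<^sub>R x"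
      unfolding add_0_right .
    have mem: "(1 / (t + 1 / real (Suc m))) *\<^sub>R x \<in> K" for m
      by (rule above) simp
    show "(1 / t) *\<^sub>R x \<in> K"
      by (rule closed_sequentially[OF compact_imp_closed[OF compact_K] mem lim])
  qed
qed

lemma gauge_nonneg: "0 \<le> gauge x"
  unfolding minkowski_functional_def by (rule cInf_greatest[OF scalings_nonempty]) auto

lemma in_K_iff: "x \<in> K \<longleftrightarrow> gauge x \<le> 1"
  using gauge_le_iff[of 1 x] by simp

lemma eq_by_positive_bounds:
  fixes a b :: real
  assumes "0 \<le> a" "0 \<le> b" "\<And>t. 0 < t \<Longrightarrow> a \<le> t \<longleftrightarrow> b \<le> t"
  shows "a = b"
proof (rule antisym)
  show "a \<le> b"
  proof (rule field_le_epsilon)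
    fix e :: real assume "0 < e"
    then show "a \<le> b + e"
      using assms(2) assms(3)[of "b + e"] by simp
  qed
  show "b \<le> a"
  proof (rule field_le_epsilon)
    fix e :: real assume "0 < e"
    then show "b \<le> a + e"
      using assms(1) assms(3)[of "a + e"] by simp
  qed
qed

lemma gauge_scale:
  assumes c: "0 \<le> c"
  shows "gauge (c *\<^sub>R x) = c * gauge x"
proof (cases "c = 0")
  case True
  have "gauge 0 \<le> t" if "0 < t" for t
    using gauge_le_iff[OF that, of 0] zero_in_K by simp
  then have "gauge 0 \<le> 0"
    by (rule_tac field_le_epsilon) auto
  then show ?thesis
    using True gauge_nonneg[of 0] by simp
next
  case False
  then have c: "0 < c" using assms by simp
  show ?thesis
  proof (rule eq_by_positive_bounds)
    fix t :: real assume t: "0 < t"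
    have "gauge (c *\<^sub>R x) \<le> t \<longleftrightarrow> (1 / (t / c)) *\<^sub>R x \<in> K"
      using gauge_le_iff[OF t, of "c *\<^sub>R x"] by simp
    also have "\<dots> \<longleftrightarrow> gauge x \<le> t / c"
      using t c by (intro gauge_le_iff[symmetric]) auto
    also have "\<dots> \<longleftrightarrow> c * gauge x \<le> t"
      using c by (simp add: field_simps)
    finally show "gauge (c *\<^sub>R x) \<le> t \<longleftrightarrow> c * gauge x \<le> t" .
  qed (use c gauge_nonneg in auto)
qed

lemma gauge_triangle: "gauge (x + y) \<le> gauge x + gauge y"
proof (rule field_le_epsilon)
  fix e :: real assume e: "0 < e"
  define s where "s = gauge x + e / 2"
  define t where "t = gauge y + e / 2"
  have st: "0 < s" "0 < t"
    using e gauge_nonneg[of x] gauge_nonneg[of y] by (simp_all add: s_def t_def)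
  have in_K: "(1 / s) *\<^sub>R x \<in> K" "(1 / t) *\<^sub>R y \<in> K"
    using gauge_le_iff[OF st(1), of x] gauge_le_iff[OF st(2), of y] e by (simp_all add: s_def t_def)
  have "(s / (s + t)) *\<^sub>R ((1 / s) *\<^sub>R x) + (t / (s + t)) *\<^sub>R ((1 / t) *\<^sub>R y) \<in> K"
    using st by (intro convexD[OF convex_K in_K]) (auto simp: add_divide_distrib[symmetric])
  then have "(1 / (s + t)) *\<^sub>R (x + y) \<in> K"
    using st by (simp add: scaleR_add_right)
  then have "gauge (x + y) \<le> s + t"
    using gauge_le_iff[of "s + t"] st by simp
  then show "gauge (x + y) \<le> gauge x + gauge y + e"
    by (simp add: s_def t_def)
qed

lemma gauge_le_norm: "gauge x \<le> norm x / inradius"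
proof (cases "x = 0")
  case True
  then show ?thesis using gauge_scale[of 0 0] by simp
next
  case False
  have "(1 / (norm x / inradius)) *\<^sub>R x \<in> K"
    using inradius False by (intro subsetD[OF inradius(2)]) (simp add: abs_of_pos)
  then show ?thesis
    using gauge_le_iff[of "norm x / inradius"] inradius(1) False by simp
qed

lemma norm_le_gauge: "norm x \<le> outradius * gauge x"
proof -
  have "norm x \<le> outradius * (gauge x + e)" if e: "0 < e" for e
  proof -
    have "0 < gauge x + e"
      using e gauge_nonneg[of x] by simp
    moreover from this have "(1 / (gauge x + e)) *\<^sub>R x \<in> K"
      using gauge_le_iff[of "gauge x + e" x] e by simp
    ultimately show ?thesis
      using outradius(2)[of "(1 / (gauge x + e)) *\<^sub>R x"] by (simp add: field_simps)
  qed
  note * = this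
  show ?thesis
  proof (rule field_le_epsilon)
    fix e :: real assume "0 < e"
    then show "norm x \<le> outradius * gauge x + e"
      using *[of "e / outradius"] outradius(1) by (simp add: distrib_left)
  qed
qed

lemma gauge_zero_iff: "gauge x = 0 \<longleftrightarrow> x = 0"
  using norm_le_gauge[of x] gauge_scale[of 0 x] by auto

lemma gauge_pos: "x \<noteq> 0 \<Longrightarrow> 0 < gauge x"
  using gauge_zero_iff[of x] gauge_nonneg[of x] by linarith

lemma gauge_lipschitz: "\<bar>gauge x - gauge y\<bar> \<le> (1 / inradius) * norm (x - y)"
proof -
  have "gauge x - gauge y \<le> norm (x - y) / inradius" for x y
    using gauge_triangle[of y "x - y"] gauge_le_norm[of "x - y"] by simp
  from this[of x y] this[of y x] show ?thesis
    by (simp add: abs_le_iff norm_minus_commute)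
qed

lemma gauge_convex: "convex_on UNIV gauge"
proof (rule convex_onI)
  fix t :: real and x y assume t: "0 < t" "t < 1"
  show "gauge ((1 - t) *\<^sub>R x + t *\<^sub>R y) \<le> (1 - t) * gauge x + t * gauge y"
    using gauge_triangle[of "(1 - t) *\<^sub>R x" "t *\<^sub>R y"] t by (simp add: gauge_scale)
qed simp

lemma gauge_continuous: "continuous_on S gauge"
  using gauge_convex convex_on_continuous[of UNIV gauge] continuous_on_subset by auto

lemma gauge_measurable [measurable]: "gauge \<in> borel_measurable borel"
  by (intro borel_measurable_continuous_onI gauge_continuous)

lemma frontier_K: "frontier K = {x. gauge x = 1}"
proof -
  have "interior K = {x. gauge x < 1}"
  proof (rule antisym)
    show "interior K \<subseteq> {x. gauge x < 1}"
    proof safe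
      fix x assume "x \<in> interior K"
      then obtain e where e: "0 < e" "cball x e \<subseteq> K"
        by (metis mem_interior_cball)
      show "gauge x < 1"
      proof (cases "x = 0")
        case True
        then show ?thesis using gauge_zero_iff[of x] by simp
      next
        case False
        have "(1 + e / norm x) *\<^sub>R x \<in> cball x e"
          using e False by (simp add: dist_norm algebra_simps)
        then have "gauge ((1 + e / norm x) *\<^sub>R x) \<le> 1"
          using e in_K_iff by blast
        moreover have "0 < e / norm x * gauge x"
          using e False gauge_pos by simp
        ultimately show ?thesis
          using e by (subst (asm) gauge_scale) (auto simp: distrib_right)
      qed
    qed
    have "open {x. gauge x < 1}"
      by (intro open_Collect_less gauge_continuous continuous_on_const)
    then show "{x. gauge x < 1} \<subseteq> interior K"
      by (intro interior_maximal) (auto simp: in_K_iff)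
  qed
  then show ?thesis
    using compact_imp_closed[OF compact_K] by (auto simp: frontier_def in_K_iff)
qed

lemma gauge_normalize: "x \<noteq> 0 \<Longrightarrow> gauge ((1 / gauge x) *\<^sub>R x) = 1"
  using gauge_pos[of x] by (subst gauge_scale) auto

lemma supp_attained: "\<exists>x\<in>K. x \<bullet> v = supp v" and inner_le_supp: "x \<in> K \<Longrightarrow> x \<bullet> v \<le> supp v"
proof -
  have "continuous_on K (\<lambda>x. x \<bullet> v)"
    by (intro continuous_intros)
  then obtain x where x: "x \<in> K" "\<And>y. y \<in> K \<Longrightarrow> y \<bullet> v \<le> x \<bullet> v"
    using continuous_attains_sup[OF compact_K, of "\<lambda>x. x \<bullet> v"] zero_in_K by blast
  then have "supp v = x \<bullet> v"
    unfolding support_function_def by (intro cSup_eq_maximum) auto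
  then show "\<exists>x\<in>K. x \<bullet> v = supp v" "x \<in> K \<Longrightarrow> x \<bullet> v \<le> supp v" for x
    using x by auto
qed

lemma inner_le_gauge_supp: "x \<bullet> v \<le> gauge x * supp v"
proof (cases "x = 0")
  case True
  then show ?thesis using gauge_zero_iff[of x] by simp
next
  case False
  have "(1 / gauge x) *\<^sub>R x \<in> K"
    using gauge_normalize[OF False] by (simp add: in_K_iff)
  then have "((1 / gauge x) *\<^sub>R x) \<bullet> v \<le> supp v"
    by (rule inner_le_supp)
  then show ?thesis
    using gauge_pos[OF False] by (simp add: field_simps)
qed

lemma supp_lower: "inradius * norm v \<le> supp v"
proof (cases "v = 0")
  case True
  then show ?thesis using inner_le_supp[OF zero_in_K, of v] by simp
next
  case False
  have "(inradius / norm v) *\<^sub>R v \<in> K"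
    using inradius False by (intro subsetD[OF inradius(2)]) (simp add: abs_of_pos)
  from inner_le_supp[OF this, of v] show ?thesis
    using False by (simp add: power2_norm_eq_inner[symmetric] power2_eq_square)
qed

lemma supp_nonneg: "0 \<le> supp v"
  using supp_lower[of v] inradius(1) by (meson mult_nonneg_nonneg norm_ge_zero less_imp_le order_trans)

lemma supp_pos: "v \<noteq> 0 \<Longrightarrow> 0 < supp v"
  using supp_lower[of v] inradius(1) by (meson mult_pos_pos zero_less_norm_iff less_le_trans)

lemma supp_unique: "x \<in> K \<Longrightarrow> (\<And>y. y \<in> K \<Longrightarrow> y \<bullet> v \<le> x \<bullet> v) \<Longrightarrow> supp v = x \<bullet> v"
  by (metis antisym inner_le_supp supp_attained)

lemma supp_scale:
  assumes "0 \<le> c"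
  shows "supp (c *\<^sub>R v) = c * supp v"
proof -
  obtain x where x: "x \<in> K" "x \<bullet> v = supp v"
    using supp_attained by blast
  then show ?thesis
    using assms inner_le_supp[of _ v] by (subst supp_unique[of x]) (auto intro: mult_left_mono)
qed

lemma supp_continuous: "continuous_on S supp"
proof -
  have "supp v - supp w \<le> outradius * norm (v - w)" for v w
  proof -
    obtain x where x: "x \<in> K" "x \<bullet> v = supp v"
      using supp_attained by blast
    then have "supp v - supp w \<le> x \<bullet> (v - w)"
      using inner_le_supp[OF x(1), of w] by (simp add: inner_diff_right)
    also have "\<dots> \<le> norm x * norm (v - w)"
      by (rule norm_cauchy_schwarz)
    also have "\<dots> \<le> outradius * norm (v - w)"
      using outradius(2)[OF x(1)] by (intro mult_right_mono) auto
    finally show ?thesis .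
  qed
  from this this[of _ _] have "dist (supp v) (supp w) \<le> outradius * dist v w" for v w
    by (metis abs_le_iff dist_norm minus_diff_eq norm_minus_commute real_norm_def)
  then have "outradius-lipschitz_on S supp"
    using outradius(1) by (intro lipschitz_onI) auto
  then show ?thesis
    by (rule lipschitz_on_continuous_on)
qed

lemma supp_measurable [measurable]: "supp \<in> borel_measurable borel"
  by (intro borel_measurable_continuous_onI supp_continuous)

end

section \<open>The gradient of the gauge\<close>

lemma gradient_eqI:
  fixes F :: "'a::real_inner \<Rightarrow> real"
  assumes "(F has_derivative (\<lambda>h. h \<bullet> w)) (at x)"
  shows "gradient F x = w"
proof -
  have uniq: "D = w" if "GDERIV F x :> D" for D
  proof -
    have "(\<lambda>h. h \<bullet> D) = (\<lambda>h. h \<bullet> w)"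
      using that assms unfolding gderiv_def by (rule has_derivative_unique)
    then have "(D - w) \<bullet> D = (D - w) \<bullet> w"
      by metis
    then have "(D - w) \<bullet> (D - w) = 0"
      by (simp add: inner_diff_right)
    then show ?thesis by simp
  qed
  moreover have w: "GDERIV F x :> w"
    unfolding gderiv_def by (rule assms)
  ultimately have "(THE D. GDERIV F x :> D) = w"
    by blast
  then show ?thesis
    using w by (auto simp: gradient_def)
qed

lemma differentiable_has_gradient:
  fixes F :: "'a::euclidean_space \<Rightarrow> real"
  assumes "F differentiable (at x)"
  shows "(F has_derivative (\<lambda>h. h \<bullet> gradient F x)) (at x)"
proof -
  obtain F' where F': "(F has_derivative F') (at x)"
    using assms unfolding differentiable_def by blast
  interpret bounded_linear F'
    using F' by (rule has_derivative_bounded_linear)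
  have "F' h = h \<bullet> (\<Sum>b\<in>Basis. F' b *\<^sub>R b)" for h
  proof -
    have "F' h = F' (\<Sum>b\<in>Basis. (h \<bullet> b) *\<^sub>R b)"
      by (simp add: euclidean_representation)
    also have "\<dots> = (\<Sum>b\<in>Basis. (h \<bullet> b) * F' b)"
      by (simp add: sum scale)
    finally show ?thesis
      by (simp add: inner_sum_right mult.commute)
  qed
  then have "F' = (\<lambda>h. h \<bullet> (\<Sum>b\<in>Basis. F' b *\<^sub>R b))"
    by (rule ext)
  then have "(F has_derivative (\<lambda>h. h \<bullet> (\<Sum>b\<in>Basis. F' b *\<^sub>R b))) (at x)"
    using F' by metis
  then show ?thesis
    using gradient_eqI by metis
qed

lemma lebesgue_measurable_AE_cong:
  fixes F G :: "'a::euclidean_space \<Rightarrow> 'b::topological_space"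
  assumes F: "F \<in> borel_measurable lebesgue" and eq: "AE x in lebesgue. F x = G x"
  shows "G \<in> borel_measurable lebesgue"
proof (rule measurableI)
  fix B :: "'b set" assume "B \<in> sets borel"
  then have "F -` B \<in> sets lebesgue"
    using measurable_sets[OF F] by fastforce
  moreover have "AE x in lebesgue. x \<in> F -` B \<longleftrightarrow> x \<in> G -` B"
    using eq by eventually_elim simp
  ultimately show "G -` B \<inter> space lebesgue \<in> sets lebesgue"
    using completion.in_sets_AE[of "F -` B" "G -` B" lborel] by simp
qed simp

lemma directional_derivative:
  fixes F :: "'a::real_inner \<Rightarrow> real"
  assumes "(F has_derivative (\<lambda>h. h \<bullet> w)) (at x)"
  shows "((\<lambda>t. (F (x + t *\<^sub>R y) - F x) / t) \<longlongrightarrow> y \<bullet> w) (at 0)"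
proof -
  have line: "((\<lambda>t::real. x + t *\<^sub>R y) has_derivative (\<lambda>t. t *\<^sub>R y)) (at 0)"
    by (auto intro!: derivative_eq_intros)
  have "(F has_derivative (\<lambda>h. h \<bullet> w)) (at (x + 0 *\<^sub>R y))"
    using assms by simp
  from has_derivative_compose[OF line this]
  have "((\<lambda>t. F (x + t *\<^sub>R y)) has_derivative (\<lambda>t. (t *\<^sub>R y) \<bullet> w)) (at 0)" .
  moreover have "(\<lambda>t. (t *\<^sub>R y) \<bullet> w) = (*) (y \<bullet> w)"
    by (auto simp: fun_eq_iff)
  ultimately have "((\<lambda>t. F (x + t *\<^sub>R y)) has_field_derivative y \<bullet> w) (at 0)"
    unfolding has_field_derivative_def by metis
  then show ?thesis
    by (simp add: has_field_derivative_iff)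
qed

context body_around_origin
begin

abbreviation grad :: "'a \<Rightarrow> 'a" where "grad \<equiv> gradient gauge"

definition smooth_points :: "'a set" where
  "smooth_points = {x. x \<noteq> 0 \<and> gauge differentiable (at x)}"

definition normal :: "'a \<Rightarrow> 'a" where
  "normal x = grad x /\<^sub>R norm (grad x)"

lemma negligible_nonsmooth: "negligible (- smooth_points)"
proof -
  have "negligible ({x. \<not> gauge differentiable (at x)} \<union> {0})"
    by (intro negligible_Un negligible_sing convex_lipschitz_differentiable_AE[OF gauge_convex gauge_lipschitz])
  then show ?thesis
    by (rule negligible_subset) (auto simp: smooth_points_def)
qed

lemma smooth_points_measurable: "smooth_points \<in> sets lebesgue"
  using negligible_imp_sets[OF negligible_nonsmooth] by (metis Compl_in_sets_lebesgue)

lemma AE_smooth: "AE x in lebesgue. x \<in> smooth_points"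
  using negligible_nonsmooth by (simp add: negligible_iff_null_sets AE_iff_null_sets[OF smooth_points_measurable, symmetric] completion.AE_iff_null_sets Compl_eq)

lemma has_grad:
  assumes "x \<in> smooth_points"
  shows "(gauge has_derivative (\<lambda>h. h \<bullet> grad x)) (at x)"
  using assms unfolding smooth_points_def by (intro differentiable_has_gradient) auto

text \<open>
  Subadditivity bounds the difference quotients in direction \<open>y\<close> by \<open>g y\<close>.
\<close>

lemma inner_grad_le:
  assumes x: "x \<in> smooth_points"
  shows "y \<bullet> grad x \<le> gauge y"
proof (rule tendsto_upperbound)
  show "((\<lambda>t. (gauge (x + t *\<^sub>R y) - gauge x) / t) \<longlongrightarrow> y \<bullet> grad x) (at_right 0)"
    using directional_derivative[OF has_grad[OF x]] by (rule tendsto_mono[rotated]) (simp add: at_le)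
  have "(gauge (x + t *\<^sub>R y) - gauge x) / t \<le> gauge y" if "0 < t" for t
    using gauge_triangle[of x "t *\<^sub>R y"] gauge_scale[of t y] that by (simp add: divide_le_eq mult.commute)
  then show "eventually (\<lambda>t. (gauge (x + t *\<^sub>R y) - gauge x) / t \<le> gauge y) (at_right 0)"
    by (auto intro: eventually_at_rightI[of 0 1])
qed simp

text \<open>
  Euler's identity for functions homogeneous of degree \<open>1\<close>.
\<close>

lemma inner_grad_self:
  assumes x: "x \<in> smooth_points"
  shows "x \<bullet> grad x = gauge x"
proof (rule tendsto_unique)
  show "((\<lambda>t. (gauge (x + t *\<^sub>R x) - gauge x) / t) \<longlongrightarrow> x \<bullet> grad x) (at_right 0)"
    using directional_derivative[OF has_grad[OF x]] by (rule tendsto_mono[rotated]) (simp add: at_le)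
  have "(gauge (x + t *\<^sub>R x) - gauge x) / t = gauge x" if "0 < t" for t
  proof -
    have "gauge (x + t *\<^sub>R x) = (1 + t) * gauge x"
      using gauge_scale[of "1 + t" x] that by (simp add: scaleR_add_left)
    then show ?thesis
      using that by (simp add: field_simps)
  qed
  then show "((\<lambda>t. (gauge (x + t *\<^sub>R x) - gauge x) / t) \<longlongrightarrow> gauge x) (at_right 0)"
    by (intro tendsto_eventually) (auto intro: eventually_at_rightI[of 0 1])
qed simp

lemma grad_scale:
  assumes x: "x \<in> smooth_points" and c: "0 < c"
  shows "c *\<^sub>R x \<in> smooth_points" "grad (c *\<^sub>R x) = grad x"
proof -
  have eq: "gauge = (\<lambda>y. c * gauge ((1 / c) *\<^sub>R y))"
    using c by (auto simp: gauge_scale fun_eq_iff)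
  have lin: "((\<lambda>y. (1 / c) *\<^sub>R y) has_derivative (\<lambda>h. (1 / c) *\<^sub>R h)) (at (c *\<^sub>R x))"
    by (auto intro!: derivative_eq_intros)
  have "(gauge has_derivative (\<lambda>h. h \<bullet> grad x)) (at ((1 / c) *\<^sub>R (c *\<^sub>R x)))"
    using has_grad[OF x] c by simp
  from has_derivative_mult_right[OF has_derivative_compose[OF lin this], of c]
  have "((\<lambda>y. c * gauge ((1 / c) *\<^sub>R y)) has_derivative (\<lambda>h. h \<bullet> grad x)) (at (c *\<^sub>R x))"
    using c by simp
  then have d: "(gauge has_derivative (\<lambda>h. h \<bullet> grad x)) (at (c *\<^sub>R x))"
    by (simp only: eq[symmetric])
  then show "grad (c *\<^sub>R x) = grad x"
    by (rule gradient_eqI)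
  show "c *\<^sub>R x \<in> smooth_points"
    using d x c by (auto simp: smooth_points_def differentiable_def)
qed

lemma smooth_nonzero: "x \<in> smooth_points \<Longrightarrow> x \<noteq> 0"
  by (simp add: smooth_points_def)

text \<open>
  By \<open>inner_grad_le\<close> and \<open>inner_grad_self\<close> the function \<open>y \<mapsto> \<langle>y, \<nabla>g(x)\<rangle>\<close> is at most \<open>1\<close> on \<open>K\<close>, with equality at the
  boundary point \<open>x / g(x)\<close>.
\<close>

lemma supp_grad:
  assumes x: "x \<in> smooth_points"
  shows "supp (grad x) = 1"
proof -
  have g: "0 < gauge x"
    using gauge_pos smooth_nonzero[OF x] by blast
  have "supp (grad x) = ((1 / gauge x) *\<^sub>R x) \<bullet> grad x"
  proof (rule supp_unique)
    show in_K: "(1 / gauge x) *\<^sub>R x \<in> K"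
      using gauge_normalize[OF smooth_nonzero[OF x]] by (simp add: in_K_iff)
    have one: "((1 / gauge x) *\<^sub>R x) \<bullet> grad x = 1"
      using g by (simp add: inner_grad_self[OF x])
    show "y \<bullet> grad x \<le> ((1 / gauge x) *\<^sub>R x) \<bullet> grad x" if "y \<in> K" for y
      using inner_grad_le[OF x, of y] that unfolding one in_K_iff by linarith
  qed
  also have "\<dots> = 1"
    using g by (simp add: inner_grad_self[OF x])
  finally show ?thesis .
qed

lemma grad_nonzero: "x \<in> smooth_points \<Longrightarrow> grad x \<noteq> 0"
  using inner_grad_self[of x] gauge_pos[OF smooth_nonzero[of x]] by auto

lemma norm_normal: "x \<in> smooth_points \<Longrightarrow> norm (normal x) = 1"
  using grad_nonzero[of x] by (simp add: normal_def)

lemma supp_normal: "x \<in> smooth_points \<Longrightarrow> supp (normal x) = 1 / norm (grad x)"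
  using supp_scale[of "inverse (norm (grad x))" "grad x"] by (simp add: normal_def supp_grad inverse_eq_divide)

lemma normal_scale: "x \<in> smooth_points \<Longrightarrow> 0 < c \<Longrightarrow> normal (c *\<^sub>R x) = normal x"
  by (simp add: normal_def grad_scale)

lemma normal_is_outer_normal:
  assumes x: "x \<in> smooth_points" "x \<in> frontier K" and y: "y \<in> K"
  shows "y \<bullet> normal x \<le> x \<bullet> normal x"
proof -
  have "y \<bullet> grad x \<le> x \<bullet> grad x"
    using inner_grad_le[OF x(1), of y] inner_grad_self[OF x(1)] x(2) y by (simp add: frontier_K in_K_iff)
  then show ?thesis
    by (simp add: normal_def mult_left_mono)
qed

text \<open>
  For an outer normal \<open>v\<close> at \<open>x\<close> the function \<open>y \<mapsto> g y - \<langle>y, v\<rangle> / h(v)\<close> is nonnegative and vanishes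
  at \<open>x\<close>; its derivative there is zero, so \<open>v\<close> is a multiple of \<open>\<nabla>g(x)\<close>.
\<close>

lemma outer_normal_unique:
  assumes x: "x \<in> smooth_points" "x \<in> frontier K" and v: "norm v = 1"
    and outer: "\<And>y. y \<in> K \<Longrightarrow> y \<bullet> v \<le> x \<bullet> v"
  shows "v = normal x"
proof -
  have v0: "v \<noteq> 0" using v by auto
  have gx: "gauge x = 1"
    using x(2) by (simp add: frontier_K)
  have s: "supp v = x \<bullet> v" "0 < supp v"
    using supp_unique[OF _ outer] gx supp_pos[OF v0] by (auto simp: in_K_iff)
  let ?u = "\<lambda>y. gauge y - y \<bullet> ((1 / supp v) *\<^sub>R v)"
  have d: "(?u has_derivative (\<lambda>h. h \<bullet> grad x - h \<bullet> ((1 / supp v) *\<^sub>R v))) (at x)"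
    by (intro has_derivative_diff has_grad[OF x(1)] bounded_linear_imp_has_derivative bounded_linear_inner_left)
  have "?u x \<le> ?u y" for y
  proof -
    have "?u x = 0" using gx s by simp
    moreover have "0 \<le> ?u y"
      using inner_le_gauge_supp[of y v] s(2) by (simp add: divide_le_eq)
    ultimately show ?thesis by simp
  qed
  then have "(\<lambda>h. h \<bullet> grad x - h \<bullet> ((1 / supp v) *\<^sub>R v)) = (\<lambda>h. 0)"
    using differential_zero_maxmin[of x UNIV ?u] d by auto
  then have "(grad x - (1 / supp v) *\<^sub>R v) \<bullet> grad x - (grad x - (1 / supp v) *\<^sub>R v) \<bullet> ((1 / supp v) *\<^sub>R v) = 0"
    by metis
  then have "(grad x - (1 / supp v) *\<^sub>R v) \<bullet> (grad x - (1 / supp v) *\<^sub>R v) = 0"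
    by (simp add: inner_diff_right)
  then have "grad x = (1 / supp v) *\<^sub>R v"
    by simp
  then show ?thesis
    using v s(2) by (simp add: normal_def)
qed

text \<open>
  The partial derivatives are limits of difference quotients outside a null set.
\<close>

lemma grad_measurable: "grad \<in> borel_measurable lebesgue"
proof (subst borel_measurable_euclidean_space, rule ballI)
  fix b :: 'a assume b: "b \<in> Basis"
  define \<delta> where "\<delta> = (\<lambda>m. 1 / real (Suc m))"
  have \<delta>: "\<delta> m \<noteq> 0" for m
    by (simp add: \<delta>_def)
  have \<delta>_lim: "\<delta> \<longlonglongrightarrow> 0"
    unfolding \<delta>_def using LIMSEQ_Suc[OF lim_1_over_n] by simp
  have lim_at: "filterlim \<delta> (at 0) sequentially"
    using \<delta>_lim \<delta> by (intro filterlim_atI) auto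
  let ?q = "\<lambda>m x. indicator smooth_points x * ((gauge (x + \<delta> m *\<^sub>R b) - gauge x) / \<delta> m)"
  have "(\<lambda>x. indicator smooth_points x * (grad x \<bullet> b)) \<in> borel_measurable lebesgue"
  proof (rule borel_measurable_LIMSEQ_real)
    show "(\<lambda>m. ?q m x) \<longlonglongrightarrow> indicator smooth_points x * (grad x \<bullet> b)" for x
    proof (cases "x \<in> smooth_points")
      case True
      from filterlim_compose[OF directional_derivative[OF has_grad[OF True], of b] lim_at] True
      show ?thesis by (simp add: inner_commute)
    qed simp
    fix m
    have "(\<lambda>x. (gauge (x + \<delta> m *\<^sub>R b) - gauge x) / \<delta> m) \<in> borel_measurable borel"
      by measurable
    then have "(\<lambda>x. (gauge (x + \<delta> m *\<^sub>R b) - gauge x) / \<delta> m) \<in> borel_measurable lebesgue"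
      by (intro measurable_completion) simp
    then show "?q m \<in> borel_measurable lebesgue"
      using smooth_points_measurable by (intro borel_measurable_times borel_measurable_indicator)
  qed
  then show "(\<lambda>x. grad x \<bullet> b) \<in> borel_measurable lebesgue"
    by (rule lebesgue_measurable_AE_cong) (use AE_smooth in \<open>auto elim!: eventually_mono\<close>)
qed

end

section \<open>Projecting pieces of the boundary\<close>

locale cart_body = body_around_origin K for K :: "(real ^ 'n) set"
begin

text \<open>
  Maps the cone over a boundary patch, intersected with \<open>K\<close>, onto the prism over the patch: the
  direction of \<open>x\<close> determines the foot point \<open>P (x / g x)\<close> in the hyperplane, the radial position the
  height. The exponent \<open>n\<close> makes the powers of \<open>g x\<close> cancel in the Jacobian, which is \<open>n \<langle>\<nabla>g(x), v\<rangle>\<close>.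
\<close>

definition flatten :: "real ^ 'n \<Rightarrow> real ^ 'n \<Rightarrow> real ^ 'n" where
  "flatten v x = (1 / gauge x) *\<^sub>R orth_proj v x + (gauge x ^ CARD('n)) *\<^sub>R v"

text \<open>
  A point of height \<open>z \<bullet> v = t\<^sup>n\<close> above the projection of a boundary point \<open>y\<close> is the image of
  \<open>t y\<close>. Height \<open>0\<close> would correspond to the apex of the cone.
\<close>

lemma prism_flatten:
  assumes v: "norm v = 1" and E: "0 \<notin> E" "\<And>x c. x \<in> E \<Longrightarrow> 0 < c \<Longrightarrow> c *\<^sub>R x \<in> E"
  shows "{z \<in> shadow_prism v (E \<inter> frontier K). 0 < z \<bullet> v} = flatten v ` (E \<inter> K)"
proof safe
  have vv: "v \<bullet> v = 1" using v by (simp add: dot_square_norm)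
  fix x assume x: "x \<in> E" "x \<in> K"
  then have g: "0 < gauge x" "gauge x \<le> 1"
    using E(1) gauge_pos[of x] by (auto simp: in_K_iff)
  have "(1 / gauge x) *\<^sub>R x \<in> E \<inter> frontier K"
    using E(2)[OF x(1), of "1 / gauge x"] g gauge_normalize[of x] E(1) x(1) by (auto simp: frontier_K)
  moreover have "orth_proj v (flatten v x) = orth_proj v ((1 / gauge x) *\<^sub>R x)"
    unfolding flatten_def linear_add[OF linear_orth_proj] linear_scale[OF linear_orth_proj]
    using orth_proj_orthogonal(2)[OF v, of x] by (simp add: orth_proj_def[of v v] vv)
  moreover have z: "flatten v x \<bullet> v = gauge x ^ CARD('n)"
    using orth_proj_orthogonal(1)[OF v, of x] by (simp add: flatten_def inner_simps vv)
  ultimately show "flatten v x \<in> shadow_prism v (E \<inter> frontier K)"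
    using g by (auto simp: shadow_prism_def power_le_one)
  show "0 < flatten v x \<bullet> v"
    using g by (simp add: z)
next
  fix z assume z: "z \<in> shadow_prism v (E \<inter> frontier K)" "0 < z \<bullet> v"
  then obtain y where y: "y \<in> E" "gauge y = 1" "orth_proj v z = orth_proj v y" "z \<bullet> v \<le> 1"
    by (auto simp: shadow_prism_def frontier_K)
  define t where "t = root CARD('n) (z \<bullet> v)"
  have t: "0 < t" "t ^ CARD('n) = z \<bullet> v" "t \<le> 1"
    using z(2) y(4) by (auto simp: t_def real_root_pow_pos)
  have "gauge (t *\<^sub>R y) = t"
    using t y(2) by (simp add: gauge_scale)
  then have "flatten v (t *\<^sub>R y) = z"
    using t y(3) by (simp add: flatten_def linear_scale[OF linear_orth_proj]) (simp add: orth_proj_def algebra_simps flip: y(3))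
  moreover have "t *\<^sub>R y \<in> E \<inter> K"
    using t E(2)[OF y(1)] \<open>gauge (t *\<^sub>R y) = t\<close> by (simp add: in_K_iff)
  ultimately show "z \<in> flatten v ` (E \<inter> K)"
    by blast
qed

lemma negligible_base: "norm v = 1 \<Longrightarrow> negligible {z. z \<bullet> v = (0::real)}"
  using negligible_hyperplane[of v 0] by (cases "v = 0") (auto simp: inner_commute)

lemma flatten_has_derivative:
  assumes x: "x \<in> smooth_points"
  shows "(flatten v has_derivative (\<lambda>h. (1 / gauge x) *\<^sub>R (h - (h \<bullet> v) *\<^sub>R v) +
      (grad x \<bullet> h) *\<^sub>R ((real CARD('n) * gauge x ^ (CARD('n) - 1)) *\<^sub>R v - (1 / (gauge x)\<^sup>2) *\<^sub>R orth_proj v x))) (at x)"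
proof -
  have g: "gauge x \<noteq> 0"
    using gauge_pos[OF smooth_nonzero[OF x]] by simp
  have P: "(orth_proj v has_derivative orth_proj v) (at x)"
    by (rule linear_imp_has_derivative[OF linear_orth_proj])
  have I: "((\<lambda>y. 1 / gauge y) has_derivative (\<lambda>h. - (h \<bullet> grad x) / (gauge x)\<^sup>2)) (at x)"
    using has_derivative_divide[OF has_derivative_const has_grad[OF x] g, of 1]
    by (simp add: power2_eq_square divide_simps)
  have N: "((\<lambda>y. gauge y ^ CARD('n)) has_derivative (\<lambda>h. real CARD('n) * (h \<bullet> grad x) * gauge x ^ (CARD('n) - 1))) (at x)"
    using has_derivative_power[OF has_grad[OF x], of "CARD('n)"] by (simp add: mult_ac)
  have "(flatten v has_derivative (\<lambda>h. ((1 / gauge x) *\<^sub>R orth_proj v h + (- (h \<bullet> grad x) / (gauge x)\<^sup>2) *\<^sub>R orth_proj v x)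
      + ((real CARD('n) * (h \<bullet> grad x) * gauge x ^ (CARD('n) - 1)) *\<^sub>R v))) (at x)"
    unfolding flatten_def
    by (intro has_derivative_add has_derivative_scaleR[OF I P] has_derivative_scaleR_left N)
  then show ?thesis
    by (rule has_derivative_eq_rhs) (auto simp: fun_eq_iff orth_proj_def[of v] algebra_simps inner_commute[of "grad x"])
qed

lemma norm_grad_le:
  assumes x: "x \<in> smooth_points"
  shows "norm (grad x) \<le> 1 / inradius"
proof -
  have "grad x \<bullet> grad x \<le> norm (grad x) / inradius"
    using inner_grad_le[OF x, of "grad x"] gauge_le_norm[of "grad x"] by linarith
  then have "norm (grad x) * norm (grad x) \<le> norm (grad x) * (1 / inradius)"
    by (simp add: power2_norm_eq_inner[symmetric] power2_eq_square)
  then show ?thesis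
    by (rule mult_left_le_imp_le) (use grad_nonzero[OF x] in simp)
qed

text \<open>
  Change of variables under \<open>flatten v\<close>, whose derivative is a multiple of the projection plus a
  rank-one map. The base of the prism, missed by \<open>flatten v\<close>, is a null set.
\<close>

lemma emeasure_prism_eq_integral:
  assumes v: "norm v = 1" and E: "E \<in> sets lebesgue" "E \<subseteq> smooth_points"
    and cone: "\<And>x c. x \<in> E \<Longrightarrow> 0 < c \<Longrightarrow> c *\<^sub>R x \<in> E"
    and pos: "\<And>x. x \<in> E \<Longrightarrow> 0 < grad x \<bullet> v"
    and inj: "inj_on (orth_proj v) (E \<inter> frontier K)"
  shows "shadow_prism v (E \<inter> frontier K) \<in> sets lebesgue"
    "emeasure lebesgue (shadow_prism v (E \<inter> frontier K)) =
      (\<integral>\<^sup>+x\<in>E \<inter> K. ennreal (real CARD('n) * (grad x \<bullet> v)) \<partial>lebesgue)"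
proof -
  let ?P = "shadow_prism v (E \<inter> frontier K)" and ?S = "E \<inter> K" and ?J = "\<lambda>x. real CARD('n) * (grad x \<bullet> v)"
  have vv: "v \<bullet> v = 1" using v by (simp add: dot_square_norm)
  have E0: "0 \<notin> E" using E(2) smooth_nonzero by blast
  have Km: "K \<in> sets lebesgue"
    using compact_K by (simp add: borel_compact)
  have S: "?S \<in> sets lebesgue"
    using E(1) Km by blast
  have inj_flat: "inj_on (flatten v) ?S"
  proof (rule inj_onI)
    fix x y assume xy: "x \<in> ?S" "y \<in> ?S" "flatten v x = flatten v y"
    have "x \<noteq> 0" "y \<noteq> 0"
      using xy(1,2) E0 by auto
    then have g: "0 < gauge x" "0 < gauge y"
      by (simp_all add: gauge_pos)
    have z: "flatten v x \<bullet> v = gauge x ^ CARD('n)" for x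
      using orth_proj_orthogonal(1)[OF v, of x] by (simp add: flatten_def inner_simps vv)
    have "gauge x ^ CARD('n) = gauge y ^ CARD('n)"
      using z[of x] z[of y] xy(3) by simp
    then have gxy: "gauge x = gauge y"
      using g power_eq_iff_eq_base[of "CARD('n)" "gauge x" "gauge y"] by simp
    have "orth_proj v ((1 / gauge x) *\<^sub>R x) = orth_proj v ((1 / gauge y) *\<^sub>R y)"
      using xy(3) unfolding flatten_def gxy linear_scale[OF linear_orth_proj] by simp
    moreover have "(1 / gauge x) *\<^sub>R x \<in> E \<inter> frontier K" "(1 / gauge y) *\<^sub>R y \<in> E \<inter> frontier K"
      using xy cone g gauge_normalize[of x] gauge_normalize[of y] E0 by (auto simp: frontier_K)
    ultimately have "(1 / gauge x) *\<^sub>R x = (1 / gauge y) *\<^sub>R y"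
      using inj by (simp add: inj_on_eq_iff)
    then show "x = y"
      using g gxy by simp
  qed
  have der: "(flatten v has_derivative (\<lambda>h. (1 / gauge x) *\<^sub>R (h - (h \<bullet> v) *\<^sub>R v) +
      (grad x \<bullet> h) *\<^sub>R ((real CARD('n) * gauge x ^ (CARD('n) - 1)) *\<^sub>R v - (1 / (gauge x)\<^sup>2) *\<^sub>R orth_proj v x))) (at x within ?S)"
    if "x \<in> ?S" for x
    by (rule has_derivative_at_withinI[OF flatten_has_derivative]) (use that E(2) in blast)
  have J: "\<bar>(1 / gauge x) ^ (CARD('n) - 1) *
      (((real CARD('n) * gauge x ^ (CARD('n) - 1)) *\<^sub>R v - (1 / (gauge x)\<^sup>2) *\<^sub>R orth_proj v x) \<bullet> v) * (grad x \<bullet> v)\<bar> = ?J x"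
    if x: "x \<in> ?S" for x
  proof -
    have "x \<noteq> 0"
      using x E0 by auto
    then have g: "0 < gauge x"
      by (rule gauge_pos)
    have "(1 / gauge x) ^ (CARD('n) - 1) * gauge x ^ (CARD('n) - 1) = 1"
      using g by (simp add: power_one_over)
    then have "(1 / gauge x) ^ (CARD('n) - 1) *
      (((real CARD('n) * gauge x ^ (CARD('n) - 1)) *\<^sub>R v - (1 / (gauge x)\<^sup>2) *\<^sub>R orth_proj v x) \<bullet> v) = real CARD('n)"
      using orth_proj_orthogonal(1)[OF v, of x] by (simp add: inner_simps vv mult.left_commute)
    then show ?thesis
      using pos[of x] x by simp
  qed
  have Jm: "?J \<in> borel_measurable lebesgue"
    using grad_measurable by measurable
  have fin: "(\<integral>\<^sup>+x\<in>?S. ennreal (?J x) \<partial>lebesgue) < \<infinity>"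
  proof -
    have "(\<integral>\<^sup>+x\<in>?S. ennreal (?J x) \<partial>lebesgue) \<le> (\<integral>\<^sup>+x. ennreal (real CARD('n) * (1 / inradius)) * indicator K x \<partial>lebesgue)"
    proof (intro nn_integral_mono)
      fix x
      have "grad x \<bullet> v \<le> 1 / inradius" if "x \<in> E"
        using norm_cauchy_schwarz[of "grad x" v] norm_grad_le[of x] that E(2) v by auto
      then have "?J x \<le> real CARD('n) * (1 / inradius)" if "x \<in> E"
        using that by (intro mult_left_mono) auto
      then show "ennreal (?J x) * indicator ?S x \<le> ennreal (real CARD('n) * (1 / inradius)) * indicator K x"
        using ennreal_leI by (simp add: indicator_def)
    qed
    also have "\<dots> = ennreal (real CARD('n) * (1 / inradius)) * emeasure lebesgue K"
      using Km by (simp add: nn_integral_cmult)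
    also have "\<dots> < \<infinity>"
      using lmeasurable_compact[OF compact_K] by (auto simp: fmeasurable_def ennreal_mult_less_top)
    finally show ?thesis .
  qed
  note F = emeasure_image_rank_one_derivative[OF S v der inj_flat J Jm fin]
  have "?P = {z \<in> ?P. 0 < z \<bullet> v} \<union> (?P \<inter> {z. z \<bullet> v = 0})"
    by (auto simp: shadow_prism_def)
  from trans[OF this arg_cong2[where f = "(\<union>)", OF prism_flatten[OF v E0 cone] refl]]
  have split: "?P = flatten v ` ?S \<union> (?P \<inter> {z. z \<bullet> v = 0})" .
  have neg: "negligible (?P \<inter> {z. z \<bullet> v = 0})"
    by (rule negligible_subset[OF negligible_base[OF v]]) auto
  show "?P \<in> sets lebesgue"
    by (subst split) (intro sets.Un F(1) negligible_imp_sets neg)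
  show "emeasure lebesgue ?P = (\<integral>\<^sup>+x\<in>?S. ennreal (?J x) \<partial>lebesgue)"
    by (subst split, subst emeasure_Un_null_set)
      (use F neg in \<open>auto simp: negligible_iff_null_sets\<close>)
qed

text \<open>
  The cone over \<open>Z\<close> consists of points of nondifferentiability of the gauge and is a null set.
  \<open>flatten v\<close> need not be differentiable there, but it is the composition of a Lipschitz map, which
  records the gauge as the new height, and a map that is smooth off the base hyperplane; both preserve
  null sets.
\<close>

lemma negligible_prism_nonsmooth:
  assumes v: "norm v = 1" and Z: "Z \<subseteq> frontier K - smooth_points"
  shows "negligible (shadow_prism v Z)"
proof -
  have vv: "v \<bullet> v = 1" using v by (simp add: dot_square_norm)
  define C where "C = {c *\<^sub>R z | c z. 0 < c \<and> z \<in> Z}"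
  have Cc: "c *\<^sub>R x \<in> C" if x: "x \<in> C" and c: "0 < c" for x c
  proof -
    obtain d z where "x = d *\<^sub>R z" "0 < d" "z \<in> Z"
      using x by (auto simp: C_def)
    then show ?thesis
      unfolding C_def using c by (intro CollectI exI[of _ "c * d"] exI[of _ z]) simp
  qed
  have gZ: "gauge z = 1" if "z \<in> Z" for z
    using that Z by (auto simp: frontier_K)
  have C0: "0 \<notin> C"
  proof
    assume "0 \<in> C"
    then obtain c z where "0 < c" "z \<in> Z" "0 = c *\<^sub>R z"
      by (auto simp: C_def)
    then show False
      using gZ[of z] gauge_zero_iff[of z] by simp
  qed
  have CZ: "C \<inter> frontier K = Z"
  proof safe
    fix x assume "x \<in> C" "x \<in> frontier K"
    then obtain c z where "0 < c" "z \<in> Z" "x = c *\<^sub>R z" "gauge x = 1"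
      by (auto simp: C_def frontier_K)
    then show "x \<in> Z"
      using gZ[of z] by (simp add: gauge_scale)
  next
    fix z assume z: "z \<in> Z"
    then have "1 *\<^sub>R z \<in> C"
      unfolding C_def by (intro CollectI exI[of _ 1] exI[of _ z]) auto
    then show "z \<in> C" by simp
    show "z \<in> frontier K" using z Z by auto
  qed
  have "C \<subseteq> - smooth_points"
  proof safe
    fix x assume "x \<in> C" and x: "x \<in> smooth_points"
    then obtain c z where cz: "0 < c" "z \<in> Z" "x = c *\<^sub>R z"
      by (auto simp: C_def)
    then have "z \<in> smooth_points"
      using grad_scale(1)[OF x, of "1 / c"] by simp
    then show False using cz Z by auto
  qed
  then have negC: "negligible C"
    by (rule negligible_subset[OF negligible_nonsmooth])
  define lift where "lift = (\<lambda>x. orth_proj v x + gauge x *\<^sub>R v)"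
  define straighten where "straighten = (\<lambda>y. (1 / (y \<bullet> v)) *\<^sub>R orth_proj v y + ((y \<bullet> v) ^ CARD('n)) *\<^sub>R v)"
  have lift_v: "lift x \<bullet> v = gauge x" and lift_P: "orth_proj v (lift x) = orth_proj v x" for x
    using orth_proj_orthogonal(1)[OF v, of x]
    by (simp_all add: lift_def inner_simps vv orth_proj_def[of v "_ + _"] )
  have "negligible (lift ` C)"
  proof (rule negligible_locally_Lipschitz_image[OF order_refl negC])
    fix x assume "x \<in> C"
    have "norm (lift y - lift x) \<le> (1 + 1 / inradius) * norm (y - x)" for y
    proof -
      have "lift y - lift x = orth_proj v (y - x) + (gauge y - gauge x) *\<^sub>R v"
        by (simp add: lift_def linear_diff[OF linear_orth_proj] algebra_simps)
      then have "norm (lift y - lift x) \<le> norm (orth_proj v (y - x)) + \<bar>gauge y - gauge x\<bar>"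
        using norm_triangle_ineq[of "orth_proj v (y - x)" "(gauge y - gauge x) *\<^sub>R v"] v by simp
      also have "\<dots> \<le> norm (y - x) + (1 / inradius) * norm (y - x)"
        by (intro add_mono norm_orth_proj_le v gauge_lipschitz)
      finally show ?thesis
        by (simp add: distrib_right)
    qed
    then show "\<exists>T B. open T \<and> x \<in> T \<and> (\<forall>y\<in>C \<inter> T. norm (lift y - lift x) \<le> B * norm (y - x))"
      by (intro exI[of _ UNIV] exI[of _ "1 + 1 / inradius"]) auto
  qed
  moreover have "straighten differentiable_on (lift ` C)"
    unfolding differentiable_on_def
  proof (rule ballI)
    fix y assume "y \<in> lift ` C"
    then have "y \<bullet> v \<noteq> 0"
      using C0 gauge_pos by (auto simp: lift_v gauge_zero_iff)
    then show "straighten differentiable (at y within lift ` C)"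
      unfolding straighten_def orth_proj_def
      by (intro differentiable_add differentiable_scaleR differentiable_divide differentiable_const
        differentiable_inner differentiable_ident differentiable_diff differentiable_power)
  qed
  ultimately have "negligible (straighten ` lift ` C)"
    by (rule negligible_differentiable_image_negligible[OF order_refl])
  moreover have "flatten v x = straighten (lift x)" for x
    unfolding straighten_def lift_v lift_P flatten_def ..
  ultimately have "negligible (flatten v ` C)"
    by (simp add: image_image)
  then have "negligible (flatten v ` (C \<inter> K) \<union> {z. z \<bullet> v = 0})"
    using negligible_base[OF v] by (intro negligible_Un) (auto intro: negligible_subset)
  then show ?thesis
    by (rule negligible_subset)
      (use prism_flatten[OF v C0 Cc] in \<open>auto simp: CZ shadow_prism_def[of v Z] set_eq_iff\<close>)
qed

text \<open>
  Each of \<open>x\<close> and \<open>y\<close> maximizes its normal direction over \<open>K\<close>, so \<open>x - y\<close> is almost orthogonal to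
  \<open>v\<close>: \<open>|\<langle>x - y, v\<rangle>| \<le> \<epsilon> |x - y|\<close>. Pythagoras gives the rest. The normals \<open>a\<close> and \<open>b\<close> need not be
  unique, so this applies to singular boundary points as well.
\<close>

lemma near_normals_lipschitz:
  assumes v: "norm v = 1" and \<epsilon>: "0 < \<epsilon>" "\<epsilon> < 1"
    and x: "x \<in> K" "norm a = 1" "\<And>y. y \<in> K \<Longrightarrow> y \<bullet> a \<le> x \<bullet> a" "norm (a - v) \<le> \<epsilon>"
    and y: "y \<in> K" "norm b = 1" "\<And>z. z \<in> K \<Longrightarrow> z \<bullet> b \<le> y \<bullet> b" "norm (b - v) \<le> \<epsilon>"
  shows "norm (x - y) \<le> 1 / sqrt (1 - \<epsilon>\<^sup>2) * norm (orth_proj v x - orth_proj v y)"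
proof -
  have one: "(z - w) \<bullet> v \<le> \<epsilon> * norm (z - w)"
    if "norm (c - v) \<le> \<epsilon>" "z \<bullet> c \<le> w \<bullet> c" for z w c
  proof -
    have "(z - w) \<bullet> v = (z - w) \<bullet> c - (z - w) \<bullet> (c - v)"
      by (simp add: inner_simps)
    also have "\<dots> \<le> norm (z - w) * norm (c - v)"
      using that(2) Cauchy_Schwarz_ineq2[of "z - w" "c - v"] by (simp add: inner_diff_left abs_le_iff)
    also have "\<dots> \<le> norm (z - w) * \<epsilon>"
      using that(1) by (intro mult_left_mono) auto
    finally show ?thesis by (simp add: mult.commute)
  qed
  have "(y - x) \<bullet> v \<le> \<epsilon> * norm (y - x)" "(x - y) \<bullet> v \<le> \<epsilon> * norm (x - y)"
    using one[OF x(4) x(3)[OF y(1)]] one[OF y(4) y(3)[OF x(1)]] by auto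
  then have "\<bar>(x - y) \<bullet> v\<bar> \<le> \<epsilon> * norm (x - y)"
    by (simp add: abs_le_iff inner_diff_left norm_minus_commute)
  then have "((x - y) \<bullet> v)\<^sup>2 \<le> (\<epsilon> * norm (x - y))\<^sup>2"
    by (rule abs_le_square_iff[THEN iffD1, OF order_trans]) simp
  then have "(1 - \<epsilon>\<^sup>2) * (norm (x - y))\<^sup>2 \<le> (norm (orth_proj v (x - y)))\<^sup>2"
    using orth_proj_orthogonal(3)[OF v, of "x - y"] by (simp add: power_mult_distrib left_diff_distrib)
  then have "sqrt ((1 - \<epsilon>\<^sup>2) * (norm (x - y))\<^sup>2) \<le> norm (orth_proj v (x - y))"
    by (rule real_le_lsqrt[rotated]) simp
  then have "sqrt (1 - \<epsilon>\<^sup>2) * norm (x - y) \<le> norm (orth_proj v x - orth_proj v y)"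
    by (simp add: real_sqrt_mult linear_diff[OF linear_orth_proj])
  moreover have "0 < sqrt (1 - \<epsilon>\<^sup>2)"
    using \<epsilon> by (simp add: abs_square_less_1)
  ultimately show ?thesis
    by (simp add: field_simps)
qed

end

section \<open>The surface area measure as an image of the cone measure\<close>

text \<open>
  Finitely many balls of radius \<open>\<epsilon>\<close> cover the sphere; subtracting from each the earlier ones makes
  them disjoint.
\<close>

lemma sphere_partition:
  fixes \<epsilon> :: real
  assumes \<epsilon>: "0 < \<epsilon>"
  shows "\<exists>(N :: nat) (c :: nat \<Rightarrow> 'a::euclidean_space) (U :: nat \<Rightarrow> 'a set).
    (\<forall>i<N. norm (c i) = 1) \<and> (\<forall>i. U i \<in> sets borel) \<and> (\<forall>i j. i \<noteq> j \<longrightarrow> U i \<inter> U j = {}) \<and>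
    (\<Union>i<N. U i) = sphere 0 1 \<and> (\<forall>i. \<forall>a\<in>U i. norm (a - c i) \<le> \<epsilon>)"
proof -
  have "sphere (0::'a) 1 \<subseteq> (\<Union>v\<in>sphere 0 1. ball v \<epsilon>)"
    using \<epsilon> by force
  then obtain F where F: "F \<subseteq> sphere (0::'a) 1" "finite F" "sphere (0::'a) 1 \<subseteq> (\<Union>v\<in>F. ball v \<epsilon>)"
    using compactE_image[OF compact_sphere, of "sphere (0::'a) 1" "\<lambda>v. ball v \<epsilon>" 0 1] by (metis open_ball)
  obtain xs where xs: "set xs = F"
    using finite_list[OF F(2)] by blast
  define N where "N = length xs"
  define c where "c = (\<lambda>i. xs ! i)"
  have c_F: "c ` {..<N} = F"
    using xs by (auto simp: c_def N_def set_conv_nth)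
  define U where "U = (\<lambda>i. (sphere (0::'a) 1 \<inter> ball (c i) \<epsilon>) - (\<Union>j<i. ball (c j) \<epsilon>))"
  show ?thesis
  proof (intro exI conjI allI impI ballI)
    show "norm (c i) = 1" if "i < N" for i
      using F(1) c_F that by force
    show "U i \<in> sets borel" for i
      unfolding U_def by (intro sets.Diff sets.Int sets.finite_UN) auto
    show "U i \<inter> U j = {}" if "i \<noteq> j" for i j
      using that by (cases "i < j") (auto simp: U_def)
    show "norm (a - c i) \<le> \<epsilon>" if "a \<in> U i" for a i
      using that by (auto simp: U_def dist_norm norm_minus_commute)
    show "(\<Union>i<N. U i) = sphere 0 1"
    proof
      show "sphere 0 1 \<subseteq> (\<Union>i<N. U i)"
      proof
        fix a :: 'a assume a: "a \<in> sphere 0 1"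
        then have ex: "\<exists>i. i < N \<and> a \<in> ball (c i) \<epsilon>"
          using F(3) c_F by blast
        define i where "i = (LEAST i. i < N \<and> a \<in> ball (c i) \<epsilon>)"
        have i: "i < N" "a \<in> ball (c i) \<epsilon>"
          using LeastI_ex[OF ex] by (auto simp: i_def)
        have "a \<notin> ball (c j) \<epsilon>" if "j < i" for j
          using not_less_Least[of j "\<lambda>i. i < N \<and> a \<in> ball (c i) \<epsilon>"] that i by (auto simp: i_def)
        then show "a \<in> (\<Union>i<N. U i)"
          using i a by (auto simp: U_def)
      qed
    qed (auto simp: U_def)
  qed
qed

context cart_body
begin

text \<open>
  The cone over a boundary element of area \<open>dS\<close> and normal \<open>\<nu>\<close> has volume \<open>h(\<nu>) dS / n\<close> within \<open>K\<close>,
  where \<open>|\<nabla>g| = 1 / h(\<nu>)\<close>. This density therefore gives the cone over a boundary patch the area of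
  the patch.
\<close>

definition cone_measure :: "(real ^ 'n) measure" where
  "cone_measure = density lebesgue (\<lambda>x. ennreal (real CARD('n) * norm (grad x)) * indicator K x)"

definition cone_of_normals :: "(real ^ 'n) set \<Rightarrow> (real ^ 'n) set" where
  "cone_of_normals \<omega> = {x \<in> smooth_points. normal x \<in> \<omega>}"

lemma K_lebesgue: "K \<in> sets lebesgue"
  using compact_K by (simp add: borel_compact)

lemma frontier_sub_K: "frontier K \<subseteq> K"
  by (auto simp: frontier_K in_K_iff)

lemma sets_cone_measure [simp]: "sets cone_measure = sets lebesgue"
  by (simp add: cone_measure_def)

lemma space_cone_measure [simp]: "space cone_measure = UNIV"
  by (simp add: cone_measure_def)

lemma cone_density_measurable:
  "(\<lambda>x. ennreal (real CARD('n) * norm (grad x)) * indicator K x) \<in> borel_measurable lebesgue"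
  using grad_measurable K_lebesgue by measurable

lemma emeasure_cone_measure:
  "E \<in> sets lebesgue \<Longrightarrow>
    emeasure cone_measure E = (\<integral>\<^sup>+x\<in>E \<inter> K. ennreal (real CARD('n) * norm (grad x)) \<partial>lebesgue)"
  unfolding cone_measure_def
  by (subst emeasure_density[OF cone_density_measurable]) (auto intro!: nn_integral_cong simp: indicator_def)

lemma normal_measurable: "normal \<in> borel_measurable lebesgue"
  unfolding normal_def using grad_measurable by measurable

lemma cone_of_normals_measurable:
  assumes "\<omega> \<in> sets borel"
  shows "cone_of_normals \<omega> \<in> sets lebesgue"
proof -
  have "cone_of_normals \<omega> = smooth_points \<inter> (normal -` \<omega> \<inter> space lebesgue)"
    by (auto simp: cone_of_normals_def)
  then show ?thesis
    using smooth_points_measurable measurable_sets[OF normal_measurable assms] by auto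
qed

lemma cone_of_normals_cone: "x \<in> cone_of_normals \<omega> \<Longrightarrow> 0 < c \<Longrightarrow> c *\<^sub>R x \<in> cone_of_normals \<omega>"
  by (simp add: cone_of_normals_def grad_scale normal_scale)

lemma cone_measure_bound:
  assumes "E \<in> sets lebesgue"
  shows "emeasure cone_measure E \<le> ennreal (real CARD('n) / inradius) * emeasure lebesgue (E \<inter> K)"
proof -
  have "emeasure cone_measure E = (\<integral>\<^sup>+x\<in>E \<inter> K. ennreal (real CARD('n) * norm (grad x)) \<partial>lebesgue)"
    by (rule emeasure_cone_measure[OF assms])
  also have "\<dots> \<le> (\<integral>\<^sup>+x. ennreal (real CARD('n) / inradius) * indicator (E \<inter> K) x \<partial>lebesgue)"
  proof (rule nn_integral_mono_AE)
    show "AE x in lebesgue. ennreal (real CARD('n) * norm (grad x)) * indicator (E \<inter> K) x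
        \<le> ennreal (real CARD('n) / inradius) * indicator (E \<inter> K) x"
      using AE_smooth
    proof eventually_elim
      case (elim x)
      have "real CARD('n) * norm (grad x) \<le> real CARD('n) * (1 / inradius)"
        by (intro mult_left_mono norm_grad_le elim) simp
      then show ?case
        by (intro mult_right_mono ennreal_leI) simp_all
    qed
  qed
  also have "\<dots> = ennreal (real CARD('n) / inradius) * emeasure lebesgue (E \<inter> K)"
    using assms K_lebesgue by (intro nn_integral_cmult_indicator) auto
  finally show ?thesis .
qed

lemma cone_measure_finite:
  assumes "E \<in> sets lebesgue"
  shows "emeasure cone_measure E < \<infinity>"
proof -
  have "emeasure lebesgue (E \<inter> K) \<le> emeasure lebesgue K"
    using K_lebesgue by (intro emeasure_mono) auto
  also have "\<dots> < \<infinity>"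
    using lmeasurable_compact[OF compact_K] unfolding fmeasurable_def by blast
  finally have "ennreal (real CARD('n) / inradius) * emeasure lebesgue (E \<inter> K) < \<infinity>"
    by (simp add: ennreal_mult_less_top)
  then show ?thesis
    using cone_measure_bound[OF assms] by (rule le_less_trans[rotated])
qed

lemma inner_unit_near:
  fixes a v :: "real ^ 'n"
  assumes "norm a = 1" "norm v = 1" "norm (a - v) \<le> \<epsilon>"
  shows "1 - \<epsilon>\<^sup>2 / 2 \<le> a \<bullet> v" "a \<bullet> v \<le> 1"
proof -
  have "a \<bullet> a = 1" "v \<bullet> v = 1"
    using assms(1,2) by (simp_all add: dot_square_norm)
  then have "(norm (a - v))\<^sup>2 = 2 - 2 * (a \<bullet> v)"
    unfolding power2_norm_eq_inner by (simp add: inner_diff_left inner_diff_right inner_commute)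
  moreover have "(norm (a - v))\<^sup>2 \<le> \<epsilon>\<^sup>2"
    using assms(3) by (intro power_mono) auto
  moreover have "0 \<le> (norm (a - v))\<^sup>2"
    by simp
  ultimately show "1 - \<epsilon>\<^sup>2 / 2 \<le> a \<bullet> v" "a \<bullet> v \<le> 1"
    by linarith+
qed

text \<open>
  The prism over the patch has volume \<open>n \<integral> \<langle>\<nabla>g, v\<rangle>\<close> over the cone, which differs from its cone measure
  \<open>n \<integral> |\<nabla>g|\<close> by the cosine of the angle between normal and \<open>v\<close>; Hausdorff measure is at least that
  volume, and at most the volume times the \<open>(n - 1)\<close>-st power of the Lipschitz constant of the inverse
  projection.
\<close>

lemma cone_piece_bounds:
  assumes v: "norm v = 1" and \<epsilon>: "0 < \<epsilon>" "\<epsilon> < 1"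
    and E: "E \<in> sets lebesgue" "E \<subseteq> smooth_points" "\<And>x c. x \<in> E \<Longrightarrow> 0 < c \<Longrightarrow> c *\<^sub>R x \<in> E"
    and near: "\<And>x. x \<in> E \<Longrightarrow> norm (normal x - v) \<le> \<epsilon>"
  shows "hausdorff_measure (CARD('n) - 1) (E \<inter> frontier K) \<le>
      ennreal ((1 / sqrt (1 - \<epsilon>\<^sup>2)) ^ (CARD('n) - 1)) * emeasure cone_measure E"
    and "ennreal (1 - \<epsilon>\<^sup>2 / 2) * emeasure cone_measure E \<le> hausdorff_measure (CARD('n) - 1) (E \<inter> frontier K)"
proof -
  let ?L = "1 / sqrt (1 - \<epsilon>\<^sup>2)" and ?A = "E \<inter> frontier K"
  have \<epsilon>2: "0 \<le> 1 - \<epsilon>\<^sup>2" "0 \<le> 1 - \<epsilon>\<^sup>2 / 2" "0 < 1 - \<epsilon>\<^sup>2 / 2"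
  proof -
    have "\<epsilon>\<^sup>2 < 1" using \<epsilon> by (simp add: abs_square_less_1)
    then show "0 \<le> 1 - \<epsilon>\<^sup>2" "0 \<le> 1 - \<epsilon>\<^sup>2 / 2" "0 < 1 - \<epsilon>\<^sup>2 / 2" by linarith+
  qed
  have grad_v: "grad x \<bullet> v = norm (grad x) * (normal x \<bullet> v)" if "x \<in> E" for x
    using grad_nonzero[of x] that E(2) by (auto simp: normal_def)
  have bounds: "1 - \<epsilon>\<^sup>2 / 2 \<le> normal x \<bullet> v" "normal x \<bullet> v \<le> 1" if "x \<in> E" for x
    using inner_unit_near[OF norm_normal v near[OF that]] that E(2) by auto
  have pos: "0 < grad x \<bullet> v" if x: "x \<in> E" for x
  proof -
    have "0 < normal x \<bullet> v"
      using bounds(1)[OF x] \<epsilon>2(3) by linarith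
    then show ?thesis
      unfolding grad_v[OF x] using grad_nonzero[of x] x E(2) by (intro mult_pos_pos) auto
  qed
  have lip: "norm (x - y) \<le> ?L * norm (orth_proj v x - orth_proj v y)" if xy: "x \<in> ?A" "y \<in> ?A" for x y
  proof (rule near_normals_lipschitz[OF v \<epsilon>, of x "normal x" y "normal y"])
    show "x \<in> K" "y \<in> K" using xy frontier_sub_K by auto
    show "norm (normal x) = 1" "norm (normal y) = 1" using xy E(2) norm_normal by auto
    show "norm (normal x - v) \<le> \<epsilon>" "norm (normal y - v) \<le> \<epsilon>" using xy near by auto
    show "z \<bullet> normal x \<le> x \<bullet> normal x" "z \<bullet> normal y \<le> y \<bullet> normal y" if "z \<in> K" for z
      using xy E(2) that by (auto intro: normal_is_outer_normal)
  qed
  have inj: "inj_on (orth_proj v) ?A"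
    using lip by (intro inj_onI) force
  have prism: "shadow_prism v ?A \<in> sets lebesgue"
    "emeasure lebesgue (shadow_prism v ?A) = (\<integral>\<^sup>+x\<in>E \<inter> K. ennreal (real CARD('n) * (grad x \<bullet> v)) \<partial>lebesgue)"
    by (rule emeasure_prism_eq_integral[OF v E pos inj]; assumption)+
  have bdd: "bounded ?A"
    using bounded_subset[OF compact_imp_bounded[OF compact_K]] frontier_sub_K by (meson Int_lower2 order_trans)
  have "emeasure lebesgue (shadow_prism v ?A) \<le> emeasure cone_measure E"
    unfolding prism(2) emeasure_cone_measure[OF E(1)]
  proof (intro nn_integral_mono)
    fix x
    have "grad x \<bullet> v \<le> norm (grad x)" if "x \<in> E"
      unfolding grad_v[OF that] using bounds(2)[OF that] by (intro mult_left_le) auto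
    then show "ennreal (real CARD('n) * (grad x \<bullet> v)) * indicator (E \<inter> K) x
        \<le> ennreal (real CARD('n) * norm (grad x)) * indicator (E \<inter> K) x"
      by (auto simp: indicator_def intro!: ennreal_leI mult_left_mono)
  qed
  then have "ennreal (?L ^ (CARD('n) - 1)) * emeasure lebesgue (shadow_prism v ?A) \<le> ennreal (?L ^ (CARD('n) - 1)) * emeasure cone_measure E"
    by (rule mult_left_mono) simp
  moreover have "hausdorff_measure (CARD('n) - 1) ?A \<le> ennreal (?L ^ (CARD('n) - 1)) * emeasure lebesgue (shadow_prism v ?A)"
    using \<epsilon>2 by (intro hausdorff_measure_le_prism[OF v bdd prism(1) _ lip]) auto
  ultimately show "hausdorff_measure (CARD('n) - 1) ?A \<le> ennreal (?L ^ (CARD('n) - 1)) * emeasure cone_measure E"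
    by (rule order_trans[rotated])
  have "ennreal (1 - \<epsilon>\<^sup>2 / 2) * emeasure cone_measure E =
      (\<integral>\<^sup>+x. ennreal (1 - \<epsilon>\<^sup>2 / 2) * (ennreal (real CARD('n) * norm (grad x)) * indicator (E \<inter> K) x) \<partial>lebesgue)"
    unfolding emeasure_cone_measure[OF E(1)]
  proof (rule nn_integral_cmult[symmetric])
    have "(\<lambda>x. ennreal (real CARD('n) * norm (grad x))) \<in> borel_measurable lebesgue"
      using grad_measurable by measurable
    then show "(\<lambda>x. ennreal (real CARD('n) * norm (grad x)) * indicator (E \<inter> K) x) \<in> borel_measurable lebesgue"
      by (intro borel_measurable_times_ennreal borel_measurable_indicator sets.Int E(1) K_lebesgue)
  qed
  also have "\<dots> \<le> (\<integral>\<^sup>+x\<in>E \<inter> K. ennreal (real CARD('n) * (grad x \<bullet> v)) \<partial>lebesgue)"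
  proof (intro nn_integral_mono)
    fix x
    have "(1 - \<epsilon>\<^sup>2 / 2) * (real CARD('n) * norm (grad x)) \<le> real CARD('n) * (grad x \<bullet> v)" if "x \<in> E"
    proof -
      have "real CARD('n) * norm (grad x) * (1 - \<epsilon>\<^sup>2 / 2) \<le> real CARD('n) * norm (grad x) * (normal x \<bullet> v)"
        using bounds(1)[OF that] by (intro mult_left_mono) auto
      then show ?thesis
        unfolding grad_v[OF that] by (simp only: mult_ac)
    qed
    then show "ennreal (1 - \<epsilon>\<^sup>2 / 2) * (ennreal (real CARD('n) * norm (grad x)) * indicator (E \<inter> K) x)
        \<le> ennreal (real CARD('n) * (grad x \<bullet> v)) * indicator (E \<inter> K) x"
      using \<epsilon>2 by (auto simp: indicator_def ennreal_mult[symmetric] intro!: ennreal_leI)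
  qed
  also have "\<dots> \<le> hausdorff_measure (CARD('n) - 1) ?A"
    using prism_le_hausdorff_measure[OF v prism(1)] unfolding prism(2) .
  finally show "ennreal (1 - \<epsilon>\<^sup>2 / 2) * emeasure cone_measure E \<le> hausdorff_measure (CARD('n) - 1) ?A" .
qed

lemma cone_pieces:
  fixes N :: nat
  assumes U: "\<And>i. U i \<in> sets borel" "\<And>i j. i \<noteq> j \<Longrightarrow> U i \<inter> U j = {}" "(\<Union>i<N. U i) = sphere 0 1"
    and \<omega>: "\<omega> \<in> sets borel" "\<omega> \<subseteq> sphere 0 1"
  shows "(\<Sum>i<N. emeasure cone_measure (cone_of_normals (\<omega> \<inter> U i))) = emeasure cone_measure (cone_of_normals \<omega>)"
proof -
  have "(\<Sum>i<N. emeasure cone_measure (cone_of_normals (\<omega> \<inter> U i))) =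
      emeasure cone_measure (\<Union>i<N. cone_of_normals (\<omega> \<inter> U i))"
  proof (rule sum_emeasure)
    show "(\<lambda>i. cone_of_normals (\<omega> \<inter> U i)) ` {..<N} \<subseteq> sets cone_measure"
      using cone_of_normals_measurable U(1) \<omega>(1) by auto
    show "disjoint_family_on (\<lambda>i. cone_of_normals (\<omega> \<inter> U i)) {..<N}"
      using U(2) by (auto simp: disjoint_family_on_def cone_of_normals_def)
  qed simp
  also have "(\<Union>i<N. cone_of_normals (\<omega> \<inter> U i)) = cone_of_normals \<omega>"
    using U(3) \<omega>(2) by (auto simp: cone_of_normals_def)
  finally show ?thesis .
qed

text \<open>
  Singular boundary points have no gradient, but the projection along \<open>v\<close> is still inverted by a
  Lipschitz map on a set of points with a normal near \<open>v\<close>, and the prism over them is null.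
\<close>

lemma hausdorff_nonsmooth_zero:
  assumes v: "norm v = 1" and \<epsilon>: "0 < \<epsilon>" "\<epsilon> < 1" and Z: "Z \<subseteq> frontier K - smooth_points"
    and near: "\<And>x. x \<in> Z \<Longrightarrow> \<exists>a. norm a = 1 \<and> norm (a - v) \<le> \<epsilon> \<and> (\<forall>y\<in>K. y \<bullet> a \<le> x \<bullet> a)"
  shows "hausdorff_measure (CARD('n) - 1) Z = 0"
proof -
  have neg: "negligible (shadow_prism v Z)"
    by (rule negligible_prism_nonsmooth[OF v Z])
  have ZK: "Z \<subseteq> K" using Z frontier_sub_K by auto
  have "\<epsilon>\<^sup>2 < 1" using \<epsilon> by (simp add: abs_square_less_1)
  then have L: "0 \<le> 1 / sqrt (1 - \<epsilon>\<^sup>2)" by simp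
  have "hausdorff_measure (CARD('n) - 1) Z \<le>
      ennreal ((1 / sqrt (1 - \<epsilon>\<^sup>2)) ^ (CARD('n) - 1)) * emeasure lebesgue (shadow_prism v Z)"
  proof (rule hausdorff_measure_le_prism[OF v _ _ L])
    show "bounded Z"
      using bounded_subset[OF compact_imp_bounded[OF compact_K] ZK] .
    show "shadow_prism v Z \<in> sets lebesgue"
      by (rule negligible_imp_sets[OF neg])
    fix x y assume xy: "x \<in> Z" "y \<in> Z"
    obtain a b where ab: "norm a = 1" "norm (a - v) \<le> \<epsilon>" "\<And>z. z \<in> K \<Longrightarrow> z \<bullet> a \<le> x \<bullet> a"
      "norm b = 1" "norm (b - v) \<le> \<epsilon>" "\<And>z. z \<in> K \<Longrightarrow> z \<bullet> b \<le> y \<bullet> b"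
      using near[OF xy(1)] near[OF xy(2)] by blast
    show "norm (x - y) \<le> 1 / sqrt (1 - \<epsilon>\<^sup>2) * norm (orth_proj v x - orth_proj v y)"
      using near_normals_lipschitz[OF v \<epsilon> _ ab(1,3,2) _ ab(4,6,5)] xy ZK by blast
  qed
  also have "emeasure lebesgue (shadow_prism v Z) = 0"
    using neg by (simp add: negligible_iff_null_sets null_setsD1)
  finally show ?thesis by simp
qed

text \<open>
  Cut the sphere into small pieces. A boundary point with normal in one of them is either singular,
  which contributes nothing, or lies on the cone of that piece.
\<close>

lemma hausdorff_reverse_image_le:
  assumes \<omega>: "\<omega> \<in> sets borel" "\<omega> \<subseteq> sphere 0 1" and \<epsilon>: "0 < \<epsilon>" "\<epsilon> < 1"
  shows "hausdorff_measure (CARD('n) - 1) (reverse_spherical_image K \<omega>) \<le>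
    ennreal ((1 / sqrt (1 - \<epsilon>\<^sup>2)) ^ (CARD('n) - 1)) * emeasure cone_measure (cone_of_normals \<omega>)"
proof -
  let ?H = "hausdorff_measure (CARD('n) - 1) :: (real ^ 'n) set \<Rightarrow> ennreal"
  let ?L = "ennreal ((1 / sqrt (1 - \<epsilon>\<^sup>2)) ^ (CARD('n) - 1))"
  obtain N :: nat and c and U :: "nat \<Rightarrow> (real ^ 'n) set" where P':
    "(\<forall>i<N. norm (c i) = 1) \<and> (\<forall>i. U i \<in> sets borel) \<and> (\<forall>i j. i \<noteq> j \<longrightarrow> U i \<inter> U j = {}) \<and>
    (\<Union>i<N. U i) = sphere 0 1 \<and> (\<forall>i. \<forall>a\<in>U i. norm (a - c i) \<le> \<epsilon>)"
    using sphere_partition[OF \<epsilon>(1), where 'a = "real ^ 'n"] by (elim exE)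
  have P: "\<And>i. i < N \<Longrightarrow> norm (c i) = 1" "\<And>i. U i \<in> sets borel" "\<And>i j. i \<noteq> j \<Longrightarrow> U i \<inter> U j = {}"
    "(\<Union>i<N. U i) = sphere 0 1" "\<And>i a. a \<in> U i \<Longrightarrow> norm (a - c i) \<le> \<epsilon>"
    using P' by auto
  have pieces: "(\<Sum>i<N. emeasure cone_measure (cone_of_normals (\<omega> \<inter> U i))) = emeasure cone_measure (cone_of_normals \<omega>)"
    by (rule cone_pieces[OF P(2) _ P(4) \<omega>]) (rule P(3))
  define Z where "Z = (\<lambda>i. {x \<in> frontier K - smooth_points. \<exists>a\<in>U i. norm a = 1 \<and> (\<forall>y\<in>K. y \<bullet> a \<le> x \<bullet> a)})"
  define A where "A = (\<lambda>i. cone_of_normals (\<omega> \<inter> U i) \<inter> frontier K)"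
  have "reverse_spherical_image K \<omega> \<subseteq> (\<Union>i<N. Z i \<union> A i)"
  proof
    fix x assume "x \<in> reverse_spherical_image K \<omega>"
    then obtain a where x: "x \<in> frontier K" and a: "a \<in> \<omega>" "norm a = 1" "\<And>y. y \<in> K \<Longrightarrow> y \<bullet> a \<le> x \<bullet> a"
      by (auto simp: reverse_spherical_image_def)
    have "a \<in> (\<Union>i<N. U i)"
      unfolding P(4) using a(2) by simp
    then obtain i where i: "i < N" "a \<in> U i" by blast
    have "x \<in> Z i \<union> A i"
    proof (cases "x \<in> smooth_points")
      case True
      have "a = normal x"
        by (rule outer_normal_unique[OF True x a(2,3)])
      then show ?thesis
        using True x a(1) i(2) by (auto simp: A_def cone_of_normals_def)
    next
      case False
      then show ?thesis
        using x a i(2) by (auto simp: Z_def)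
    qed
    then show "x \<in> (\<Union>i<N. Z i \<union> A i)"
      using i(1) by blast
  qed
  then have "?H (reverse_spherical_image K \<omega>) \<le> ?H (\<Union>i<N. Z i \<union> A i)"
    by (rule hausdorff_measure_mono)
  also have "\<dots> \<le> (\<Sum>i<N. ?H (Z i \<union> A i))"
    by (rule hausdorff_measure_UN_le) simp
  also have "\<dots> \<le> (\<Sum>i<N. ?L * emeasure cone_measure (cone_of_normals (\<omega> \<inter> U i)))"
  proof (rule sum_mono)
    fix i assume "i \<in> {..<N}"
    then have i: "i < N" by simp
    have "?H (Z i) = 0"
      by (rule hausdorff_nonsmooth_zero[OF P(1)[OF i] \<epsilon>]) (auto simp: Z_def intro: P(5))
    moreover have "?H (A i) \<le> ?L * emeasure cone_measure (cone_of_normals (\<omega> \<inter> U i))"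
      unfolding A_def
    proof (rule cone_piece_bounds(1)[OF P(1)[OF i] \<epsilon>])
      show "cone_of_normals (\<omega> \<inter> U i) \<in> sets lebesgue"
        using \<omega>(1) P(2) by (intro cone_of_normals_measurable) auto
    qed (auto simp: cone_of_normals_cone, auto simp: cone_of_normals_def intro: P(5))
    ultimately show "?H (Z i \<union> A i) \<le> ?L * emeasure cone_measure (cone_of_normals (\<omega> \<inter> U i))"
      using hausdorff_measure_Un_le[of "CARD('n) - 1" "Z i" "A i"] by (auto intro: order_trans)
  qed
  also have "\<dots> = ?L * emeasure cone_measure (cone_of_normals \<omega>)"
    unfolding sum_distrib_left[symmetric] pieces ..
  finally show ?thesis .
qed

text \<open>
  A compact subset \<open>T\<close> of \<open>E \<inter> K\<close> of almost full volume is projected radially to the boundary; the cone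
  over this compact patch contains \<open>T\<close> and is contained in \<open>E\<close>.
\<close>

lemma cone_inner_compact:
  assumes E: "E \<in> sets lebesgue" "E \<subseteq> smooth_points" "\<And>x c. x \<in> E \<Longrightarrow> 0 < c \<Longrightarrow> c *\<^sub>R x \<in> E" and e: "0 < e"
  obtains E' where "E' \<in> sets lebesgue" "E' \<subseteq> E" "\<And>x c. x \<in> E' \<Longrightarrow> 0 < c \<Longrightarrow> c *\<^sub>R x \<in> E'"
    "compact (E' \<inter> frontier K)" "emeasure cone_measure E \<le> emeasure cone_measure E' + ennreal e"
proof -
  have E0: "x \<noteq> 0" if "x \<in> E" for x using E(2) that smooth_nonzero by blast
  define e' where "e' = e * inradius / real CARD('n)"
  have e': "0 < e'" "real CARD('n) / inradius * e' = e"
    using e inradius(1) by (auto simp: e'_def)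
  have EK: "E \<inter> K \<in> sets lebesgue" using E(1) K_lebesgue by auto
  obtain T where T: "closed T" "T \<subseteq> E \<inter> K" "(E \<inter> K) - T \<in> lmeasurable" "emeasure lebesgue ((E \<inter> K) - T) < ennreal e'"
    using sets_lebesgue_inner_closed[OF EK e'(1)] by blast
  have Tc: "compact T"
    using T(1,2) compact_K by (metis Int_lower2 compact_Int_closed inf.absorb2 order_trans)
  define p where "p = (\<lambda>x. (1 / gauge x) *\<^sub>R x)"
  have p_eq: "p x = (1 / gauge x) *\<^sub>R x" for x
    by (simp add: p_def)
  have p_scale: "p (c *\<^sub>R x) = p x" if "0 < c" for c x
    using that by (simp add: p_def gauge_scale)
  have "continuous_on T p"
    unfolding p_def using T(2) E0 gauge_zero_iff by (intro continuous_intros gauge_continuous) auto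
  then have pT: "compact (p ` T)"
    using Tc by (rule compact_continuous_image)
  define E' where "E' = {x. x \<noteq> 0 \<and> p x \<in> p ` T}"
  have p_meas: "p \<in> borel_measurable borel"
    unfolding p_def by measurable
  have "E' = (p -` (p ` T) \<inter> space borel) - {0}"
    by (auto simp: E'_def)
  moreover have "(p -` (p ` T) \<inter> space borel) - {0} \<in> sets borel"
    using measurable_sets[OF p_meas, of "p ` T"] pT by (auto simp: borel_compact)
  ultimately have E'_meas: "E' \<in> sets lebesgue"
    by simp
  have E'E: "E' \<subseteq> E"
  proof
    fix x assume "x \<in> E'"
    then obtain y where y: "x \<noteq> 0" "y \<in> T" "p x = p y"
      by (auto simp: E'_def)
    have "x = gauge x *\<^sub>R p x"
      using gauge_pos[OF y(1)] by (simp add: p_def)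
    also have "\<dots> = (gauge x / gauge y) *\<^sub>R y"
      by (simp add: y(3)) (simp add: p_def)
    also have "\<dots> \<in> E"
      using y T(2) E0 gauge_pos by (intro E(3) divide_pos_pos) auto
    finally show "x \<in> E" .
  qed
  have "E' \<inter> frontier K = p ` T"
  proof safe
    fix x assume "x \<in> E'" "x \<in> frontier K"
    then show "x \<in> p ` T"
      by (simp add: E'_def frontier_K p_eq[of x])
  next
    fix x assume x: "x \<in> T"
    then have x0: "x \<noteq> 0" "0 < gauge x" using T(2) E0 gauge_pos by auto
    then have "p (p x) = p x"
      using p_scale[of "1 / gauge x" x] by (simp add: p_eq[of x])
    then show "p x \<in> E'"
      using x x0 by (auto simp: E'_def) (simp add: p_def)
    show "p x \<in> frontier K"
      using gauge_normalize[OF x0(1)] by (simp add: frontier_K p_def)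
  qed
  then have "compact (E' \<inter> frontier K)"
    using pT by simp
  moreover have "c *\<^sub>R x \<in> E'" if "x \<in> E'" "0 < c" for x c
    using that by (simp add: E'_def p_scale)
  moreover have "emeasure cone_measure E \<le> emeasure cone_measure E' + ennreal e"
  proof -
    have Tm: "T \<in> sets lebesgue" using T(1) by (simp add: borel_closed)
    have "emeasure cone_measure E = emeasure cone_measure (E \<inter> K)"
      using E(1) EK by (simp add: emeasure_cone_measure Int_assoc)
    also have "\<dots> \<le> emeasure cone_measure (T \<union> (E \<inter> K - T))"
      using EK Tm by (intro emeasure_mono) auto
    also have "\<dots> \<le> emeasure cone_measure T + emeasure cone_measure (E \<inter> K - T)"
      using EK Tm by (intro emeasure_subadditive) auto
    also have "emeasure cone_measure T \<le> emeasure cone_measure E'"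
      using T(2) E0 E'_meas by (intro emeasure_mono) (auto simp: E'_def)
    also have "emeasure cone_measure (E \<inter> K - T) \<le> ennreal (real CARD('n) / inradius) * emeasure lebesgue ((E \<inter> K - T) \<inter> K)"
      using EK Tm by (intro cone_measure_bound) auto
    also have "emeasure lebesgue ((E \<inter> K - T) \<inter> K) \<le> ennreal e'"
    proof -
      have "(E \<inter> K - T) \<inter> K = E \<inter> K - T" by auto
      then show ?thesis using T(4) by simp
    qed
    also have "ennreal (real CARD('n) / inradius) * ennreal e' = ennreal e"
      using e' inradius(1) by (subst ennreal_mult[symmetric]) auto
    finally show ?thesis
      by (simp add: add_mono mult_left_mono)
  qed
  ultimately show thesis
    using that[OF E'_meas E'E] by blast
qed

text \<open>
  Hausdorff measure enters as an outer measure that is additive over disjoint compact sets. The pieces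
  of the partition are therefore first replaced by compact patches of almost the same cone measure,
  which are disjoint.
\<close>

lemma hausdorff_reverse_image_ge:
  assumes \<omega>: "\<omega> \<in> sets borel" "\<omega> \<subseteq> sphere 0 1" and \<epsilon>: "0 < \<epsilon>" "\<epsilon> < 1"
  shows "ennreal (1 - \<epsilon>\<^sup>2 / 2) * emeasure cone_measure (cone_of_normals \<omega>) \<le>
    hausdorff_measure (CARD('n) - 1) (reverse_spherical_image K \<omega>)"
proof (rule ennreal_le_epsilon)
  fix e :: real assume e: "0 < e"
  let ?H = "hausdorff_measure (CARD('n) - 1) :: (real ^ 'n) set \<Rightarrow> ennreal"
  let ?q = "ennreal (1 - \<epsilon>\<^sup>2 / 2)"
  have \<epsilon>2: "0 \<le> 1 - \<epsilon>\<^sup>2 / 2"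
  proof -
    have "\<epsilon>\<^sup>2 < 1" using \<epsilon> by (simp add: abs_square_less_1)
    then show ?thesis by linarith
  qed
  obtain N :: nat and c and U :: "nat \<Rightarrow> (real ^ 'n) set" where P':
    "(\<forall>i<N. norm (c i) = 1) \<and> (\<forall>i. U i \<in> sets borel) \<and> (\<forall>i j. i \<noteq> j \<longrightarrow> U i \<inter> U j = {}) \<and>
    (\<Union>i<N. U i) = sphere 0 1 \<and> (\<forall>i. \<forall>a\<in>U i. norm (a - c i) \<le> \<epsilon>)"
    using sphere_partition[OF \<epsilon>(1), where 'a = "real ^ 'n"] by (elim exE)
  have P: "\<And>i. i < N \<Longrightarrow> norm (c i) = 1" "\<And>i. U i \<in> sets borel" "\<And>i j. i \<noteq> j \<Longrightarrow> U i \<inter> U j = {}"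
    "(\<Union>i<N. U i) = sphere 0 1" "\<And>i a. a \<in> U i \<Longrightarrow> norm (a - c i) \<le> \<epsilon>"
    using P' by auto
  have pieces: "(\<Sum>i<N. emeasure cone_measure (cone_of_normals (\<omega> \<inter> U i))) = emeasure cone_measure (cone_of_normals \<omega>)"
    by (rule cone_pieces[OF P(2) _ P(4) \<omega>]) (rule P(3))
  define E where "E = (\<lambda>i. cone_of_normals (\<omega> \<inter> U i))"
  have E: "E i \<in> sets lebesgue" "E i \<subseteq> smooth_points" "\<And>x c. x \<in> E i \<Longrightarrow> 0 < c \<Longrightarrow> c *\<^sub>R x \<in> E i" for i
    unfolding E_def using \<omega>(1) P(2) cone_of_normals_cone
    by (auto intro!: cone_of_normals_measurable) (auto simp: cone_of_normals_def)
  have E_near: "norm (normal x - c i) \<le> \<epsilon>" if "x \<in> E i" for x i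
    using that P(5) by (auto simp: E_def cone_of_normals_def)
  define e1 where "e1 = e / (real N + 1)"
  have e1: "0 < e1" "real N * e1 \<le> e"
    using e by (auto simp: e1_def field_simps)
  have "\<exists>F. F \<in> sets lebesgue \<and> F \<subseteq> E i \<and> (\<forall>x c. x \<in> F \<longrightarrow> 0 < c \<longrightarrow> c *\<^sub>R x \<in> F) \<and>
      compact (F \<inter> frontier K) \<and> emeasure cone_measure (E i) \<le> emeasure cone_measure F + ennreal e1" for i
  proof (rule cone_inner_compact[of "E i" e1], goal_cases)
    case (5 F)
    then show ?case by blast
  qed (use E e1(1) in auto)
  then obtain F where F: "\<And>i. F i \<in> sets lebesgue" "\<And>i. F i \<subseteq> E i" "\<And>i x c. x \<in> F i \<Longrightarrow> 0 < c \<Longrightarrow> c *\<^sub>R x \<in> F i"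
    "\<And>i. compact (F i \<inter> frontier K)" "\<And>i. emeasure cone_measure (E i) \<le> emeasure cone_measure (F i) + ennreal e1"
    by metis
  have disj: "E i \<inter> E j = {}" if "i \<noteq> j" for i j
    using P(3)[OF that] by (auto simp: E_def cone_of_normals_def)
  have "?q * emeasure cone_measure (cone_of_normals \<omega>) = (\<Sum>i<N. ?q * emeasure cone_measure (E i))"
    unfolding sum_distrib_left[symmetric] E_def pieces ..
  also have "\<dots> \<le> (\<Sum>i<N. ?H (F i \<inter> frontier K) + ennreal e1)"
  proof (rule sum_mono)
    fix i assume "i \<in> {..<N}"
    then have i: "i < N" by simp
    have "?q * emeasure cone_measure (E i) \<le> ?q * (emeasure cone_measure (F i) + ennreal e1)"
      by (intro mult_left_mono F(5)) simp
    also have "\<dots> = ?q * emeasure cone_measure (F i) + ?q * ennreal e1"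
      by (rule distrib_left)
    also have "\<dots> \<le> ?H (F i \<inter> frontier K) + ennreal e1"
    proof (rule add_mono)
      show "?q * emeasure cone_measure (F i) \<le> ?H (F i \<inter> frontier K)"
        using F(2)[of i] E(2)[of i] E_near[of _ i]
        by (intro cone_piece_bounds(2)[OF P(1)[OF i] \<epsilon> F(1) _ F(3)]) auto
      have "?q * ennreal e1 \<le> 1 * ennreal e1"
        by (intro mult_right_mono) auto
      then show "?q * ennreal e1 \<le> ennreal e1" by simp
    qed
    finally show "?q * emeasure cone_measure (E i) \<le> ?H (F i \<inter> frontier K) + ennreal e1" .
  qed
  also have "\<dots> = (\<Sum>i<N. ?H (F i \<inter> frontier K)) + ennreal (real N * e1)"
    using e1(1) by (simp add: sum.distrib ennreal_mult' ennreal_of_nat_eq_real_of_nat)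
  also have "\<dots> \<le> ?H (\<Union>i<N. F i \<inter> frontier K) + ennreal e"
  proof (rule add_mono)
    show "(\<Sum>i<N. ?H (F i \<inter> frontier K)) \<le> ?H (\<Union>i<N. F i \<inter> frontier K)"
      using F(2,4) disj by (intro hausdorff_measure_disjoint_compact) blast+
    show "ennreal (real N * e1) \<le> ennreal e"
      by (rule ennreal_leI[OF e1(2)])
  qed
  also have "?H (\<Union>i<N. F i \<inter> frontier K) \<le> ?H (reverse_spherical_image K \<omega>)"
  proof (rule hausdorff_measure_mono, safe)
    fix i x assume x: "x \<in> F i" "x \<in> frontier K"
    then have "x \<in> smooth_points" "normal x \<in> \<omega>"
      using F(2)[of i] by (auto simp: E_def cone_of_normals_def)
    then show "x \<in> reverse_spherical_image K \<omega>"
      using x(2) norm_normal normal_is_outer_normal[of x] by (auto simp: reverse_spherical_image_def)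
  qed
  finally show "?q * emeasure cone_measure (cone_of_normals \<omega>) \<le> ?H (reverse_spherical_image K \<omega>) + ennreal e"
    by (simp add: add_mono)
qed

text \<open>
  Both bounds tend to the cone measure as the pieces of the sphere shrink. In particular the set function
  defining the surface area measure is countably additive.
\<close>

proposition hausdorff_reverse_image:
  assumes \<omega>: "\<omega> \<in> sets borel" "\<omega> \<subseteq> sphere 0 1"
  shows "hausdorff_measure (CARD('n) - 1) (reverse_spherical_image K \<omega>) = emeasure cone_measure (cone_of_normals \<omega>)"
    (is "?H = ?M")
proof -
  obtain c where c: "0 \<le> c" "?M = ennreal c"
    using cone_measure_finite[OF cone_of_normals_measurable[OF \<omega>(1)]] by (cases ?M rule: ennreal_cases) auto
  define \<epsilon> where "\<epsilon> = (\<lambda>m. 1 / real (Suc (Suc m)))"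
  have \<epsilon>: "0 < \<epsilon> m" "\<epsilon> m < 1" for m
    by (auto simp: \<epsilon>_def)
  have \<epsilon>_lim: "\<epsilon> \<longlonglongrightarrow> 0"
    unfolding \<epsilon>_def using LIMSEQ_Suc[OF LIMSEQ_Suc[OF lim_1_over_n]] by simp
  have \<epsilon>2: "(\<epsilon> m)\<^sup>2 < 1" for m
    using \<epsilon>[of m] by (simp add: abs_square_less_1)
  show ?thesis
  proof (rule antisym)
    have "(\<lambda>m. ennreal ((1 / sqrt (1 - (\<epsilon> m)\<^sup>2)) ^ (CARD('n) - 1) * c)) \<longlonglongrightarrow> ennreal ((1 / sqrt (1 - 0\<^sup>2)) ^ (CARD('n) - 1) * c)"
      by (intro tendsto_intros \<epsilon>_lim) auto
    then have "(\<lambda>m. ennreal ((1 / sqrt (1 - (\<epsilon> m)\<^sup>2)) ^ (CARD('n) - 1) * c)) \<longlonglongrightarrow> ennreal c"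
      by simp
    moreover have "?H \<le> ennreal ((1 / sqrt (1 - (\<epsilon> m)\<^sup>2)) ^ (CARD('n) - 1) * c)" for m
      using hausdorff_reverse_image_le[OF \<omega> \<epsilon>[of m]] c \<epsilon>2[of m] by (subst ennreal_mult) auto
    ultimately show "?H \<le> ?M"
      unfolding c(2) by (intro LIMSEQ_le_const) auto
    have "(\<lambda>m. ennreal ((1 - (\<epsilon> m)\<^sup>2 / 2) * c)) \<longlonglongrightarrow> ennreal ((1 - 0\<^sup>2 / 2) * c)"
      by (intro tendsto_intros \<epsilon>_lim) auto
    then have "(\<lambda>m. ennreal ((1 - (\<epsilon> m)\<^sup>2 / 2) * c)) \<longlonglongrightarrow> ennreal c"
      by simp
    moreover have "ennreal ((1 - (\<epsilon> m)\<^sup>2 / 2) * c) \<le> ?H" for m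
    proof -
      have "0 \<le> 1 - (\<epsilon> m)\<^sup>2 / 2" using \<epsilon>2[of m] by linarith
      then show ?thesis
        using hausdorff_reverse_image_ge[OF \<omega> \<epsilon>[of m]] c by (subst ennreal_mult) auto
    qed
    ultimately show "?M \<le> ?H"
      unfolding c(2) by (intro LIMSEQ_le_const2) auto
  qed
qed

text \<open>
  The arbitrary unit vector at singular points keeps all values on the sphere, the space of the image
  measure.
\<close>

definition unit_normal :: "real ^ 'n \<Rightarrow> real ^ 'n" where
  "unit_normal x = (if x \<in> smooth_points then normal x else axis undefined 1)"

lemma unit_normal_measurable: "unit_normal \<in> cone_measure \<rightarrow>\<^sub>M restrict_space borel (sphere 0 1)"
proof (rule measurable_restrict_space2)
  show "unit_normal \<in> space cone_measure \<rightarrow> sphere 0 1"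
    by (auto simp: unit_normal_def norm_normal)
  have "{x \<in> space lebesgue. x \<in> smooth_points} \<in> sets lebesgue"
    using smooth_points_measurable by simp
  then have "unit_normal \<in> borel_measurable lebesgue"
    unfolding unit_normal_def using normal_measurable by (intro measurable_If) auto
  then show "unit_normal \<in> borel_measurable cone_measure"
    by (simp add: measurable_def)
qed

lemma surface_area_measure_eq:
  "surface_area_measure K = distr cone_measure (restrict_space borel (sphere 0 1)) unit_normal"
proof -
  let ?B = "restrict_space borel (sphere (0 :: real ^ 'n) 1)"
  let ?D = "distr cone_measure ?B unit_normal"
  have eq: "hausdorff_measure (CARD('n) - 1) (reverse_spherical_image K \<omega>) = emeasure ?D \<omega>"
    if \<omega>: "\<omega> \<in> sets ?B" for \<omega>
  proof -
    have \<omega>': "\<omega> \<in> sets borel" "\<omega> \<subseteq> sphere 0 1"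
      using \<omega> by (auto simp: sets_restrict_space_iff)
    have "emeasure ?D \<omega> = emeasure cone_measure (unit_normal -` \<omega> \<inter> space cone_measure)"
      by (rule emeasure_distr[OF unit_normal_measurable \<omega>])
    also have "\<dots> = emeasure cone_measure (cone_of_normals \<omega>)"
    proof (rule emeasure_eq_AE)
      have "AE x in lebesgue. x \<in> smooth_points"
        by (rule AE_smooth)
      then have "AE x in cone_measure. x \<in> smooth_points"
        unfolding cone_measure_def by (subst AE_density[OF cone_density_measurable]) auto
      then show "AE x in cone_measure. x \<in> unit_normal -` \<omega> \<inter> space cone_measure \<longleftrightarrow> x \<in> cone_of_normals \<omega>"
        by eventually_elim (auto simp: unit_normal_def cone_of_normals_def)
    qed (use measurable_sets[OF unit_normal_measurable \<omega>] cone_of_normals_measurable[OF \<omega>'(1)] in auto)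
    finally show ?thesis
      using hausdorff_reverse_image[OF \<omega>'] by simp
  qed
  have sp: "space ?B = sphere 0 1"
    by (simp add: space_restrict_space)
  have "surface_area_measure K = measure_of (space ?B) (sets ?B) (emeasure ?D)"
    unfolding surface_area_measure_def sp
  proof (rule measure_of_eq)
    show "sets ?B \<subseteq> Pow (sphere 0 1)"
      using sets.space_closed[of ?B] sp by simp
    fix \<omega> assume "\<omega> \<in> sigma_sets (sphere 0 1) (sets ?B)"
    then have "\<omega> \<in> sets ?B"
      using sets.sigma_sets_eq[of ?B] sp by simp
    then show "hausdorff_measure (CARD('n) - 1) (reverse_spherical_image K \<omega>) = emeasure ?D \<omega>"
      by (rule eq)
  qed
  also have "\<dots> = measure_of (space ?D) (sets ?D) (emeasure ?D)"
    by simp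
  also have "\<dots> = ?D"
    by (rule measure_of_of_measure)
  finally show ?thesis .
qed

text \<open>
  The quadratic form that determines both ellipsoids.
\<close>

definition grad_energy :: "real ^ 'n \<Rightarrow> real" where
  "grad_energy u = (\<integral>x. indicator K x * (u \<bullet> grad x)\<^sup>2 \<partial>lebesgue)"

lemma cone_measure_alt:
  "cone_measure = density lebesgue (\<lambda>x. ennreal (real CARD('n) * norm (grad x) * indicator K x))"
  unfolding cone_measure_def
  by (intro density_cong) (use cone_density_measurable grad_measurable K_lebesgue in \<open>auto simp: indicator_def\<close>)

text \<open>
  At \<open>\<nu> = \<nabla>g / |\<nabla>g|\<close> the factor \<open>1 / h(\<nu>) = |\<nabla>g|\<close> from the \<open>L\<^sub>2\<close> density and the factor \<open>n |\<nabla>g|\<close>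
  from the cone measure cancel the denominator of \<open>\<langle>u, \<nu>\<rangle>\<^sup>2\<close>.
\<close>

lemma L2_surface_integral:
  "(LINT v|L2_surface_area_measure K. \<bar>u \<bullet> v\<bar>\<^sup>2) = real CARD('n) * grad_energy u"
proof -
  let ?B = "restrict_space borel (sphere (0 :: real ^ 'n) 1)"
  let ?g = "\<lambda>v. (1 / supp v) *\<^sub>R \<bar>u \<bullet> v\<bar>\<^sup>2"
  have sets_S: "sets (surface_area_measure K) = sets ?B"
    by (simp add: surface_area_measure_eq)
  have m1: "(\<lambda>v. \<bar>u \<bullet> v\<bar>\<^sup>2) \<in> borel_measurable ?B" "(\<lambda>v. 1 / supp v) \<in> borel_measurable ?B"
    by (intro measurable_restrict_space1; measurable)+
  then have m2: "(\<lambda>v. \<bar>u \<bullet> v\<bar>\<^sup>2) \<in> borel_measurable (surface_area_measure K)"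
    "(\<lambda>v. 1 / supp v) \<in> borel_measurable (surface_area_measure K)"
    by (simp_all add: measurable_cong_sets[OF sets_S refl])
  have "(LINT v|L2_surface_area_measure K. \<bar>u \<bullet> v\<bar>\<^sup>2) = (LINT v|surface_area_measure K. ?g v)"
    unfolding L2_surface_area_measure_def
    by (rule integral_density[OF m2]) (simp add: supp_nonneg)
  also have "\<dots> = (LINT x|cone_measure. ?g (unit_normal x))"
    unfolding surface_area_measure_eq
    by (rule integral_distr[OF unit_normal_measurable]) (use m1 in measurable)
  also have "\<dots> = (LINT x|lebesgue. (real CARD('n) * norm (grad x) * indicator K x) *\<^sub>R ?g (unit_normal x))"
    unfolding cone_measure_alt
  proof (rule integral_density)
    have "(\<lambda>v. ?g v) \<in> borel_measurable ?B"
      using m1 by measurable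
    from measurable_compose[OF unit_normal_measurable this]
    show "(\<lambda>x. ?g (unit_normal x)) \<in> borel_measurable lebesgue"
      by (simp add: measurable_def)
    show "(\<lambda>x. real CARD('n) * norm (grad x) * indicator K x) \<in> borel_measurable lebesgue"
      using grad_measurable K_lebesgue by (intro borel_measurable_times borel_measurable_indicator) measurable
  qed simp
  also have "\<dots> = (LINT x|lebesgue. real CARD('n) * (indicator K x * (u \<bullet> grad x)\<^sup>2))"
  proof (rule integral_cong_AE)
    show "AE x in lebesgue. (real CARD('n) * norm (grad x) * indicator K x) *\<^sub>R ?g (unit_normal x)
        = real CARD('n) * (indicator K x * (u \<bullet> grad x)\<^sup>2)"
      using AE_smooth
    proof eventually_elim
      case (elim x)
      have "0 < norm (grad x)"
        using grad_nonzero[OF elim] by simp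
      then show ?case
        using elim by (simp add: unit_normal_def supp_normal) (simp add: normal_def power2_eq_square field_simps)
    qed
    have "(\<lambda>v. ?g v) \<in> borel_measurable ?B"
      using m1 by measurable
    from measurable_compose[OF unit_normal_measurable this]
    have m3: "(\<lambda>x. ?g (unit_normal x)) \<in> borel_measurable lebesgue"
      by (simp add: measurable_def)
    have m4: "(\<lambda>x. real CARD('n) * norm (grad x) * indicator K x) \<in> borel_measurable lebesgue"
      using grad_measurable K_lebesgue by (intro borel_measurable_times borel_measurable_indicator) measurable
    show "(\<lambda>x. (real CARD('n) * norm (grad x) * indicator K x) *\<^sub>R ?g (unit_normal x)) \<in> borel_measurable lebesgue"
      by (rule borel_measurable_scaleR[OF m4 m3])
    have "(\<lambda>x. (u \<bullet> grad x)\<^sup>2) \<in> borel_measurable lebesgue"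
      using grad_measurable by measurable
    then show "(\<lambda>x. real CARD('n) * (indicator K x * (u \<bullet> grad x)\<^sup>2)) \<in> borel_measurable lebesgue"
      using K_lebesgue by (intro borel_measurable_times borel_measurable_indicator borel_measurable_const)
  qed
  finally show ?thesis
    by (simp add: grad_energy_def)
qed

section \<open>Homogeneous functions and the gauge\<close>

lemma gauge_lebesgue [measurable]: "gauge \<in> borel_measurable lebesgue"
  by (intro measurable_completion) simp

lemma lebesgue_scale:
  fixes F :: "real ^ 'n \<Rightarrow> ennreal"
  assumes r: "0 < r" and F: "F \<in> borel_measurable lebesgue"
  shows "(\<integral>\<^sup>+x. F x \<partial>lebesgue) = ennreal (r ^ CARD('n)) * (\<integral>\<^sup>+x. F (r *\<^sub>R x) \<partial>lebesgue)"
proof -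
  let ?T = "\<lambda>x :: real ^ 'n. r *\<^sub>R x"
  have T: "(\<lambda>x :: real ^ 'n. 0 + (\<Sum>j\<in>Basis. (r * (x \<bullet> j)) *\<^sub>R j)) = ?T"
    by (simp add: fun_eq_iff scaleR_scaleR[symmetric] scaleR_sum_right[symmetric] euclidean_representation del: scaleR_scaleR)
  have leb: "lebesgue = density (distr lebesgue lebesgue ?T) (\<lambda>_. ennreal (r ^ CARD('n)))"
    using lebesgue_affine_euclidean[of "\<lambda>_ :: real ^ 'n. r" 0] r unfolding T by (simp add: prod_ennreal)
  have Tm: "?T \<in> lebesgue \<rightarrow>\<^sub>M lebesgue"
    using lebesgue_affine_measurable[of "\<lambda>_ :: real ^ 'n. r" 0] r unfolding T by simp
  have "(\<integral>\<^sup>+x. F x \<partial>lebesgue) = (\<integral>\<^sup>+x. F x \<partial>density (distr lebesgue lebesgue ?T) (\<lambda>_. ennreal (r ^ CARD('n))))"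
    using leb by simp
  also have "\<dots> = (\<integral>\<^sup>+x. ennreal (r ^ CARD('n)) * F x \<partial>distr lebesgue lebesgue ?T)"
    using F by (intro nn_integral_density) auto
  also have "\<dots> = (\<integral>\<^sup>+x. ennreal (r ^ CARD('n)) * F (r *\<^sub>R x) \<partial>lebesgue)"
    using F by (intro nn_integral_distr Tm) auto
  also have "\<dots> = ennreal (r ^ CARD('n)) * (\<integral>\<^sup>+x. F (r *\<^sub>R x) \<partial>lebesgue)"
    using measurable_compose[OF Tm F] by (intro nn_integral_cmult)
  finally show ?thesis .
qed

definition gauge_distribution :: "(real ^ 'n \<Rightarrow> real) \<Rightarrow> real measure" where
  "gauge_distribution G = distr (density lebesgue (\<lambda>x. ennreal (G x))) borel gauge"

text \<open>
  The sublevel set is the dilate \<open>r K\<close>, and \<open>G\<close> does not change under dilation.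
\<close>

lemma gauge_distribution_atMost:
  assumes G: "G \<in> borel_measurable lebesgue"
    and hom: "\<And>x c. x \<in> smooth_points \<Longrightarrow> 0 < c \<Longrightarrow> G (c *\<^sub>R x) = G x"
  shows "emeasure (gauge_distribution G) {..r} = ennreal (max 0 r ^ CARD('n)) * (\<integral>\<^sup>+x\<in>K. ennreal (G x) \<partial>lebesgue)"
proof -
  have "emeasure (gauge_distribution G) {..r} = emeasure (density lebesgue (\<lambda>x. ennreal (G x))) {x. gauge x \<le> r}"
    unfolding gauge_distribution_def by (subst emeasure_distr) (auto simp: vimage_def)
  also have "\<dots> = (\<integral>\<^sup>+x. ennreal (G x) * indicator {x. gauge x \<le> r} x \<partial>lebesgue)"
    using G by (intro emeasure_density) auto
  also have "\<dots> = ennreal (max 0 r ^ CARD('n)) * (\<integral>\<^sup>+x\<in>K. ennreal (G x) \<partial>lebesgue)"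
  proof (cases "0 < r")
    case True
    have "(\<integral>\<^sup>+x. ennreal (G x) * indicator {x. gauge x \<le> r} x \<partial>lebesgue) =
        ennreal (r ^ CARD('n)) * (\<integral>\<^sup>+x. ennreal (G (r *\<^sub>R x)) * indicator {x. gauge x \<le> r} (r *\<^sub>R x) \<partial>lebesgue)"
      using G by (intro lebesgue_scale True borel_measurable_times_ennreal borel_measurable_indicator) auto
    also have "(\<integral>\<^sup>+x. ennreal (G (r *\<^sub>R x)) * indicator {x. gauge x \<le> r} (r *\<^sub>R x) \<partial>lebesgue) = (\<integral>\<^sup>+x\<in>K. ennreal (G x) \<partial>lebesgue)"
    proof (rule nn_integral_cong_AE)
      show "AE x in lebesgue. ennreal (G (r *\<^sub>R x)) * indicator {x. gauge x \<le> r} (r *\<^sub>R x) = ennreal (G x) * indicator K x"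
        using AE_smooth
      proof eventually_elim
        case (elim x)
        have "gauge (r *\<^sub>R x) \<le> r \<longleftrightarrow> x \<in> K"
          using True by (simp add: gauge_scale in_K_iff)
        then show ?case
          using hom[OF elim True] by (simp add: indicator_def)
      qed
    qed
    finally show ?thesis
      using True by simp
  next
    case False
    have "AE x in lebesgue. ennreal (G x) * indicator {x. gauge x \<le> r} x = 0"
      using AE_smooth
    proof eventually_elim
      case (elim x)
      then show ?case
        using gauge_pos[OF smooth_nonzero[OF elim]] False by (simp add: indicator_def)
    qed
    then have "(\<integral>\<^sup>+x. ennreal (G x) * indicator {x. gauge x \<le> r} x \<partial>lebesgue) = (\<integral>\<^sup>+x. 0 \<partial>(lebesgue :: (real ^ 'n) measure))"
      by (rule nn_integral_cong_AE)
    then show ?thesis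
      using False by (simp add: max_def)
  qed
  finally show ?thesis .
qed

text \<open>
  The distributions of the gauge under the densities \<open>G\<close> and \<open>1\<close> both give mass proportional to \<open>r\<^sup>n\<close> to
  \<open>{..r}\<close>, so they are proportional, and so are the integrals of any function of the gauge.
\<close>

lemma homogeneous_average:
  fixes F :: "real \<Rightarrow> real"
  assumes G: "G \<in> borel_measurable lebesgue" "\<And>x. 0 \<le> G x"
    and hom: "\<And>x c. x \<in> smooth_points \<Longrightarrow> 0 < c \<Longrightarrow> G (c *\<^sub>R x) = G x"
    and fin: "(\<integral>\<^sup>+x\<in>K. ennreal (G x) \<partial>lebesgue) < \<infinity>" and F: "F \<in> borel_measurable borel" "\<And>s. 0 \<le> F s"
  shows "emeasure lebesgue K * (\<integral>\<^sup>+x. ennreal (F (gauge x) * G x) \<partial>lebesgue) =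
    (\<integral>\<^sup>+x\<in>K. ennreal (G x) \<partial>lebesgue) * (\<integral>\<^sup>+x. ennreal (F (gauge x)) \<partial>lebesgue)"
proof -
  let ?I = "\<integral>\<^sup>+x\<in>K. ennreal (G x) \<partial>lebesgue"
  have V: "(\<integral>\<^sup>+x\<in>K. ennreal 1 \<partial>lebesgue) = emeasure lebesgue K"
    using K_lebesgue by simp
  have V_fin: "emeasure lebesgue K < \<infinity>"
    using lmeasurable_compact[OF compact_K] unfolding fmeasurable_def by blast
  have at1: "emeasure (gauge_distribution (\<lambda>_. 1)) {..r} = ennreal (max 0 r ^ CARD('n)) * emeasure lebesgue K" for r
    using gauge_distribution_atMost[of "\<lambda>_. 1" r] unfolding V by simp
  have atG: "emeasure (gauge_distribution G) {..r} = ennreal (max 0 r ^ CARD('n)) * ?I" for r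
    by (rule gauge_distribution_atMost[OF G(1) hom])
  have eq: "scale_measure (emeasure lebesgue K) (gauge_distribution G) = scale_measure ?I (gauge_distribution (\<lambda>_. 1))"
  proof (rule measure_eqI_generator_eq[where E = "range (\<lambda>a::real. {..a})" and A = "\<lambda>i. {..real i}" and \<Omega> = UNIV])
    show "Int_stable (range (\<lambda>a::real. {..a}))"
      by (auto simp: Int_stable_def)
    have b: "sets borel = sigma_sets UNIV (range (\<lambda>a::real. {..a}))"
      by (subst borel_eq_atMost) simp
    show "sets (scale_measure (emeasure lebesgue K) (gauge_distribution G)) = sigma_sets UNIV (range (\<lambda>a::real. {..a}))"
      "sets (scale_measure ?I (gauge_distribution (\<lambda>_. 1))) = sigma_sets UNIV (range (\<lambda>a::real. {..a}))"
      unfolding b[symmetric] by (simp_all add: gauge_distribution_def)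
    show "emeasure (scale_measure (emeasure lebesgue K) (gauge_distribution G)) X = emeasure (scale_measure ?I (gauge_distribution (\<lambda>_. 1))) X"
      if "X \<in> range (\<lambda>a::real. {..a})" for X
      using that by (auto simp: at1 atG mult_ac)
    show "emeasure (scale_measure (emeasure lebesgue K) (gauge_distribution G)) {..real i} \<noteq> \<infinity>" for i
      using V_fin fin by (simp add: atG ennreal_mult_eq_top_iff less_top)
    show "(\<Union>i. {..real i}) = UNIV"
      using real_arch_simple by blast
  qed auto
  have Fg: "(\<lambda>x. ennreal (F (gauge x))) \<in> borel_measurable lebesgue"
    using F(1) by measurable
  have int: "(\<integral>\<^sup>+s. ennreal (F s) \<partial>gauge_distribution H) = (\<integral>\<^sup>+x. ennreal (F (gauge x) * H x) \<partial>lebesgue)"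
    if H: "H \<in> borel_measurable lebesgue" "\<And>x. 0 \<le> H x" for H
  proof -
    have "(\<integral>\<^sup>+s. ennreal (F s) \<partial>gauge_distribution H) = (\<integral>\<^sup>+x. ennreal (F (gauge x)) \<partial>density lebesgue (\<lambda>x. ennreal (H x)))"
      unfolding gauge_distribution_def using F(1) by (intro nn_integral_distr) auto
    also have "\<dots> = (\<integral>\<^sup>+x. ennreal (H x) * ennreal (F (gauge x)) \<partial>lebesgue)"
      using H(1) Fg by (intro nn_integral_density) auto
    also have "\<dots> = (\<integral>\<^sup>+x. ennreal (F (gauge x) * H x) \<partial>lebesgue)"
      using H(2) F(2) by (intro nn_integral_cong) (simp add: ennreal_mult mult.commute)
    finally show ?thesis .
  qed
  have scale: "(\<integral>\<^sup>+s. ennreal (F s) \<partial>scale_measure a (gauge_distribution H)) = a * (\<integral>\<^sup>+s. ennreal (F s) \<partial>gauge_distribution H)" for a H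
    using F(1) by (intro nn_integral_scale_measure) (simp add: gauge_distribution_def)
  show ?thesis
    using scale[of "emeasure lebesgue K" G] scale[of ?I "\<lambda>_. 1"] int[OF G] int[of "\<lambda>_. 1"] unfolding eq by simp
qed

text \<open>
  Comparison with \<open>1 / (1 + a t\<^sup>2)\<close>, whose antiderivative is an arctangent.
\<close>

lemma nn_integral_exp_square_finite:
  fixes a :: real
  assumes a: "0 < a"
  shows "(\<integral>\<^sup>+t. ennreal (exp (- (a * t\<^sup>2))) \<partial>lborel) < \<infinity>"
proof -
  let ?h = "\<lambda>t :: real. 1 / (1 + a * t\<^sup>2)"
  have pos: "0 < 1 + a * t\<^sup>2" for t
    using a by (intro add_pos_nonneg) auto
  have half: "(\<integral>\<^sup>+t. ennreal (?h t) * indicator {0..} t \<partial>lborel) = ennreal (pi / 2 / sqrt a - arctan (sqrt a * 0) / sqrt a)"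
  proof (rule nn_integral_FTC_atLeast)
    show "DERIV (\<lambda>t. arctan (sqrt a * t) / sqrt a) t :> ?h t" for t
      using a by (auto intro!: derivative_eq_intros simp: power_mult_distrib inverse_eq_divide)
    have "filterlim (\<lambda>t. sqrt a * t) at_top at_top"
      using a by (intro filterlim_tendsto_pos_mult_at_top[OF tendsto_const]) (auto simp: filterlim_ident)
    then show "((\<lambda>t. arctan (sqrt a * t) / sqrt a) \<longlongrightarrow> pi / 2 / sqrt a) at_top"
      using a by (intro tendsto_divide filterlim_compose[OF tendsto_arctan_at_top] tendsto_const) auto
  qed (use pos in \<open>auto intro: less_imp_le\<close>)
  have other: "(\<integral>\<^sup>+t. ennreal (?h t) * indicator {..0} t \<partial>lborel) = (\<integral>\<^sup>+t. ennreal (?h t) * indicator {0..} t \<partial>lborel)"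
    by (subst nn_integral_real_affine[where c = "-1" and t = 0]) (auto intro!: nn_integral_cong simp: indicator_def)
  have "(\<integral>\<^sup>+t. ennreal (exp (- (a * t\<^sup>2))) \<partial>lborel) \<le>
      (\<integral>\<^sup>+t. ennreal (?h t) * indicator {0..} t + ennreal (?h t) * indicator {..0} t \<partial>lborel)"
  proof (intro nn_integral_mono)
    fix t :: real
    have "1 + a * t\<^sup>2 \<le> exp (a * t\<^sup>2)"
      by (rule exp_ge_add_one_self)
    then have "exp (- (a * t\<^sup>2)) \<le> ?h t"
      using pos[of t] by (simp add: exp_minus inverse_eq_divide frac_le)
    then have "ennreal (exp (- (a * t\<^sup>2))) \<le> ennreal (?h t)"
      by (rule ennreal_leI)
    then show "ennreal (exp (- (a * t\<^sup>2))) \<le> ennreal (?h t) * indicator {0..} t + ennreal (?h t) * indicator {..0} t"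
      by (cases "0 \<le> t") (auto simp: indicator_def add_increasing2)
  qed
  also have "\<dots> = (\<integral>\<^sup>+t. ennreal (?h t) * indicator {0..} t \<partial>lborel) + (\<integral>\<^sup>+t. ennreal (?h t) * indicator {..0} t \<partial>lborel)"
    by (intro nn_integral_add) auto
  also have "\<dots> < \<infinity>"
    unfolding other half by (simp add: ennreal_less_top)
  finally show ?thesis .
qed

text \<open>
  The gauge dominates a multiple of the Euclidean norm, so the integral is bounded by a product of
  one-dimensional Gaussian integrals.
\<close>

lemma gaussian_mass_finite: "(\<integral>\<^sup>+x. ennreal (exp (- ((gauge x)\<^sup>2 / 2))) \<partial>lebesgue) < \<infinity>"
proof -
  define a where "a = 1 / (2 * outradius\<^sup>2)"
  have a: "0 < a" using outradius(1) by (simp add: a_def)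
  have "(\<integral>\<^sup>+x. ennreal (exp (- ((gauge x)\<^sup>2 / 2))) \<partial>lebesgue) = (\<integral>\<^sup>+x. ennreal (exp (- ((gauge x)\<^sup>2 / 2))) \<partial>lborel)"
    by (rule nn_integral_completion)
  also have "\<dots> \<le> (\<integral>\<^sup>+x. (\<Prod>b\<in>Basis. ennreal (exp (- (a * (x \<bullet> b)\<^sup>2)))) \<partial>(lborel :: (real ^ 'n) measure))"
  proof (intro nn_integral_mono)
    fix x :: "real ^ 'n"
    have "(norm x)\<^sup>2 \<le> (outradius * gauge x)\<^sup>2"
      using norm_le_gauge[of x] by (intro power_mono) auto
    then have "a * (norm x)\<^sup>2 \<le> (gauge x)\<^sup>2 / 2"
      using outradius(1) by (simp add: a_def power_mult_distrib field_simps)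
    moreover have "(norm x)\<^sup>2 = (\<Sum>b\<in>Basis. (x \<bullet> b)\<^sup>2)"
      by (simp add: norm_eq_sqrt_inner euclidean_inner[of x x] power2_eq_square sum_nonneg)
    ultimately have "exp (- ((gauge x)\<^sup>2 / 2)) \<le> exp (\<Sum>b\<in>Basis. - (a * (x \<bullet> b)\<^sup>2))"
      by (simp add: sum_negf sum_distrib_left[symmetric])
    also have "\<dots> = (\<Prod>b\<in>Basis. exp (- (a * (x \<bullet> b)\<^sup>2)))"
      by (simp add: exp_sum)
    finally show "ennreal (exp (- ((gauge x)\<^sup>2 / 2))) \<le> (\<Prod>b\<in>Basis. ennreal (exp (- (a * (x \<bullet> b)\<^sup>2))))"
      by (simp add: prod_ennreal ennreal_leI)
  qed
  also have "\<dots> = (\<Prod>b\<in>(Basis :: (real ^ 'n) set). \<integral>\<^sup>+t. ennreal (exp (- (a * t\<^sup>2))) \<partial>lborel)"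
    by (rule nn_integral_lborel_prod) auto
  also have "\<dots> < \<infinity>"
    using nn_integral_exp_square_finite[OF a] by (simp add: ennreal_prod_eq_top power_less_top_ennreal)
  finally show ?thesis .
qed

end

section \<open>Ellipsoids\<close>

lemma quadratic_scale:
  fixes A :: "real ^ 'n ^ 'n"
  shows "(t *\<^sub>R x) \<bullet> (A *v (t *\<^sub>R x)) = t\<^sup>2 * (x \<bullet> (A *v x))"
  by (simp add: matrix_vector_mult_scaleR power2_eq_square)

lemma radial_function_ellipsoid:
  fixes A :: "real ^ 'n ^ 'n"
  assumes pos: "0 < u \<bullet> (A *v u)"
  shows "1 / (radial_function {x. x \<bullet> (A *v x) \<le> 1} u)\<^sup>2 = u \<bullet> (A *v u)"
proof -
  let ?q = "u \<bullet> (A *v u)"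
  have "{t. 0 \<le> t \<and> t *\<^sub>R u \<in> {x. x \<bullet> (A *v x) \<le> 1}} = {0 .. 1 / sqrt ?q}"
  proof -
    have "t\<^sup>2 * ?q \<le> 1 \<longleftrightarrow> t \<le> 1 / sqrt ?q" if "0 \<le> t" for t
    proof -
      have "t\<^sup>2 * ?q \<le> 1 \<longleftrightarrow> (t * sqrt ?q)\<^sup>2 \<le> 1\<^sup>2"
        using pos by (simp add: power_mult_distrib)
      also have "\<dots> \<longleftrightarrow> t * sqrt ?q \<le> 1"
        using that pos by (intro power_mono_iff) auto
      finally show ?thesis
        using pos by (simp add: field_simps)
    qed
    then show ?thesis
      unfolding mem_Collect_eq quadratic_scale by auto
  qed
  then have "radial_function {x. x \<bullet> (A *v x) \<le> 1} u = 1 / sqrt ?q"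
    using pos by (simp add: radial_function_def)
  then show ?thesis
    using pos by (simp add: power_divide)
qed

lemma minkowski_functional_ellipsoid:
  fixes A :: "real ^ 'n ^ 'n"
  assumes pos: "\<And>x. x \<noteq> 0 \<Longrightarrow> 0 < x \<bullet> (A *v x)"
  shows "(minkowski_functional {x. x \<bullet> (A *v x) \<le> 1} x)\<^sup>2 = x \<bullet> (A *v x)"
proof -
  let ?q = "x \<bullet> (A *v x)" and ?E = "{x. x \<bullet> (A *v x) \<le> 1}"
  have q0: "0 \<le> ?q"
    using pos[of x] by (cases "x = 0") auto
  have mem: "x \<in> (\<lambda>y. t *\<^sub>R y) ` ?E \<longleftrightarrow> sqrt ?q \<le> t" if t: "0 \<le> t" for t
  proof (cases "t = 0")
    case True
    have "x \<in> (\<lambda>y. 0 *\<^sub>R y) ` ?E \<longleftrightarrow> x = 0"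
      by (auto simp: image_iff intro!: exI[of _ 0])
    also have "\<dots> \<longleftrightarrow> sqrt ?q \<le> 0"
      using pos[of x] q0 by (cases "x = 0") auto
    finally show ?thesis
      using True by simp
  next
    case False
    then have t: "0 < t" using t by simp
    have "x \<in> (\<lambda>y. t *\<^sub>R y) ` ?E \<longleftrightarrow> (1 / t) *\<^sub>R x \<in> ?E"
      using t by (auto intro!: image_eqI[of _ _ "(1 / t) *\<^sub>R x"])
    also have "\<dots> \<longleftrightarrow> (1 / t)\<^sup>2 * ?q \<le> 1"
      unfolding mem_Collect_eq quadratic_scale ..
    also have "\<dots> \<longleftrightarrow> ?q \<le> t\<^sup>2"
      using t by (simp add: power_one_over divide_le_eq)
    also have "\<dots> \<longleftrightarrow> sqrt ?q \<le> t"
      using t by (metis less_imp_le real_sqrt_le_iff real_sqrt_unique sqrt_le_D)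
    finally show ?thesis .
  qed
  have "{t. 0 \<le> t \<and> x \<in> (\<lambda>y. t *\<^sub>R y) ` ?E} = {sqrt ?q..}"
    using mem q0 by (auto intro: order_trans[OF real_sqrt_ge_zero])
  then have "minkowski_functional ?E x = sqrt ?q"
    by (simp add: minkowski_functional_def)
  then show ?thesis
    using q0 by simp
qed

text \<open>
  On unit vectors \<open>1 / \<rho>\<^sup>2\<close> is the value of the quadratic form, which is determined by those values.
\<close>

lemma centered_ellipsoid_unique:
  fixes E E' :: "(real ^ 'n) set"
  assumes E: "centered_ellipsoid E" and E': "centered_ellipsoid E'"
    and radial: "\<And>u. u \<in> sphere 0 1 \<Longrightarrow> 1 / (radial_function E u)\<^sup>2 = 1 / (radial_function E' u)\<^sup>2"
  shows "E = E'"
proof -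
  obtain A where A: "\<And>x. x \<noteq> 0 \<Longrightarrow> 0 < x \<bullet> (A *v x)" "E = {x. x \<bullet> (A *v x) \<le> 1}"
    using E by (auto simp: centered_ellipsoid_def)
  obtain B where B: "\<And>x. x \<noteq> 0 \<Longrightarrow> 0 < x \<bullet> (B *v x)" "E' = {x. x \<bullet> (B *v x) \<le> 1}"
    using E' by (auto simp: centered_ellipsoid_def)
  have "x \<bullet> (A *v x) = x \<bullet> (B *v x)" for x
  proof (cases "x = 0")
    case False
    define u where "u = (1 / norm x) *\<^sub>R x"
    have u: "u \<in> sphere 0 1" "x = norm x *\<^sub>R u" "u \<noteq> 0"
      using False by (auto simp: u_def)
    have "u \<bullet> (A *v u) = u \<bullet> (B *v u)"
      using radial[OF u(1)] unfolding A(2) B(2)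
      by (simp add: radial_function_ellipsoid A(1)[OF u(3)] B(1)[OF u(3)])
    then show ?thesis
      using quadratic_scale[of "norm x" u A] quadratic_scale[of "norm x" u B] u(2) by simp
  qed simp
  then show ?thesis
    unfolding A(2) B(2) by simp
qed

context cart_body
begin

lemma K_finite: "emeasure lebesgue K < \<infinity>"
  using lmeasurable_compact[OF compact_K] unfolding fmeasurable_def by blast

lemma K_volume_pos: "0 < measure lebesgue K"
proof -
  have "0 < measure lebesgue (ball (0 :: real ^ 'n) inradius)"
    using content_ball_pos[OF inradius(1), of "0 :: real ^ 'n"] by simp
  also have "\<dots> \<le> measure lebesgue K"
    using inradius(2) lmeasurable_compact[OF compact_K] by (intro measure_mono_fmeasurable) auto
  finally show ?thesis .
qed

lemma grad_inner_bound:
  assumes "x \<in> smooth_points"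
  shows "\<bar>u \<bullet> grad x\<bar> \<le> norm u / inradius"
proof -
  have "\<bar>u \<bullet> grad x\<bar> \<le> norm u * norm (grad x)"
    by (rule Cauchy_Schwarz_ineq2)
  also have "\<dots> \<le> norm u * (1 / inradius)"
    by (intro mult_left_mono norm_grad_le assms) auto
  finally show ?thesis by simp
qed

lemma inner_grad_measurable: "(\<lambda>x. u \<bullet> grad x) \<in> borel_measurable lebesgue"
  using grad_measurable by measurable

lemma energy_integrable: "integrable lebesgue (\<lambda>x. indicator K x * ((u \<bullet> grad x) * (w \<bullet> grad x)))"
proof -
  have "integrable lebesgue (\<lambda>x. indicator K x *\<^sub>R ((u \<bullet> grad x) * (w \<bullet> grad x)))"
  proof (rule integrableI_bounded_set_indicator[where B = "norm u / inradius * (norm w / inradius)"])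
    show "AE x in lebesgue. x \<in> K \<longrightarrow> norm ((u \<bullet> grad x) * (w \<bullet> grad x)) \<le> norm u / inradius * (norm w / inradius)"
      using AE_smooth
    proof eventually_elim
      case (elim x)
      show ?case
        unfolding real_norm_def abs_mult
        by (intro impI mult_mono grad_inner_bound elim) (use inradius(1) in auto)
    qed
    show "(\<lambda>x. (u \<bullet> grad x) * (w \<bullet> grad x)) \<in> borel_measurable lebesgue"
      by (intro borel_measurable_times inner_grad_measurable)
  qed (use K_lebesgue K_finite in auto)
  then show ?thesis by simp
qed

definition LYZ_matrix :: "real ^ 'n ^ 'n" where
  "LYZ_matrix = (\<chi> i j. real CARD('n) / measure lebesgue K *
     (\<integral>x. indicator K x * ((axis i 1 \<bullet> grad x) * (axis j 1 \<bullet> grad x)) \<partial>lebesgue))"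

lemma LYZ_matrix_quadratic:
  "u \<bullet> (LYZ_matrix *v u) = real CARD('n) / measure lebesgue K * grad_energy u"
proof -
  let ?c = "real CARD('n) / measure lebesgue K"
  let ?m = "\<lambda>i j x. indicator K x * ((axis i 1 \<bullet> grad x) * (axis j 1 \<bullet> grad x)) :: real"
  have "grad_energy u = (\<integral>x. (\<Sum>i\<in>UNIV. \<Sum>j\<in>UNIV. (u $ i * u $ j) * ?m i j x) \<partial>lebesgue)"
    unfolding grad_energy_def
  proof (intro Bochner_Integration.integral_cong refl)
    fix x
    have "(u \<bullet> grad x)\<^sup>2 = (\<Sum>i\<in>UNIV. \<Sum>j\<in>UNIV. (u $ i * grad x $ i) * (u $ j * grad x $ j))"
      by (simp add: inner_vec_def power2_eq_square sum_product)
    then show "indicator K x * (u \<bullet> grad x)\<^sup>2 = (\<Sum>i\<in>UNIV. \<Sum>j\<in>UNIV. (u $ i * u $ j) * ?m i j x)"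
      by (simp add: sum_distrib_left inner_axis' mult_ac)
  qed
  also have "\<dots> = (\<Sum>i\<in>UNIV. \<Sum>j\<in>UNIV. (u $ i * u $ j) * (\<integral>x. ?m i j x \<partial>lebesgue))"
    by (subst Bochner_Integration.integral_sum, intro Bochner_Integration.integrable_sum integrable_mult_right energy_integrable)
      (intro sum.cong refl, subst Bochner_Integration.integral_sum,
        auto intro!: integrable_mult_right energy_integrable)
  finally show ?thesis
    by (simp add: inner_vec_def matrix_vector_mult_def LYZ_matrix_def sum_distrib_left mult_ac)
qed

lemma grad_energy_scale: "grad_energy (t *\<^sub>R u) = t\<^sup>2 * grad_energy u"
proof -
  have eq: "(indicator K x * ((t *\<^sub>R u) \<bullet> grad x)\<^sup>2 :: real) = t\<^sup>2 * (indicator K x * (u \<bullet> grad x)\<^sup>2)" for x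
    by (simp add: power_mult_distrib mult_ac)
  then show ?thesis
    unfolding grad_energy_def eq by simp
qed

text \<open>
  By Euler's identity \<open>\<langle>w, \<nabla>g(w)\<rangle> = g w\<close>. Scale \<open>u\<close> to a point \<open>w\<close> with \<open>g w = 1 / 2\<close>. On
  the ball around \<open>w\<close> with radius \<open>inradius / 8\<close>, which lies in \<open>K\<close>, both \<open>g x - g w\<close> and
  \<open>\<langle>x - w, \<nabla>g(x)\<rangle>\<close> are at most \<open>1 / 8\<close> in absolute value, so \<open>\<langle>w, \<nabla>g(x)\<rangle> \<ge> 1 / 4\<close> there.
\<close>

lemma grad_energy_pos:
  assumes u: "u \<noteq> 0"
  shows "0 < grad_energy u"
proof -
  define t where "t = 1 / (2 * gauge u)"
  define w where "w = t *\<^sub>R u"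
  have g: "0 < gauge u" using u by (rule gauge_pos)
  have t: "0 < t" using g by (simp add: t_def)
  have gw: "gauge w = 1 / 2"
    using t g by (simp add: w_def gauge_scale t_def)
  define \<rho> where "\<rho> = inradius / 8"
  have \<rho>: "0 < \<rho>" "\<rho> / inradius = 1 / 8"
    using inradius(1) by (auto simp: \<rho>_def)
  have near: "\<bar>gauge x - gauge w\<bar> \<le> 1 / 8" if "x \<in> ball w \<rho>" for x
  proof -
    have "norm (x - w) \<le> \<rho>"
      using that by (simp add: dist_norm norm_minus_commute)
    then have "norm (x - w) / inradius \<le> \<rho> / inradius"
      using inradius(1) by (intro divide_right_mono) auto
    then show ?thesis
      using gauge_lipschitz[of x w] \<rho>(2) by simp
  qed
  have lower: "1 / 16 \<le> (w \<bullet> grad x)\<^sup>2" if x: "x \<in> ball w \<rho>" "x \<in> smooth_points" for x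
  proof -
    have "\<bar>(x - w) \<bullet> grad x\<bar> \<le> norm (x - w) / inradius"
      by (rule grad_inner_bound[OF x(2)])
    also have "\<dots> \<le> \<rho> / inradius"
      using x(1) inradius(1) by (intro divide_right_mono) (auto simp: dist_norm norm_minus_commute)
    finally have "(x - w) \<bullet> grad x \<le> 1 / 8"
      using \<rho>(2) by simp
    then have "gauge x - 1 / 8 \<le> w \<bullet> grad x"
      using inner_grad_self[OF x(2)] by (simp add: inner_diff_left)
    moreover have "3 / 8 \<le> gauge x"
      using near[OF x(1)] gw by linarith
    ultimately have "1 / 4 \<le> w \<bullet> grad x"
      by linarith
    then have "(1 / 4)\<^sup>2 \<le> (w \<bullet> grad x)\<^sup>2"
      by (intro power_mono) auto
    then show ?thesis by (simp add: power2_eq_square)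
  qed
  have ball_K: "ball w \<rho> \<subseteq> K"
  proof
    fix x assume "x \<in> ball w \<rho>"
    then show "x \<in> K"
      using near[of x] gw unfolding in_K_iff by linarith
  qed
  have "0 < measure lebesgue (ball w \<rho>) * (1 / 16)"
    using content_ball_pos[OF \<rho>(1), of w] by simp
  also have "\<dots> = (\<integral>x. indicator (ball w \<rho>) x * (1 / 16) \<partial>lebesgue)"
    by simp
  also have "\<dots> \<le> grad_energy w"
    unfolding grad_energy_def
  proof (rule integral_mono_AE)
    show "integrable lebesgue (\<lambda>x. indicator (ball w \<rho>) x * (1 / 16) :: real)"
      using emeasure_bounded_finite[OF bounded_ball, of w \<rho>]
      by (intro integrable_mult_left integrable_real_indicator) auto
    show "integrable lebesgue (\<lambda>x. indicator K x * (w \<bullet> grad x)\<^sup>2)"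
      using energy_integrable[of w w] by (simp add: power2_eq_square)
    show "AE x in lebesgue. indicator (ball w \<rho>) x * (1 / 16) \<le> indicator K x * (w \<bullet> grad x)\<^sup>2"
      using AE_smooth
    proof eventually_elim
      case (elim x)
      then show ?case
        using lower[OF _ elim] ball_K by (auto simp: indicator_def)
    qed
  qed
  finally have "0 < t\<^sup>2 * grad_energy u"
    by (simp add: w_def grad_energy_scale)
  then show ?thesis
    using t by (simp add: zero_less_mult_iff)
qed

text \<open>
  The matrix of the form defines an ellipsoid with the prescribed radial function, and there is only one
  such ellipsoid.
\<close>

lemma LYZ_ellipsoid_eq: "LYZ_ellipsoid K = {x. x \<bullet> (LYZ_matrix *v x) \<le> 1}"
proof -
  let ?E = "{x. x \<bullet> (LYZ_matrix *v x) \<le> 1}"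
  let ?P = "\<lambda>E. centered_ellipsoid E \<and> (\<forall>u\<in>sphere 0 1. 1 / (radial_function E u)\<^sup>2 =
           1 / measure lebesgue K * (LINT v|L2_surface_area_measure K. \<bar>u \<bullet> v\<bar>\<^sup>2))"
  have pos: "0 < x \<bullet> (LYZ_matrix *v x)" if "x \<noteq> 0" for x
    unfolding LYZ_matrix_quadratic using grad_energy_pos[OF that] K_volume_pos by simp
  have "transpose LYZ_matrix = LYZ_matrix"
    by (simp add: transpose_def LYZ_matrix_def vec_eq_iff mult.commute)
  then have ell: "centered_ellipsoid ?E"
    unfolding centered_ellipsoid_def using pos by blast
  have radial: "1 / (radial_function ?E u)\<^sup>2 =
      1 / measure lebesgue K * (LINT v|L2_surface_area_measure K. \<bar>u \<bullet> v\<bar>\<^sup>2)" if u: "u \<in> sphere 0 1" for u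
  proof -
    have "u \<noteq> 0" using u by auto
    then have "1 / (radial_function ?E u)\<^sup>2 = u \<bullet> (LYZ_matrix *v u)"
      by (rule radial_function_ellipsoid[OF pos])
    also have "\<dots> = 1 / measure lebesgue K * (LINT v|L2_surface_area_measure K. \<bar>u \<bullet> v\<bar>\<^sup>2)"
      unfolding LYZ_matrix_quadratic L2_surface_integral by simp
    finally show ?thesis .
  qed
  show ?thesis
    unfolding LYZ_ellipsoid_def
  proof (rule the_equality)
    show "?P ?E"
      using ell radial by blast
    fix E assume E: "?P E"
    show "E = ?E"
    proof (rule centered_ellipsoid_unique[OF _ ell])
      show "centered_ellipsoid E" using E by blast
      show "1 / (radial_function E u)\<^sup>2 = 1 / (radial_function ?E u)\<^sup>2" if "u \<in> sphere 0 1" for u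
        using E radial[OF that] that by simp
    qed
  qed
qed

lemma minkowski_functional_LYZ_ellipsoid:
  "(minkowski_functional (LYZ_ellipsoid K) u)\<^sup>2 = real CARD('n) / measure lebesgue K * grad_energy u"
proof -
  have "0 < x \<bullet> (LYZ_matrix *v x)" if "x \<noteq> 0" for x
    unfolding LYZ_matrix_quadratic using grad_energy_pos[OF that] K_volume_pos by simp
  then show ?thesis
    unfolding LYZ_ellipsoid_eq by (subst minkowski_functional_ellipsoid) (simp_all add: LYZ_matrix_quadratic)
qed

end

section \<open>The functional ellipsoid of a Gaussian of the gauge\<close>

context cart_body
begin

definition gauss :: "real ^ 'n \<Rightarrow> real" where
  "gauss x = exp (- ((gauge x)\<^sup>2 / 2))"

lemma neg_log_gauss: "neg_log gauss x = ereal ((gauge x)\<^sup>2 / 2)"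
  by (simp add: neg_log_def gauss_def)

lemma gauss_measurable: "gauss \<in> borel_measurable lebesgue"
  unfolding gauss_def by measurable

text \<open>
  The bound is \<open>\<langle>x, y\<rangle> \<le> g x h(y) \<le> (g x)\<^sup>2 / 2 + h(y)\<^sup>2 / 2\<close>. It is attained at \<open>h(y) z\<close>, where \<open>z\<close> is a
  point of \<open>K\<close> that maximizes the product with \<open>y\<close>.
\<close>

lemma functional_support_gauss: "functional_support gauss y = ereal ((supp y)\<^sup>2 / 2)"
  unfolding functional_support_def legendre_conjugate_def neg_log_gauss
proof (rule antisym)
  show "(SUP x. ereal (y \<bullet> x) - ereal ((gauge x)\<^sup>2 / 2)) \<le> ereal ((supp y)\<^sup>2 / 2)"
  proof (rule SUP_least)
    fix x
    have "y \<bullet> x \<le> gauge x * supp y"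
      using inner_le_gauge_supp[of x y] by (simp add: inner_commute)
    moreover have "0 \<le> (gauge x - supp y)\<^sup>2"
      by simp
    ultimately have "y \<bullet> x - (gauge x)\<^sup>2 / 2 \<le> (supp y)\<^sup>2 / 2"
      by (simp add: power2_diff)
    then show "ereal (y \<bullet> x) - ereal ((gauge x)\<^sup>2 / 2) \<le> ereal ((supp y)\<^sup>2 / 2)"
      by simp
  qed
  obtain z where z: "z \<in> K" "z \<bullet> y = supp y"
    using supp_attained by blast
  let ?x = "supp y *\<^sub>R z"
  have "gauge ?x \<le> supp y"
    using z(1) supp_nonneg[of y] by (simp add: gauge_scale in_K_iff mult_left_le)
  then have "(gauge ?x)\<^sup>2 \<le> (supp y)\<^sup>2"
    using gauge_nonneg by (intro power_mono) auto
  then have "(supp y)\<^sup>2 / 2 \<le> y \<bullet> ?x - (gauge ?x)\<^sup>2 / 2"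
    using z(2) by (simp add: inner_commute power2_eq_square)
  then have "ereal ((supp y)\<^sup>2 / 2) \<le> ereal (y \<bullet> ?x) - ereal ((gauge ?x)\<^sup>2 / 2)"
    by simp
  also have "\<dots> \<le> (SUP x. ereal (y \<bullet> x) - ereal ((gauge x)\<^sup>2 / 2))"
    by (rule SUP_upper) simp
  finally show "ereal ((supp y)\<^sup>2 / 2) \<le> (SUP x. ereal (y \<bullet> x) - ereal ((gauge x)\<^sup>2 / 2))" .
qed

lemma gradient_half_square:
  assumes x: "x \<in> smooth_points"
  shows "gradient (\<lambda>x. (gauge x)\<^sup>2 / 2) x = gauge x *\<^sub>R grad x"
proof (rule gradient_eqI)
  have "((\<lambda>y. (1 / 2) * (gauge y)\<^sup>2) has_derivative (\<lambda>h. (1 / 2) * (real 2 * (h \<bullet> grad x) * gauge x ^ (2 - 1)))) (at x)"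
    by (intro has_derivative_mult_right has_derivative_power has_grad x)
  then show "((\<lambda>y. (gauge y)\<^sup>2 / 2) has_derivative (\<lambda>h. h \<bullet> (gauge x *\<^sub>R grad x))) (at x)"
    by (simp add: mult_ac)
qed

lemma half_square_gradient_measurable:
  "gradient (\<lambda>x. (gauge x)\<^sup>2 / 2) \<in> borel_measurable lebesgue"
proof (rule lebesgue_measurable_AE_cong)
  show "(\<lambda>x. gauge x *\<^sub>R grad x) \<in> borel_measurable lebesgue"
    using grad_measurable by measurable
  show "AE x in lebesgue. gauge x *\<^sub>R grad x = gradient (\<lambda>x. (gauge x)\<^sup>2 / 2) x"
    using AE_smooth by eventually_elim (simp add: gradient_half_square)
qed

text \<open>
  At \<open>y = g \<nabla>g\<close> the conjugate equals \<open>h(y)\<^sup>2 / 2 = g\<^sup>2 / 2\<close>, because \<open>h(\<nabla>g) = 1\<close>; the factor \<open>g\<^sup>2\<close> in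
  \<open>\<langle>u, y\<rangle>\<^sup>2\<close> cancels.
\<close>

lemma functional_integral:
  "(LINT y|functional_surface_area_measure gauss.
      \<bar>u \<bullet> y\<bar>\<^sup>2 * real_of_ereal (inverse (functional_support gauss y)))
    = 2 * (LINT x|lebesgue. gauss x * (u \<bullet> grad x)\<^sup>2)"
proof -
  let ?\<phi> = "\<lambda>x. (gauge x)\<^sup>2 / 2"
  let ?H = "\<lambda>y. \<bar>u \<bullet> y\<bar>\<^sup>2 * real_of_ereal (inverse (functional_support gauss y))"
  let ?H' = "\<lambda>y. \<bar>u \<bullet> y\<bar>\<^sup>2 * inverse ((supp y)\<^sup>2 / 2)"
  have H: "?H y = ?H' y" for y
    unfolding functional_support_gauss by (cases "(supp y)\<^sup>2 / 2 = 0") (auto simp: zero_ereal_def[symmetric])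
  have Hm: "?H' \<in> borel_measurable borel"
    by measurable
  have \<phi>: "(\<lambda>x. real_of_ereal (neg_log gauss x)) = ?\<phi>"
    by (simp add: neg_log_gauss)
  have dens: "gradient ?\<phi> \<in> density lebesgue (\<lambda>x. ennreal (gauss x)) \<rightarrow>\<^sub>M borel"
    using half_square_gradient_measurable by simp
  have "(LINT y|functional_surface_area_measure gauss. ?H y) = (LINT x|density lebesgue (\<lambda>x. ennreal (gauss x)). ?H' (gradient ?\<phi> x))"
    unfolding functional_surface_area_measure_def \<phi> H by (rule integral_distr[OF dens Hm])
  also have "\<dots> = (LINT x|lebesgue. gauss x *\<^sub>R ?H' (gradient ?\<phi> x))"
    using measurable_compose[OF half_square_gradient_measurable Hm] gauss_measurable
    by (intro integral_density) (auto simp: gauss_def)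
  also have "\<dots> = (LINT x|lebesgue. 2 * (gauss x * (u \<bullet> grad x)\<^sup>2))"
  proof (rule integral_cong_AE)
    show "AE x in lebesgue. gauss x *\<^sub>R ?H' (gradient ?\<phi> x) = 2 * (gauss x * (u \<bullet> grad x)\<^sup>2)"
      using AE_smooth
    proof eventually_elim
      case (elim x)
      have g: "0 < gauge x"
        using gauge_pos[OF smooth_nonzero[OF elim]] .
      have "supp (gauge x *\<^sub>R grad x) = gauge x"
        using g supp_grad[OF elim] by (simp add: supp_scale)
      then have "?H' (gauge x *\<^sub>R grad x) = 2 * (u \<bullet> grad x)\<^sup>2"
        using g by (simp add: power_mult_distrib field_simps)
      then show ?case
        by (simp add: gradient_half_square[OF elim])
    qed
    show "(\<lambda>x. gauss x *\<^sub>R ?H' (gradient ?\<phi> x)) \<in> borel_measurable lebesgue"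
      using measurable_compose[OF half_square_gradient_measurable Hm] gauss_measurable
      by (intro borel_measurable_scaleR)
    show "(\<lambda>x. 2 * (gauss x * (u \<bullet> grad x)\<^sup>2)) \<in> borel_measurable lebesgue"
      using gauss_measurable inner_grad_measurable[of u] by measurable
  qed
  finally show ?thesis by simp
qed

text \<open>
  \<open>homogeneous_average\<close> for \<open>\<langle>u, \<nabla>g\<rangle>\<^sup>2\<close> and the Gaussian function of the gauge.
\<close>

lemma gauss_average:
  "measure lebesgue K * (LINT x|lebesgue. gauss x * (u \<bullet> grad x)\<^sup>2) = grad_energy u * total_mass gauss"
proof -
  let ?G = "\<lambda>x. (u \<bullet> grad x)\<^sup>2"
  have Gm: "?G \<in> borel_measurable lebesgue"
    using inner_grad_measurable[of u] by measurable
  have energy: "grad_energy u = enn2real (\<integral>\<^sup>+x\<in>K. ennreal (?G x) \<partial>lebesgue)"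
  proof -
    have "grad_energy u = enn2real (\<integral>\<^sup>+x. ennreal (indicator K x * ?G x) \<partial>lebesgue)"
      unfolding grad_energy_def using Gm K_lebesgue
      by (intro integral_eq_nn_integral borel_measurable_times borel_measurable_indicator) auto
    also have "(\<integral>\<^sup>+x. ennreal (indicator K x * ?G x) \<partial>lebesgue) = (\<integral>\<^sup>+x\<in>K. ennreal (?G x) \<partial>lebesgue)"
      by (intro nn_integral_cong) (simp add: indicator_def)
    finally show ?thesis .
  qed
  have "integrable lebesgue (\<lambda>x. indicator K x * ?G x)"
    using energy_integrable[of u u] by (simp add: power2_eq_square)
  then have "(\<integral>\<^sup>+x. ennreal (norm (indicator K x * ?G x)) \<partial>lebesgue) < \<infinity>"
    by (simp add: integrable_iff_bounded)
  also have "(\<integral>\<^sup>+x. ennreal (norm (indicator K x * ?G x)) \<partial>lebesgue) = (\<integral>\<^sup>+x\<in>K. ennreal (?G x) \<partial>lebesgue)"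
    by (intro nn_integral_cong) (simp add: indicator_def)
  finally have fin: "(\<integral>\<^sup>+x\<in>K. ennreal (?G x) \<partial>lebesgue) < \<infinity>" .
  have "emeasure lebesgue K * (\<integral>\<^sup>+x. ennreal (exp (- ((gauge x)\<^sup>2 / 2)) * ?G x) \<partial>lebesgue) =
      (\<integral>\<^sup>+x\<in>K. ennreal (?G x) \<partial>lebesgue) * (\<integral>\<^sup>+x. ennreal (exp (- ((gauge x)\<^sup>2 / 2))) \<partial>lebesgue)"
    using fin by (intro homogeneous_average[where F = "\<lambda>s. exp (- (s\<^sup>2 / 2))"] Gm) (auto simp: grad_scale)
  then have "enn2real (emeasure lebesgue K * (\<integral>\<^sup>+x. ennreal (gauss x * ?G x) \<partial>lebesgue)) =
      enn2real ((\<integral>\<^sup>+x\<in>K. ennreal (?G x) \<partial>lebesgue) * (\<integral>\<^sup>+x. ennreal (gauss x) \<partial>lebesgue))"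
    by (simp add: gauss_def)
  moreover have "(LINT x|lebesgue. gauss x * ?G x) = enn2real (\<integral>\<^sup>+x. ennreal (gauss x * ?G x) \<partial>lebesgue)"
    using gauss_measurable Gm by (intro integral_eq_nn_integral borel_measurable_times) (auto simp: gauss_def)
  moreover have "total_mass gauss = enn2real (\<integral>\<^sup>+x. ennreal (gauss x) \<partial>lebesgue)"
    unfolding total_mass_def using gauss_measurable by (intro integral_eq_nn_integral) (auto simp: gauss_def)
  ultimately show ?thesis
    by (simp add: enn2real_mult energy measure_def)
qed

lemma total_mass_gauss_pos: "0 < total_mass gauss"
proof -
  let ?J = "\<integral>\<^sup>+x. ennreal (gauss x) \<partial>lebesgue"
  have J: "total_mass gauss = enn2real ?J"
    unfolding total_mass_def using gauss_measurable by (intro integral_eq_nn_integral) (auto simp: gauss_def)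
  have "?J < \<infinity>"
    using gaussian_mass_finite by (simp add: gauss_def)
  moreover have "?J \<noteq> 0"
  proof
    assume "?J = 0"
    then have "AE x in lebesgue. ennreal (gauss x) = 0"
      using gauss_measurable by (subst (asm) nn_integral_0_iff_AE) auto
    then have "AE x in lebesgue. x \<notin> K"
      by eventually_elim (simp add: gauss_def)
    then have "K \<in> null_sets lebesgue"
      using K_lebesgue by (simp add: AE_iff_null_sets)
    then show False
      using K_volume_pos by (simp add: measure_def null_setsD1)
  qed
  ultimately show ?thesis
    unfolding J by (simp add: enn2real_positive_iff zero_less_iff_neq_zero)
qed

proposition functional_LYZ_gauss:
  "functional_LYZ_ellipsoid gauss u = exp (- ((minkowski_functional (LYZ_ellipsoid K) u)\<^sup>2 / 2))"
proof -
  let ?J = "total_mass gauss" and ?V = "measure lebesgue K"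
  have "(LINT x|lebesgue. gauss x * (u \<bullet> grad x)\<^sup>2) = grad_energy u * ?J / ?V"
    using gauss_average[of u] K_volume_pos by (simp add: field_simps)
  then have "real CARD('n) / (4 * ?J) * (2 * (LINT x|lebesgue. gauss x * (u \<bullet> grad x)\<^sup>2))
      = real CARD('n) / ?V * grad_energy u / 2"
    using total_mass_gauss_pos by simp
  then show ?thesis
    unfolding functional_LYZ_ellipsoid_def functional_integral minkowski_functional_LYZ_ellipsoid by simp
qed

end

theorem lemma3p1:
  fixes K :: "(real ^ 'n) set" and f :: "real ^ 'n \<Rightarrow> real"
  assumes "convex_body K"
    and "0 \<in> interior K"
    and "\<And>x. f x = exp (- ((minkowski_functional K x)\<^sup>2 / 2))"
  shows "\<forall>x. functional_LYZ_ellipsoid f x =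
           exp (- ((minkowski_functional (LYZ_ellipsoid K) x)\<^sup>2 / 2))"
proof -
  interpret cart_body K
    by standard (rule assms)+
  have "f = gauss"
    using assms(3) by (simp add: fun_eq_iff gauss_def)
  then show ?thesis
    using functional_LYZ_gauss by simp
qed

end
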